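(* Let $\mathcal{H}$ be the extended affine Hecke algebra over $\mathbb{C}[v,v^{-1}]$ associated to a finite Weyl group $W$, its integral weight lattice $X$ and a parameter set. Then $\mathcal{H}$ is a free Frobenius extension of its centre $\mathcal{Z}_{\mathcal{H}}=\mathbb{C}[v,v^{-1}][X]^W$. In general this extension is not symmetric; that is, there exist a Weyl group and a parameter set for which it is not symmetric.
   Context: Extended affine Hecke algebra (Lusztig): let $W$ be a finite Weyl group, i.e. the Weyl group of a reduced crystallographic root system, with simple roots $\Pi$, simple coroots $\check\alpha$, simple reflections $s_\alpha$, length function $l$ and integral weight lattice $X$. Let $v$ be an indeterminate. A parameter set is a function $\lambda:\Pi\to\mathbb{Z}_{\geq0}$ with $\lambda(\alpha)=\lambda(\beta)$ whenever $s_\alpha,s_\beta$ are conjugate in $W$. $\mathcal{H}$ is the $\mathbb{C}[v,v^{-1}]$-algebra with $\mathbb{C}[v,v^{-1}]$-basis $T_w\theta_x$ ($w\in W$, $x\in X$), with multiplication determined by: $T_wT_{w'}=T_{ww'}$ if $l(ww')=l(w)+l(w')$; $(T_{s_\alpha}+1)(T_{s_\alpha}-v^{2\lambda(\alpha)})=0$; $\theta_x\theta_{x'}=\theta_{x+x'}$, $\theta_0=1$; and $\theta_xT_{s_\alpha}-T_{s_\alpha}\theta_{s_\alpha(x)}=(v^{2\lambda(\alpha)}-1)\frac{\theta_x-\theta_{s_\alpha(x)}}{1-\theta_{-\alpha}}$ for $\alpha\in\Pi$. The subalgebra spanned by the $\theta_x$ is the Laurent polynomial algebra $\mathbb{C}[v,v^{-1}][X]$,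 and the centre of $\mathcal{H}$ is $\mathcal{Z}_{\mathcal{H}}=\mathbb{C}[v,v^{-1}][X]^W$, over which $\mathcal{H}$ is free of rank $|W|^2$. Frobenius extensions: let $\mathcal{Z}$ be a subring of the centre of a ring $R$. $R$ is a free Frobenius extension of $\mathcal{Z}$ if $R$ is a free $\mathcal{Z}$-module of finite rank and there is an isomorphism $F:R\to\mathrm{Hom}_{\mathcal{Z}}(R,\mathcal{Z})$ of $R$-$\mathcal{Z}$-bimodules, where $(r\cdot f\cdot s)(x)=f(xr)s$. Put $\mathbb{B}(r,t)=F(t)(r)$. The Nakayama automorphism is the $\mathcal{Z}$-algebra automorphism $\nu$ of $R$ with $\mathbb{B}(x,y)=\mathbb{B}(\nu(y),x)$ for all $x,y$; it is unique up to inner automorphisms. The extension is symmetric if $\nu$ is inner. *)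

theory Defs
  imports
    "HOL-Analysis.Analysis"
    "HOL-Algebra.QuotRing"
    "HOL-Algebra.Subrings"
    "HOL-Library.Poly_Mapping"
begin

section \<open>Root systems\<close>

definition coroot_pairing :: "'a::euclidean_space \<Rightarrow> 'a \<Rightarrow> real" where
  "coroot_pairing x \<alpha> = 2 * (x \<bullet> \<alpha>) / (\<alpha> \<bullet> \<alpha>)"

definition reflection :: "'a::euclidean_space \<Rightarrow> 'a \<Rightarrow> 'a" where
  "reflection \<alpha> x = x - coroot_pairing x \<alpha> *\<^sub>R \<alpha>"

text \<open>
  A root system is a root system of the space \<open>span \<Phi>\<close>, which may be a proper subspace of the
  ambient Euclidean space.
\<close>

definition reduced_root_system :: "'a::euclidean_space set \<Rightarrow> bool" where
  "reduced_root_system \<Phi> \<longleftrightarrow>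
     finite \<Phi> \<and> 0 \<notin> \<Phi> \<and>
     (\<forall>\<alpha>\<in>\<Phi>. \<forall>\<beta>\<in>\<Phi>. reflection \<alpha> \<beta> \<in> \<Phi>) \<and>
     (\<forall>\<alpha>\<in>\<Phi>. \<forall>\<beta>\<in>\<Phi>. coroot_pairing \<beta> \<alpha> \<in> \<int>) \<and>
     (\<forall>\<alpha>\<in>\<Phi>. \<forall>c. c *\<^sub>R \<alpha> \<in> \<Phi> \<longrightarrow> c = 1 \<or> c = -1)"

definition simple_roots :: "'a::euclidean_space set \<Rightarrow> 'a set \<Rightarrow> bool" where
  "simple_roots \<Phi> \<Delta> \<longleftrightarrow>
     \<Delta> \<subseteq> \<Phi> \<and> independent \<Delta> \<and>
     (\<forall>\<beta>\<in>\<Phi>. \<exists>c :: 'a \<Rightarrow> nat.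
        \<beta> = (\<Sum>\<alpha>\<in>\<Delta>. real (c \<alpha>) *\<^sub>R \<alpha>) \<or> \<beta> = - (\<Sum>\<alpha>\<in>\<Delta>. real (c \<alpha>) *\<^sub>R \<alpha>))"

text \<open>
  The elements of the Weyl group are maps on the ambient space; they fix the orthogonal complement
  of \<open>span \<Phi>\<close> pointwise. As reflections are involutions, closure under products suffices.
\<close>

inductive_set weyl_group :: "'a::euclidean_space set \<Rightarrow> ('a \<Rightarrow> 'a) set"
  for \<Phi> :: "'a set" where
  id: "id \<in> weyl_group \<Phi>"
| step: "w \<in> weyl_group \<Phi> \<Longrightarrow> \<alpha> \<in> \<Phi> \<Longrightarrow> reflection \<alpha> \<circ> w \<in> weyl_group \<Phi>"

definition weyl_length :: "'a::euclidean_space set \<Rightarrow> ('a \<Rightarrow> 'a) \<Rightarrow> nat" where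
  "weyl_length \<Delta> w =
     (LEAST n. \<exists>\<alpha>s. set \<alpha>s \<subseteq> \<Delta> \<and> length \<alpha>s = n \<and> w = foldr (\<lambda>\<alpha> u. reflection \<alpha> \<circ> u) \<alpha>s id)"

definition weight_lattice :: "'a::euclidean_space set \<Rightarrow> 'a set" where
  "weight_lattice \<Phi> = {x \<in> span \<Phi>. \<forall>\<alpha>\<in>\<Phi>. coroot_pairing x \<alpha> \<in> \<int>}"

definition parameter_set :: "'a::euclidean_space set \<Rightarrow> 'a set \<Rightarrow> ('a \<Rightarrow> nat) \<Rightarrow> bool" where
  "parameter_set \<Phi> \<Delta> L \<longleftrightarrow>
     (\<forall>\<alpha>\<in>\<Delta>. \<forall>\<beta>\<in>\<Delta>.
        (\<exists>w\<in>weyl_group \<Phi>. w \<circ> reflection \<alpha> = reflection \<beta> \<circ> w) \<longrightarrow> L \<alpha> = L \<beta>)"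

section \<open>The extended affine Hecke algebra\<close>

text \<open>
  The group algebra of the integers over the complex numbers, with the convolution product of
  \<^type>\<open>poly_mapping\<close>, is the ring of complex Laurent polynomials in an indeterminate \<open>v\<close>.
\<close>

type_synonym laurent = "int \<Rightarrow>\<^sub>0 complex"

definition v_power :: "int \<Rightarrow> laurent" where
  "v_power k = Poly_Mapping.single k 1"

text \<open>
  Likewise the elements of \<^typ>\<open>'a \<Rightarrow>\<^sub>0 laurent\<close> with keys in \<open>X\<close> form the group algebra of \<open>X\<close>
  over the Laurent polynomials; \<open>theta_embed\<close> is its image in a ring \<open>H\<close>, where \<open>\<iota>\<close> gives the
  scalars of \<open>H\<close> and \<open>\<theta> x\<close> the image of the group element \<open>x\<close>.
\<close>

definition theta_embed ::
  "('h, 'm) ring_scheme \<Rightarrow> (laurent \<Rightarrow> 'h) \<Rightarrow> ('a \<Rightarrow> 'h) \<Rightarrow> ('a \<Rightarrow>\<^sub>0 laurent) \<Rightarrow> 'h" where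
  "theta_embed H \<iota> \<theta> q =
     finsum H (\<lambda>x. \<iota> (Poly_Mapping.lookup q x) \<otimes>\<^bsub>H\<^esub> \<theta> x) (Poly_Mapping.keys q)"

definition hecke_combination ::
  "('h, 'm) ring_scheme \<Rightarrow> (laurent \<Rightarrow> 'h) \<Rightarrow> (('a \<Rightarrow> 'a) \<Rightarrow> 'h) \<Rightarrow> ('a \<Rightarrow> 'h) \<Rightarrow>
   (('a \<Rightarrow> 'a) \<times> 'a \<Rightarrow>\<^sub>0 laurent) \<Rightarrow> 'h" where
  "hecke_combination H \<iota> T \<theta> c =
     finsum H (\<lambda>(w, x). \<iota> (Poly_Mapping.lookup c (w, x)) \<otimes>\<^bsub>H\<^esub> (T w \<otimes>\<^bsub>H\<^esub> \<theta> x)) (Poly_Mapping.keys c)"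

text \<open>
  The structure of an algebra over the Laurent polynomials on \<open>H\<close> is the unital ring homomorphism
  \<open>\<iota>\<close> into the centre. The quotient in the Bernstein relation is formed in the group algebra of
  \<open>X\<close>, as the element \<open>q\<close> whose product with \<open>1 - \<theta>\<^sub>-\<^sub>\<alpha>\<close> is \<open>\<theta>\<^sub>x - \<theta>\<^sub>s\<^sub>x\<close>; it exists and is unique.
\<close>

locale affine_hecke_algebra = ring H
  for \<Phi> \<Delta> :: "'a::euclidean_space set" and L :: "'a \<Rightarrow> nat"
    and H :: "('h, 'm) ring_scheme" (structure)
    and \<iota> :: "laurent \<Rightarrow> 'h" and T :: "('a \<Rightarrow> 'a) \<Rightarrow> 'h" and \<theta> :: "'a \<Rightarrow> 'h" +
  assumes scalar_closed: "\<iota> a \<in> carrier H"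
    and scalar_one: "\<iota> 1 = \<one>"
    and scalar_add: "\<iota> (a + b) = \<iota> a \<oplus> \<iota> b"
    and scalar_mult: "\<iota> (a * b) = \<iota> a \<otimes> \<iota> b"
    and scalar_central: "h \<in> carrier H \<Longrightarrow> \<iota> a \<otimes> h = h \<otimes> \<iota> a"
    and T_closed: "w \<in> weyl_group \<Phi> \<Longrightarrow> T w \<in> carrier H"
    and theta_closed: "x \<in> weight_lattice \<Phi> \<Longrightarrow> \<theta> x \<in> carrier H"
    and basis: "h \<in> carrier H \<Longrightarrow>
      \<exists>!c. Poly_Mapping.keys c \<subseteq> weyl_group \<Phi> \<times> weight_lattice \<Phi> \<and> h = hecke_combination H \<iota> T \<theta> c"
    and T_mult: "\<lbrakk>w \<in> weyl_group \<Phi>; w' \<in> weyl_group \<Phi>;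
        weyl_length \<Delta> (w \<circ> w') = weyl_length \<Delta> w + weyl_length \<Delta> w'\<rbrakk> \<Longrightarrow>
      T w \<otimes> T w' = T (w \<circ> w')"
    and T_quadratic: "\<alpha> \<in> \<Delta> \<Longrightarrow>
      (T (reflection \<alpha>) \<oplus> \<one>) \<otimes> (T (reflection \<alpha>) \<ominus> \<iota> (v_power (2 * int (L \<alpha>)))) = \<zero>"
    and theta_mult: "\<lbrakk>x \<in> weight_lattice \<Phi>; y \<in> weight_lattice \<Phi>\<rbrakk> \<Longrightarrow> \<theta> x \<otimes> \<theta> y = \<theta> (x + y)"
    and theta_zero: "\<theta> 0 = \<one>"
    and bernstein: "\<lbrakk>\<alpha> \<in> \<Delta>; x \<in> weight_lattice \<Phi>\<rbrakk> \<Longrightarrow>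
      \<exists>q :: 'a \<Rightarrow>\<^sub>0 laurent. Poly_Mapping.keys q \<subseteq> weight_lattice \<Phi> \<and>
        q * (1 - Poly_Mapping.single (- \<alpha>) 1)
          = Poly_Mapping.single x 1 - Poly_Mapping.single (reflection \<alpha> x) 1 \<and>
        \<theta> x \<otimes> T (reflection \<alpha>) \<ominus> T (reflection \<alpha>) \<otimes> \<theta> (reflection \<alpha> x)
          = \<iota> (v_power (2 * int (L \<alpha>)) - 1) \<otimes> theta_embed H \<iota> \<theta> q"

text \<open>The subset \<open>\<complex>[v,v\<^sup>-\<^sup>1][X]\<^sup>W\<close> of \<open>H\<close>.\<close>

definition theta_invariants ::
  "'a::euclidean_space set \<Rightarrow> ('h, 'm) ring_scheme \<Rightarrow> (laurent \<Rightarrow> 'h) \<Rightarrow> ('a \<Rightarrow> 'h) \<Rightarrow> 'h set" where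
  "theta_invariants \<Phi> H \<iota> \<theta> =
     theta_embed H \<iota> \<theta> ` {q. Poly_Mapping.keys q \<subseteq> weight_lattice \<Phi> \<and>
       (\<forall>w\<in>weyl_group \<Phi>. \<forall>x\<in>weight_lattice \<Phi>. Poly_Mapping.lookup q (w x) = Poly_Mapping.lookup q x)}"

section \<open>Frobenius extensions\<close>

definition ring_centre :: "('r, 'm) ring_scheme \<Rightarrow> 'r set" where
  "ring_centre R = {z \<in> carrier R. \<forall>r\<in>carrier R. z \<otimes>\<^bsub>R\<^esub> r = r \<otimes>\<^bsub>R\<^esub> z}"

definition free_basis_over :: "('r, 'm) ring_scheme \<Rightarrow> 'r set \<Rightarrow> 'r set \<Rightarrow> bool" where
  "free_basis_over R Z B \<longleftrightarrow>
     B \<subseteq> carrier R \<and>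
     (\<forall>r\<in>carrier R. \<exists>!c. c \<in> B \<rightarrow>\<^sub>E Z \<and> r = finsum R (\<lambda>b. c b \<otimes>\<^bsub>R\<^esub> b) B)"

definition Hom_over :: "('r, 'm) ring_scheme \<Rightarrow> 'r set \<Rightarrow> ('r \<Rightarrow> 'r) set" where
  "Hom_over R Z =
     {f \<in> carrier R \<rightarrow>\<^sub>E Z.
        (\<forall>x\<in>carrier R. \<forall>y\<in>carrier R. f (x \<oplus>\<^bsub>R\<^esub> y) = f x \<oplus>\<^bsub>R\<^esub> f y) \<and>
        (\<forall>z\<in>Z. \<forall>x\<in>carrier R. f (z \<otimes>\<^bsub>R\<^esub> x) = z \<otimes>\<^bsub>R\<^esub> f x)}"

text \<open>
  Isomorphisms of \<open>R\<close>-\<open>Z\<close>-bimodules from \<open>R\<close> to \<open>Hom_over R Z\<close>, on which \<open>R\<close> and \<open>Z\<close> act by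
  \<open>(r \<cdot> f \<cdot> s) x = f (x r) s\<close>.
\<close>

definition frobenius_iso ::
  "('r, 'm) ring_scheme \<Rightarrow> 'r set \<Rightarrow> ('r \<Rightarrow> 'r \<Rightarrow> 'r) \<Rightarrow> bool" where
  "frobenius_iso R Z F \<longleftrightarrow>
     bij_betw F (carrier R) (Hom_over R Z) \<and>
     (\<forall>t\<in>carrier R. \<forall>u\<in>carrier R. \<forall>x\<in>carrier R. F (t \<oplus>\<^bsub>R\<^esub> u) x = F t x \<oplus>\<^bsub>R\<^esub> F u x) \<and>
     (\<forall>r\<in>carrier R. \<forall>t\<in>carrier R. \<forall>s\<in>Z. \<forall>x\<in>carrier R.
        F (r \<otimes>\<^bsub>R\<^esub> t \<otimes>\<^bsub>R\<^esub> s) x = F t (x \<otimes>\<^bsub>R\<^esub> r) \<otimes>\<^bsub>R\<^esub> s)"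

definition free_frobenius_extension :: "('r, 'm) ring_scheme \<Rightarrow> 'r set \<Rightarrow> bool" where
  "free_frobenius_extension R Z \<longleftrightarrow>
     ring R \<and> subring Z R \<and> Z \<subseteq> ring_centre R \<and>
     (\<exists>B. finite B \<and> free_basis_over R Z B) \<and>
     (\<exists>F. frobenius_iso R Z F)"

definition nakayama_automorphism ::
  "('r, 'm) ring_scheme \<Rightarrow> 'r set \<Rightarrow> ('r \<Rightarrow> 'r \<Rightarrow> 'r) \<Rightarrow> ('r \<Rightarrow> 'r) \<Rightarrow> bool" where
  "nakayama_automorphism R Z F \<nu> \<longleftrightarrow>
     \<nu> \<in> ring_iso R R \<and> (\<forall>z\<in>Z. \<nu> z = z) \<and>
     (let \<B> = (\<lambda>r t. F t r) in \<forall>x\<in>carrier R. \<forall>y\<in>carrier R. \<B> x y = \<B> (\<nu> y) x)"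

definition inner_automorphism :: "('r, 'm) ring_scheme \<Rightarrow> ('r \<Rightarrow> 'r) \<Rightarrow> bool" where
  "inner_automorphism R \<nu> \<longleftrightarrow>
     (\<exists>u\<in>Units R. \<forall>x\<in>carrier R. \<nu> x = u \<otimes>\<^bsub>R\<^esub> x \<otimes>\<^bsub>R\<^esub> inv\<^bsub>R\<^esub> u)"

text \<open>
  Different choices of \<open>F\<close> change \<open>\<nu>\<close> by an inner automorphism only, so quantifying existentially or
  universally over \<open>F\<close> amounts to the same.
\<close>

definition symmetric_frobenius_extension :: "('r, 'm) ring_scheme \<Rightarrow> 'r set \<Rightarrow> bool" where
  "symmetric_frobenius_extension R Z \<longleftrightarrow>
     free_frobenius_extension R Z \<and>
     (\<exists>F \<nu>. frobenius_iso R Z F \<and> nakayama_automorphism R Z F \<nu> \<and> inner_automorphism R \<nu>)"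

end

theory Submission
  imports Defs "Jordan_Normal_Form.Determinant"
begin

text \<open>
  Write \<open>S\<close> for the group algebra of the weight lattice \<open>X\<close>. The alternating sum over \<open>W\<close>, divided by
  the Weyl denominator, is a form \<open>S \<rightarrow> S\<^sup>W\<close>. Its Gram matrix on Steinberg's family \<open>w\<^sup>-\<^sup>1 \<lambda>\<^sub>w\<close>, where
  \<open>\<lambda>\<^sub>w\<close> is the sum of the fundamental weights of the left descents of \<open>w\<close>, has determinant \<open>1\<close> or
  \<open>-1\<close>, as a comparison of leading terms shows; so \<open>S\<close> is free over \<open>S\<^sup>W\<close> and the form is perfect.

  In \<open>H\<close>, moving an element of \<open>S\<close> past \<open>T\<^sub>w\<close> twists it by \<open>w\<^sup>-\<^sup>1\<close> up to terms of smaller length. Hence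
  the centre is \<open>S\<^sup>W\<close>. The form on \<open>H\<close> which takes the coefficient of \<open>T\<^sub>1\<close> and applies the form on \<open>S\<close>
  is a Frobenius form, because its Gram matrix is triangular by length with unit multiples of the
  perfect form on \<open>S\<close> in the diagonal blocks.

  For \<open>A\<^sub>1\<close> with the zero parameter, \<open>H\<close> is the smash product of \<open>S\<close> with \<open>W\<close>. If it were symmetric,
  there would be a trace form on \<open>H\<close> that represents all functionals; a trace form vanishes on
  \<open>T\<^sub>s S\<close> and is invariant under \<open>s\<close> on \<open>S\<close>. Representing the form above and setting all \<open>\<theta>\<^sub>x = 1\<close> gives
  \<open>2 = 0\<close>.
\<close>

text \<open>The determinant is a unit for reasons of degree. Let \<open>M\<close> hold all
  translates of Steinberg's family, with one row for each element of W, and let \<open>A\<close> be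
  its transpose with signed columns. Then \<open>A * M\<close> is \<open>denom\<close> times the
  Gram matrix, so up to sign the squared determinant of \<open>M\<close> is \<open>denom ^ n\<close>
  times the Gram determinant. A simple reflection interchanges the elements with and without the
  corresponding left descent, so each fundamental weight is used by half of the family. Hence the
  square and \<open>denom ^ n\<close> have the same leading exponent, and the remaining factor is an
  invariant without exponents of positive height, which leaves a constant. That the identity
  permutation alone supplies the leading term takes two rounds of maximality, first for dominant
  weights and then inside their stabilizers. Throughout, cancellation comes from a leading
  coefficient 1 in the direction of some vector, so no factorization theory of the group algebra
  enters. The zero parameter suits the example because the Bernstein relation then has no error term
  and the trace condition can be solved explicitly.\<close>

no_notation Matrix.scalar_prod (infix \<open>\<bullet>\<close> 70)

section \<open>Root systems and Weyl groups\<close>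

abbreviation winv :: "('a \<Rightarrow> 'a) \<Rightarrow> 'a \<Rightarrow> 'a" where "winv \<equiv> inv_into UNIV"

lemma linear_reflection: "linear (reflection \<alpha>)"
  unfolding reflection_def coroot_pairing_def
  by (rule linearI) (simp_all add: inner_add_left add_divide_distrib ring_distribs scaleR_add_left
      scaleR_diff_right)

lemma reflection_inner [simp]: "reflection \<alpha> x \<bullet> reflection \<alpha> y = x \<bullet> y"
proof (cases "\<alpha> = 0")
  case False
  then have "\<alpha> \<bullet> \<alpha> \<noteq> 0" by simp
  then show ?thesis
    unfolding reflection_def coroot_pairing_def
    by (simp add: inner_diff_left inner_diff_right field_simps inner_commute)
qed (simp add: reflection_def)

lemma reflection_self: "\<alpha> \<noteq> 0 \<Longrightarrow> reflection \<alpha> \<alpha> = - \<alpha>"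
  by (simp add: reflection_def coroot_pairing_def scaleR_2)

lemma reflection_invol [simp]: "reflection \<alpha> (reflection \<alpha> x) = x"
proof (cases "\<alpha> = 0")
  case False
  have "reflection \<alpha> (reflection \<alpha> x) = reflection \<alpha> x - coroot_pairing x \<alpha> *\<^sub>R reflection \<alpha> \<alpha>"
    using linear_diff[OF linear_reflection, of \<alpha> x] linear_scale[OF linear_reflection, of \<alpha>]
    by (metis reflection_def)
  also have "\<dots> = x"
    using False by (simp add: reflection_self) (simp add: reflection_def)
  finally show ?thesis .
qed (simp add: reflection_def)

lemma reflection_comp_self [simp]: "reflection \<alpha> \<circ> reflection \<alpha> = id"
  by auto

lemma reflection_uminus [simp]: "reflection (- \<alpha>) = reflection \<alpha>"
  by (rule ext) (simp add: reflection_def coroot_pairing_def)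

lemma reflection_conj:
  assumes "linear w" "\<And>x y. w x \<bullet> w y = x \<bullet> y"
  shows "w (reflection \<alpha> x) = reflection (w \<alpha>) (w x)"
  using assms by (simp add: reflection_def coroot_pairing_def linear_diff linear_scale)

text \<open>The functional is represented by an inner product in the ambient space, and the
  representing vector is then projected to \<open>V\<close>. The projection matters because the
  roots may span a proper subspace, in which the fundamental weights must lie.\<close>

lemma exists_dual_vector:
  fixes \<Delta> :: "'a::euclidean_space set"
  assumes "independent \<Delta>" "\<Delta> \<subseteq> V" "subspace V"
  shows "\<exists>\<omega>\<in>V. \<forall>\<delta>\<in>\<Delta>. \<omega> \<bullet> \<delta> = g \<delta>"
proof -
  obtain f :: "'a \<Rightarrow> real" where f: "linear f" "\<And>x. x \<in> \<Delta> \<Longrightarrow> f x = g x"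
    using linear_independent_extend[OF assms(1), of g] by auto
  define z where "z = (\<Sum>b\<in>Basis. f b *\<^sub>R b)"
  have z: "z \<bullet> x = f x" for x
  proof -
    have "f x = f (\<Sum>b\<in>Basis. (x \<bullet> b) *\<^sub>R b)" by (simp add: euclidean_representation)
    also have "\<dots> = (\<Sum>b\<in>Basis. (x \<bullet> b) * f b)"
      by (simp add: linear_sum[OF f(1)] linear_scale[OF f(1)])
    finally show ?thesis
      unfolding z_def inner_sum_left by (simp add: inner_commute mult.commute)
  qed
  obtain y u where yu: "y \<in> span V" "\<And>v. v \<in> span V \<Longrightarrow> Linear_Algebra.orthogonal u v" "z = y + u"
    using orthogonal_subspace_decomp_exists[of V z] by metis
  have V: "span V = V" using assms(3) by (simp add: span_eq_iff)
  have "y \<bullet> \<delta> = g \<delta>" if "\<delta> \<in> \<Delta>" for \<delta>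
  proof -
    have "u \<bullet> \<delta> = 0" using yu(2)[of \<delta>] that assms(2) V by (auto simp: Linear_Algebra.orthogonal_def)
    then show ?thesis using z[of \<delta>] f(2)[OF that] yu(3) by (simp add: inner_add_left)
  qed
  then show ?thesis using yu(1) V by auto
qed

lemma weyl_linear: "w \<in> weyl_group \<Phi> \<Longrightarrow> linear w"
proof (induction rule: weyl_group.induct)
  case id show ?case by (rule linear_id)
next
  case (step w \<alpha>)
  then show ?case using linear_compose[OF _ linear_reflection] by blast
qed

lemma weyl_inner: "w \<in> weyl_group \<Phi> \<Longrightarrow> w x \<bullet> w y = x \<bullet> y"
  by (induction rule: weyl_group.induct) auto

lemma weyl_comp: "w \<in> weyl_group \<Phi> \<Longrightarrow> u \<in> weyl_group \<Phi> \<Longrightarrow> w \<circ> u \<in> weyl_group \<Phi>"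
  by (induction rule: weyl_group.induct) (auto simp: comp_assoc intro: weyl_group.intros)

lemma weyl_reflection: "\<alpha> \<in> \<Phi> \<Longrightarrow> reflection \<alpha> \<in> weyl_group \<Phi>"
  using weyl_group.step[OF weyl_group.id] by simp

lemma weyl_inverse: "w \<in> weyl_group \<Phi> \<Longrightarrow> \<exists>u\<in>weyl_group \<Phi>. w \<circ> u = id \<and> u \<circ> w = id"
proof (induction rule: weyl_group.induct)
  case id show ?case by (rule bexI[of _ id]) (simp_all add: weyl_group.id)
next
  case (step w \<alpha>)
  then obtain u where u: "u \<in> weyl_group \<Phi>" "w \<circ> u = id" "u \<circ> w = id" by blast
  have "(reflection \<alpha> \<circ> w) \<circ> (u \<circ> reflection \<alpha>) = reflection \<alpha> \<circ> (w \<circ> u) \<circ> reflection \<alpha>"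
    by (simp only: comp_assoc)
  then have "(reflection \<alpha> \<circ> w) \<circ> (u \<circ> reflection \<alpha>) = id"
    by (simp only: u comp_id reflection_comp_self)
  moreover have "(u \<circ> reflection \<alpha>) \<circ> (reflection \<alpha> \<circ> w) = u \<circ> (reflection \<alpha> \<circ> reflection \<alpha>) \<circ> w"
    by (simp only: comp_assoc)
  then have "(u \<circ> reflection \<alpha>) \<circ> (reflection \<alpha> \<circ> w) = id"
    by (simp only: u comp_id reflection_comp_self)
  ultimately show ?case
    using weyl_comp[OF u(1) weyl_reflection[OF step(2)]] by blast
qed

lemma weyl_bij: "w \<in> weyl_group \<Phi> \<Longrightarrow> bij w"
  using weyl_inverse o_bij by metis

lemma weyl_inv: "w \<in> weyl_group \<Phi> \<Longrightarrow> winv w \<in> weyl_group \<Phi>"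
  using weyl_inverse inv_unique_comp by metis

lemma weyl_inv_inner: "w \<in> weyl_group \<Phi> \<Longrightarrow> winv w x \<bullet> y = x \<bullet> w y"
  by (metis weyl_bij weyl_inner bij_inv_eq_iff)

lemma weyl_group_rank_one: "weyl_group {\<alpha>, - \<alpha>} = {id, reflection \<alpha>}"
proof
  show "weyl_group {\<alpha>, - \<alpha>} \<subseteq> {id, reflection \<alpha>}"
  proof
    fix w assume "w \<in> weyl_group {\<alpha>, - \<alpha>}"
    then show "w \<in> {id, reflection \<alpha>}"
    proof (induction rule: weyl_group.induct)
      case (step w \<beta>)
      then have "reflection \<beta> = reflection \<alpha>" by auto
      then show ?case using step.IH by (metis comp_id insertCI insertE reflection_comp_self singletonD)
    qed (rule insertI1)
  qed
qed (use weyl_reflection[of \<alpha> "{\<alpha>, - \<alpha>}"] weyl_group.id in blast)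

section \<open>Products of words in reflections\<close>

definition word_prod :: "'a::euclidean_space list \<Rightarrow> ('a \<Rightarrow> 'a)" where
  "word_prod \<alpha>s = foldr (\<lambda>\<alpha> u. reflection \<alpha> \<circ> u) \<alpha>s id"

lemma word_prod_simps [simp]:
  "word_prod [] = id" "word_prod (\<alpha> # \<alpha>s) = reflection \<alpha> \<circ> word_prod \<alpha>s"
  by (simp_all add: word_prod_def)

lemma word_prod_append: "word_prod (xs @ ys) = word_prod xs \<circ> word_prod ys"
  by (induction xs) (simp_all add: comp_assoc)

lemma word_prod_rev: "word_prod (rev xs) \<circ> word_prod xs = id"
proof (induction xs)
  case (Cons a xs)
  have "word_prod (rev (a # xs)) \<circ> word_prod (a # xs)
      = word_prod (rev xs) \<circ> (reflection a \<circ> reflection a) \<circ> word_prod xs"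
    by (simp only: rev.simps word_prod_append word_prod_simps comp_assoc comp_id)
  also have "\<dots> = id" using Cons by (simp only: reflection_comp_self comp_id)
  finally show ?case .
qed simp

section \<open>A root system with a fixed base\<close>

locale root_base =
  fixes \<Phi> \<Delta> :: "'a::euclidean_space set"
  assumes root_system: "reduced_root_system \<Phi>" and base: "simple_roots \<Phi> \<Delta>"
begin

abbreviation W where "W \<equiv> weyl_group \<Phi>"
abbreviation X where "X \<equiv> weight_lattice \<Phi>"

lemma finite_roots: "finite \<Phi>" and zero_not_root: "0 \<notin> \<Phi>"
  and reflection_root: "\<alpha> \<in> \<Phi> \<Longrightarrow> \<beta> \<in> \<Phi> \<Longrightarrow> reflection \<alpha> \<beta> \<in> \<Phi>"
  and integral_root: "\<alpha> \<in> \<Phi> \<Longrightarrow> \<beta> \<in> \<Phi> \<Longrightarrow> coroot_pairing \<beta> \<alpha> \<in> \<int>"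
  and reduced_root: "\<alpha> \<in> \<Phi> \<Longrightarrow> c *\<^sub>R \<alpha> \<in> \<Phi> \<Longrightarrow> c = 1 \<or> c = -1"
  using root_system unfolding reduced_root_system_def by blast+

lemma base_roots: "\<Delta> \<subseteq> \<Phi>" and independent_base: "independent \<Delta>"
  and root_combination: "\<beta> \<in> \<Phi> \<Longrightarrow> \<exists>c :: 'a \<Rightarrow> nat.
        \<beta> = (\<Sum>\<alpha>\<in>\<Delta>. real (c \<alpha>) *\<^sub>R \<alpha>) \<or> \<beta> = - (\<Sum>\<alpha>\<in>\<Delta>. real (c \<alpha>) *\<^sub>R \<alpha>)"
  using base unfolding simple_roots_def by blast+

lemma finite_base: "finite \<Delta>"
  using base_roots finite_roots finite_subset by auto

lemma simple_root: "\<alpha> \<in> \<Delta> \<Longrightarrow> \<alpha> \<in> \<Phi>" and simple_nonzero: "\<alpha> \<in> \<Delta> \<Longrightarrow> \<alpha> \<noteq> 0"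
  using base_roots zero_not_root by auto

lemma uminus_root: "\<alpha> \<in> \<Phi> \<Longrightarrow> - \<alpha> \<in> \<Phi>"
  using reflection_root[of \<alpha> \<alpha>] reflection_self[of \<alpha>] zero_not_root by metis

lemma weyl_root: "w \<in> W \<Longrightarrow> \<beta> \<in> \<Phi> \<Longrightarrow> w \<beta> \<in> \<Phi>"
  by (induction rule: weyl_group.induct) (auto intro: reflection_root)

lemma simple_in_weyl: "\<alpha> \<in> \<Delta> \<Longrightarrow> reflection \<alpha> \<in> W"
  by (simp add: simple_root weyl_reflection)

subsection \<open>Fundamental weights and positive roots\<close>

text \<open>The fundamental weight: half the square length is the value for which the pairing with
  the coroot of \<open>\<gamma>\<close> equals 1.\<close>

definition fund :: "'a \<Rightarrow> 'a" where
  "fund \<gamma> = (SOME \<omega>. \<omega> \<in> span \<Phi> \<and> (\<forall>\<delta>\<in>\<Delta>. \<omega> \<bullet> \<delta> = (if \<delta> = \<gamma> then (\<gamma> \<bullet> \<gamma>) / 2 else 0)))"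

lemma fund_span: "fund \<gamma> \<in> span \<Phi>"
  and fund_inner: "\<delta> \<in> \<Delta> \<Longrightarrow> fund \<gamma> \<bullet> \<delta> = (if \<delta> = \<gamma> then (\<gamma> \<bullet> \<gamma>) / 2 else 0)"
proof -
  have "\<exists>\<omega>. \<omega> \<in> span \<Phi> \<and> (\<forall>\<delta>\<in>\<Delta>. \<omega> \<bullet> \<delta> = (if \<delta> = \<gamma> then (\<gamma> \<bullet> \<gamma>) / 2 else 0))"
    using exists_dual_vector[OF independent_base, of "span \<Phi>"
        "\<lambda>\<delta>. if \<delta> = \<gamma> then (\<gamma> \<bullet> \<gamma>) / 2 else 0"] base_roots span_superset[of \<Phi>]
    by (metis subset_trans subspace_span)
  from someI_ex[OF this]
  show "fund \<gamma> \<in> span \<Phi>" "\<delta> \<in> \<Delta> \<Longrightarrow> fund \<gamma> \<bullet> \<delta> = (if \<delta> = \<gamma> then (\<gamma> \<bullet> \<gamma>) / 2 else 0)"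
    unfolding fund_def by blast+
qed

definition rho :: 'a where "rho = (\<Sum>\<gamma>\<in>\<Delta>. fund \<gamma>)"

lemma rho_span: "rho \<in> span \<Phi>"
  unfolding rho_def by (intro span_sum fund_span)

lemma rho_inner_simple: "\<delta> \<in> \<Delta> \<Longrightarrow> rho \<bullet> \<delta> = (\<delta> \<bullet> \<delta>) / 2"
  unfolding rho_def by (simp add: inner_sum_left fund_inner finite_base)

lemma rho_simple_pos: "\<delta> \<in> \<Delta> \<Longrightarrow> rho \<bullet> \<delta> > 0"
  by (simp add: rho_inner_simple simple_nonzero)

lemma span_simple: "span \<Delta> = span \<Phi>"
proof
  show "span \<Delta> \<subseteq> span \<Phi>" using base_roots by (rule span_mono)
  have "\<beta> \<in> span \<Delta>" if b: "\<beta> \<in> \<Phi>" for \<beta>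
  proof -
    obtain c :: "'a \<Rightarrow> nat" where
      "\<beta> = (\<Sum>\<alpha>\<in>\<Delta>. real (c \<alpha>) *\<^sub>R \<alpha>) \<or> \<beta> = - (\<Sum>\<alpha>\<in>\<Delta>. real (c \<alpha>) *\<^sub>R \<alpha>)"
      using root_combination[OF b] by blast
    moreover have "(\<Sum>\<alpha>\<in>\<Delta>. real (c \<alpha>) *\<^sub>R \<alpha>) \<in> span \<Delta>"
      by (intro span_sum span_scale span_base)
    ultimately show ?thesis using span_neg by auto
  qed
  then show "span \<Phi> \<subseteq> span \<Delta>"
    by (intro span_minimal subspace_span) auto
qed

lemma span_expansion:
  assumes "x \<in> span \<Phi>"
  shows "x = (\<Sum>\<gamma>\<in>\<Delta>. (2 * (fund \<gamma> \<bullet> x) / (\<gamma> \<bullet> \<gamma>)) *\<^sub>R \<gamma>)"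
proof -
  obtain u where u: "x = (\<Sum>\<gamma>\<in>\<Delta>. u \<gamma> *\<^sub>R \<gamma>)"
    using assms unfolding span_simple[symmetric] span_finite[OF finite_base] by auto
  have "2 * (fund \<gamma> \<bullet> x) / (\<gamma> \<bullet> \<gamma>) = u \<gamma>" if g: "\<gamma> \<in> \<Delta>" for \<gamma>
  proof -
    have "fund \<gamma> \<bullet> x = (\<Sum>\<delta>\<in>\<Delta>. u \<delta> * (if \<delta> = \<gamma> then (\<gamma> \<bullet> \<gamma>) / 2 else 0))"
      unfolding u by (simp add: inner_sum_right fund_inner cong: sum.cong)
    also have "\<dots> = u \<gamma> * ((\<gamma> \<bullet> \<gamma>) / 2)"
      using g finite_base by (simp add: if_distrib cong: if_cong)
    finally show ?thesis using simple_nonzero[OF g] by (simp add: field_simps)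
  qed
  then show ?thesis using u by simp
qed

lemma span_fund_zero: "x \<in> span \<Phi> \<Longrightarrow> (\<And>\<gamma>. \<gamma> \<in> \<Delta> \<Longrightarrow> fund \<gamma> \<bullet> x = 0) \<Longrightarrow> x = 0"
  using span_expansion[of x] by simp

text \<open>A single functional decides the sign: the height along \<open>rho\<close> is the sum of
  the numbers \<open>fund \<gamma> \<bullet> \<beta>\<close>, and for a root these are all of one
  sign.\<close>

definition pos :: "'a set" where "pos = {\<beta> \<in> \<Phi>. rho \<bullet> \<beta> > 0}"

lemma finite_pos: "finite pos" and pos_root: "\<beta> \<in> pos \<Longrightarrow> \<beta> \<in> \<Phi>"
  using finite_roots by (auto simp: pos_def)

lemma root_cases:
  assumes "\<beta> \<in> \<Phi>"
  obtains "\<beta> \<in> pos" "- \<beta> \<notin> pos" "\<And>\<gamma>. \<gamma> \<in> \<Delta> \<Longrightarrow> fund \<gamma> \<bullet> \<beta> \<ge> 0"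
  | "\<beta> \<notin> pos" "- \<beta> \<in> pos" "\<And>\<gamma>. \<gamma> \<in> \<Delta> \<Longrightarrow> fund \<gamma> \<bullet> \<beta> \<le> 0"
proof -
  obtain c :: "'a \<Rightarrow> nat" where c:
    "\<beta> = (\<Sum>\<alpha>\<in>\<Delta>. real (c \<alpha>) *\<^sub>R \<alpha>) \<or> \<beta> = - (\<Sum>\<alpha>\<in>\<Delta>. real (c \<alpha>) *\<^sub>R \<alpha>)"
    using root_combination[OF assms] by blast
  define y where "y = (\<Sum>\<alpha>\<in>\<Delta>. real (c \<alpha>) *\<^sub>R \<alpha>)"
  have f: "fund \<gamma> \<bullet> y \<ge> 0" for \<gamma>
    unfolding y_def by (auto simp: inner_sum_right fund_inner intro!: sum_nonneg)
  have b: "\<beta> = y \<or> \<beta> = - y" using c y_def by simp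
  have y0: "y \<noteq> 0" and yr: "y \<in> \<Phi>"
    using b zero_not_root assms uminus_root[of \<beta>] by auto
  have "rho \<bullet> y = (\<Sum>\<gamma>\<in>\<Delta>. fund \<gamma> \<bullet> y)" by (simp add: rho_def inner_sum_left)
  moreover have "\<dots> \<noteq> 0"
  proof
    assume "(\<Sum>\<gamma>\<in>\<Delta>. fund \<gamma> \<bullet> y) = 0"
    then have "\<forall>\<gamma>\<in>\<Delta>. fund \<gamma> \<bullet> y = 0"
      using sum_nonneg_eq_0_iff[OF finite_base, of "\<lambda>\<gamma>. fund \<gamma> \<bullet> y"] f by auto
    then show False using span_fund_zero[of y] y0 yr span_superset by blast
  qed
  ultimately have p: "rho \<bullet> y > 0" using sum_nonneg[of \<Delta> "\<lambda>\<gamma>. fund \<gamma> \<bullet> y"] f by simp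
  show thesis
    using b
  proof
    assume "\<beta> = y" then show thesis using that(1) p f yr by (auto simp: pos_def)
  next
    assume "\<beta> = - y" then show thesis using that(2) p f yr by (auto simp: pos_def)
  qed
qed

lemma pos_iff_not_neg: "\<beta> \<in> \<Phi> \<Longrightarrow> \<beta> \<notin> pos \<longleftrightarrow> - \<beta> \<in> pos"
  by (meson root_cases)

lemma fund_pos_nonneg: "\<beta> \<in> pos \<Longrightarrow> \<gamma> \<in> \<Delta> \<Longrightarrow> fund \<gamma> \<bullet> \<beta> \<ge> 0"
  using root_cases[OF pos_root] by metis

lemma simple_pos: "\<alpha> \<in> \<Delta> \<Longrightarrow> \<alpha> \<in> pos"
  by (simp add: pos_def simple_root rho_simple_pos)

text \<open>As the system is reduced, a positive root other than \<open>\<alpha>\<close> has a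
  positive coefficient at some other simple root. The reflection changes only the coefficient at
  \<open>\<alpha>\<close>, so this positive coefficient survives and makes the image
  positive.\<close>

lemma reflection_pos:
  assumes "\<alpha> \<in> \<Delta>" "\<beta> \<in> pos" "\<beta> \<noteq> \<alpha>"
  shows "reflection \<alpha> \<beta> \<in> pos - {\<alpha>}"
proof -
  have br: "\<beta> \<in> \<Phi>" using assms pos_root by auto
  have ar: "\<alpha> \<in> \<Phi>" using assms simple_root by auto
  have "\<exists>\<gamma>\<in>\<Delta>. \<gamma> \<noteq> \<alpha> \<and> fund \<gamma> \<bullet> \<beta> \<noteq> 0"
  proof (rule ccontr)
    assume "\<not> ?thesis"
    then have z: "fund \<gamma> \<bullet> \<beta> = 0" if "\<gamma> \<in> \<Delta>" "\<gamma> \<noteq> \<alpha>" for \<gamma> using that by auto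
    define k where "k = 2 * (fund \<alpha> \<bullet> \<beta>) / (\<alpha> \<bullet> \<alpha>)"
    have "\<beta> = (\<Sum>\<gamma>\<in>\<Delta>. (2 * (fund \<gamma> \<bullet> \<beta>) / (\<gamma> \<bullet> \<gamma>)) *\<^sub>R \<gamma>)"
      using span_expansion br span_superset by blast
    also have "\<dots> = (\<Sum>\<gamma>\<in>\<Delta>. if \<gamma> = \<alpha> then k *\<^sub>R \<alpha> else 0)"
      by (rule sum.cong) (auto simp: z k_def)
    also have "\<dots> = k *\<^sub>R \<alpha>" using assms(1) finite_base by simp
    finally have bk: "\<beta> = k *\<^sub>R \<alpha>" .
    then have "k = 1 \<or> k = -1" using reduced_root[OF ar] br by auto
    then have "\<beta> = - \<alpha>" using bk assms(3) by auto
    then show False using assms simple_pos[OF assms(1)] pos_iff_not_neg[OF ar] by auto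
  qed
  then obtain \<gamma> where g: "\<gamma> \<in> \<Delta>" "\<gamma> \<noteq> \<alpha>" "fund \<gamma> \<bullet> \<beta> > 0"
    using fund_pos_nonneg[OF assms(2)] by force
  have "fund \<gamma> \<bullet> reflection \<alpha> \<beta> = fund \<gamma> \<bullet> \<beta>"
    using g assms by (simp add: reflection_def inner_diff_right fund_inner)
  then have "reflection \<alpha> \<beta> \<in> pos"
    using g root_cases[OF reflection_root[OF ar br]] by (metis not_le)
  moreover have "reflection \<alpha> \<beta> \<noteq> \<alpha>"
  proof
    assume "reflection \<alpha> \<beta> = \<alpha>"
    then have "\<beta> = - \<alpha>" using reflection_invol[of \<alpha> \<beta>] reflection_self[OF simple_nonzero[OF assms(1)]] by metis
    then show False using assms simple_pos[OF assms(1)] pos_iff_not_neg[OF ar] by auto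
  qed
  ultimately show ?thesis by simp
qed

lemma simple_neg: "\<alpha> \<in> \<Delta> \<Longrightarrow> - \<alpha> \<notin> pos"
  using simple_pos pos_iff_not_neg simple_root by blast

lemma reflection_pos_image: "\<alpha> \<in> \<Delta> \<Longrightarrow> reflection \<alpha> ` (pos - {\<alpha>}) = pos - {\<alpha>}"
  using reflection_pos by (auto simp: image_iff) (metis Diff_iff insertI1 reflection_invol singletonD)

subsection \<open>Words in simple reflections\<close>

text \<open>For positive roots this is an induction on the height along \<open>rho\<close>: a
  positive root that is not simple has a positive inner product with some simple root, and
  reflecting in that simple root lowers the height while the root stays positive.\<close>

lemma root_conj_simple:
  assumes "\<beta> \<in> \<Phi>"
  shows "\<exists>\<alpha>s. set \<alpha>s \<subseteq> \<Delta> \<and> (\<exists>\<alpha>\<in>\<Delta>. \<beta> = word_prod \<alpha>s \<alpha>)"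
proof -
  define good where "good \<beta> \<longleftrightarrow> (\<exists>\<alpha>s. set \<alpha>s \<subseteq> \<Delta> \<and> (\<exists>\<alpha>\<in>\<Delta>. \<beta> = word_prod \<alpha>s \<alpha>))" for \<beta>
  have step: "good (reflection \<alpha> \<gamma>)" if "good \<gamma>" "\<alpha> \<in> \<Delta>" for \<alpha> \<gamma>
  proof -
    obtain \<alpha>s \<delta> where "set \<alpha>s \<subseteq> \<Delta>" "\<delta> \<in> \<Delta>" "\<gamma> = word_prod \<alpha>s \<delta>"
      using \<open>good \<gamma>\<close> by (auto simp: good_def)
    then show ?thesis
      unfolding good_def using that(2) by (intro exI[of _ "\<alpha> # \<alpha>s"]) auto
  qed
  have pos: "good \<beta>" if "\<beta> \<in> pos" for \<beta>
  proof (rule ccontr)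
    assume "\<not> good \<beta>"
    then have "{\<beta>\<in>pos. \<not> good \<beta>} \<noteq> {}" "finite {\<beta>\<in>pos. \<not> good \<beta>}" using that finite_pos by auto
    then obtain \<beta> where b: "\<beta> \<in> pos" "\<not> good \<beta>"
      and min: "\<And>\<gamma>. \<gamma> \<in> pos \<Longrightarrow> \<not> good \<gamma> \<Longrightarrow> \<not> rho \<bullet> \<gamma> < rho \<bullet> \<beta>"
      using ex_is_arg_min_if_finite[of "{\<beta>\<in>pos. \<not> good \<beta>}" "\<lambda>\<beta>. rho \<bullet> \<beta>"]
      unfolding is_arg_min_def by blast
    have bd: "\<beta> \<notin> \<Delta>"
    proof
      assume "\<beta> \<in> \<Delta>" then have "good \<beta>" unfolding good_def by (intro exI[of _ "[]"]) auto
      then show False using b by simp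
    qed
    have "\<exists>\<alpha>\<in>\<Delta>. \<alpha> \<bullet> \<beta> > 0"
    proof (rule ccontr)
      assume "\<not> ?thesis"
      then have n: "\<alpha> \<bullet> \<beta> \<le> 0" if "\<alpha> \<in> \<Delta>" for \<alpha> using that by force
      have "\<beta> \<bullet> \<beta> = (\<Sum>\<gamma>\<in>\<Delta>. (2 * (fund \<gamma> \<bullet> \<beta>) / (\<gamma> \<bullet> \<gamma>)) *\<^sub>R \<gamma>) \<bullet> \<beta>"
        using span_expansion[of \<beta>] b(1) pos_root span_superset by (metis subset_iff)
      also have "\<dots> \<le> 0"
        unfolding inner_sum_left
        using n fund_pos_nonneg[OF b(1)]
        by (intro sum_nonpos) (simp add: divide_nonpos_nonneg mult_nonneg_nonpos)
      finally have "\<beta> = 0" by (meson inner_gt_zero_iff not_le)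
      then show False using b(1) pos_root zero_not_root by auto
    qed
    then obtain \<alpha> where a: "\<alpha> \<in> \<Delta>" "\<alpha> \<bullet> \<beta> > 0" by auto
    have "reflection \<alpha> \<beta> \<in> pos" using reflection_pos a b bd by auto
    moreover have "rho \<bullet> reflection \<alpha> \<beta> < rho \<bullet> \<beta>"
      using rho_simple_pos[OF a(1)] a simple_nonzero[OF a(1)]
      by (simp add: reflection_def coroot_pairing_def inner_diff_right inner_commute)
    ultimately have "good (reflection \<alpha> \<beta>)" using min by blast
    from step[OF this a(1)] show False using b by simp
  qed
  have "good \<beta>"
  proof (cases "\<beta> \<in> pos")
    case False
    then have "good (- \<beta>)" using pos pos_iff_not_neg assms by auto
    then obtain \<alpha>s \<alpha> where a: "set \<alpha>s \<subseteq> \<Delta>" "\<alpha> \<in> \<Delta>" "- \<beta> = word_prod \<alpha>s \<alpha>"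
      by (auto simp: good_def)
    have lin: "linear (word_prod xs)" for xs :: "'a list"
    proof (induction xs)
      case (Cons x xs)
      then show ?case unfolding word_prod_simps by (rule linear_compose[OF _ linear_reflection])
    qed (simp add: linear_ident)
    \<comment> \<open>A negative root costs one more letter, because
      \<open>reflection \<alpha>\<close> sends \<open>\<alpha>\<close> to its negative.\<close>
    have "word_prod (\<alpha>s @ [\<alpha>]) \<alpha> = \<beta>"
      using a by (simp add: word_prod_append reflection_self simple_nonzero linear_neg[OF lin] flip: a(3))
    then show ?thesis using a unfolding good_def
      by (intro exI[of _ "\<alpha>s @ [\<alpha>]"]) auto
  qed (simp add: pos)
  then show ?thesis by (simp add: good_def)
qed

lemma word_prod_weyl: "set \<alpha>s \<subseteq> \<Delta> \<Longrightarrow> word_prod \<alpha>s \<in> W"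
  by (induction \<alpha>s) (auto simp: weyl_group.id intro!: weyl_group.step simple_root)

lemma reflection_conj_weyl: "w \<in> W \<Longrightarrow> reflection (w \<alpha>) \<circ> w = w \<circ> reflection \<alpha>"
  by (rule ext) (simp add: reflection_conj weyl_linear weyl_inner)

text \<open>The reflection in a root \<open>u \<alpha>\<close> is the conjugate of
  \<open>reflection \<alpha>\<close> by \<open>u\<close>, so every generator becomes a palindromic
  word in simple reflections.\<close>

lemma weyl_word: "w \<in> W \<Longrightarrow> \<exists>\<alpha>s. set \<alpha>s \<subseteq> \<Delta> \<and> w = word_prod \<alpha>s"
proof (induction rule: weyl_group.induct)
  case id show ?case by (intro exI[of _ "[]"]) auto
next
  case (step w \<beta>)
  then obtain ws where ws: "set ws \<subseteq> \<Delta>" "w = word_prod ws" by auto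
  obtain as \<alpha> where a: "set as \<subseteq> \<Delta>" "\<alpha> \<in> \<Delta>" "\<beta> = word_prod as \<alpha>"
    using root_conj_simple[OF step(2)] by auto
  have inv: "word_prod as \<circ> word_prod (rev as) = id"
    using word_prod_rev[of "rev as"] by simp
  have "reflection \<beta> = reflection \<beta> \<circ> (word_prod as \<circ> word_prod (rev as))"
    using inv by simp
  also have "\<dots> = (reflection (word_prod as \<alpha>) \<circ> word_prod as) \<circ> word_prod (rev as)"
    using a(3) by (simp add: comp_assoc)
  also have "\<dots> = word_prod (as @ [\<alpha>] @ rev as)"
    using reflection_conj_weyl[OF word_prod_weyl[OF a(1)]] by (simp add: word_prod_append comp_assoc)
  finally have "reflection \<beta> \<circ> w = word_prod ((as @ [\<alpha>] @ rev as) @ ws)"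
    using ws by (simp add: word_prod_append comp_assoc)
  then show ?case using a ws by (intro exI[of _ "(as @ [\<alpha>] @ rev as) @ ws"]) auto
qed

section \<open>The action of the Weyl group on the weight lattice\<close>

lemma coroot_pairing_weyl: "w \<in> W \<Longrightarrow> coroot_pairing (w x) (w \<alpha>) = coroot_pairing x \<alpha>"
  by (simp add: coroot_pairing_def weyl_inner)

lemma weyl_span: "w \<in> W \<Longrightarrow> x \<in> span \<Phi> \<Longrightarrow> w x \<in> span \<Phi>"
proof -
  assume w: "w \<in> W" "x \<in> span \<Phi>"
  then have "w x \<in> w ` span \<Phi>" by auto
  also have "\<dots> = span (w ` \<Phi>)" using linear_span_image[OF weyl_linear[OF w(1)]] by simp
  also have "\<dots> \<subseteq> span \<Phi>" using weyl_root[OF w(1)] by (intro span_mono) auto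
  finally show ?thesis .
qed

lemma weyl_lattice: "w \<in> W \<Longrightarrow> x \<in> X \<Longrightarrow> w x \<in> X"
proof -
  assume w: "w \<in> W" "x \<in> X"
  have "coroot_pairing (w x) \<alpha> \<in> \<int>" if "\<alpha> \<in> \<Phi>" for \<alpha>
  proof -
    have "\<alpha> = w (winv w \<alpha>)" using weyl_bij[OF w(1)] by (simp add: bij_is_surj surj_f_inv_f)
    then have "coroot_pairing (w x) \<alpha> = coroot_pairing x (winv w \<alpha>)"
      using coroot_pairing_weyl[OF w(1)] by metis
    then show ?thesis using w(2) weyl_root[OF weyl_inv[OF w(1)] that] by (auto simp: weight_lattice_def)
  qed
  then show ?thesis using w weyl_span by (auto simp: weight_lattice_def)
qed

lemma lattice_add: "x \<in> X \<Longrightarrow> y \<in> X \<Longrightarrow> x + y \<in> X"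
  and lattice_uminus: "x \<in> X \<Longrightarrow> - x \<in> X"
  and lattice_zero: "0 \<in> X"
  and lattice_diff: "x \<in> X \<Longrightarrow> y \<in> X \<Longrightarrow> x - y \<in> X"
  by (auto simp: weight_lattice_def coroot_pairing_def inner_add_left inner_diff_left add_divide_distrib
      diff_divide_distrib ring_distribs span_add span_neg span_diff span_zero)

lemma lattice_sum: "(\<And>i. i \<in> A \<Longrightarrow> f i \<in> X) \<Longrightarrow> (\<Sum>i\<in>A. f i) \<in> X"
  by (induction A rule: infinite_finite_induct) (auto simp: lattice_zero lattice_add)

lemma root_lattice: "\<beta> \<in> \<Phi> \<Longrightarrow> \<beta> \<in> X"
  using integral_root by (auto simp: weight_lattice_def intro: span_base)

text \<open>Every root is a word applied to a simple root. Moving the letters of the word over to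
  \<open>x\<close> changes \<open>x\<close> by integral multiples of roots, so its pairings with the
  simple coroots stay integral. This puts the fundamental weights into the lattice.\<close>

lemma lattice_simple_integral:
  assumes "x \<in> span \<Phi>" "\<And>\<alpha>. \<alpha> \<in> \<Delta> \<Longrightarrow> coroot_pairing x \<alpha> \<in> \<int>"
  shows "x \<in> X"
proof -
  have *: "set \<alpha>s \<subseteq> \<Delta> \<Longrightarrow> (\<forall>\<alpha>\<in>\<Delta>. coroot_pairing x \<alpha> \<in> \<int>) \<Longrightarrow>
    \<alpha> \<in> \<Delta> \<Longrightarrow> coroot_pairing x (word_prod \<alpha>s \<alpha>) \<in> \<int>" for \<alpha>s \<alpha> x
  proof (induction \<alpha>s arbitrary: x)
    case (Cons \<beta> \<alpha>s)
    have b: "\<beta> \<in> \<Delta>" using Cons by auto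
    have "coroot_pairing x (reflection \<beta> (word_prod \<alpha>s \<alpha>))
        = coroot_pairing (reflection \<beta> x) (word_prod \<alpha>s \<alpha>)"
      using coroot_pairing_weyl[OF simple_in_weyl[OF b], of "reflection \<beta> x"] by simp
    moreover have "coroot_pairing (reflection \<beta> x) \<gamma> \<in> \<int>" if "\<gamma> \<in> \<Delta>" for \<gamma>
    proof -
      have "coroot_pairing (reflection \<beta> x) \<gamma> = coroot_pairing x \<gamma> - coroot_pairing x \<beta> * coroot_pairing \<beta> \<gamma>"
        by (simp add: reflection_def coroot_pairing_def inner_diff_left diff_divide_distrib right_diff_distrib)
      then show ?thesis using Cons.prems b that integral_root[of \<gamma> \<beta>] simple_root by auto
    qed
    ultimately show ?case using Cons by auto
  qed auto
  then show ?thesis using assms root_conj_simple by (fastforce simp: weight_lattice_def)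
qed

lemma fund_lattice: "\<gamma> \<in> \<Delta> \<Longrightarrow> fund \<gamma> \<in> X"
  by (intro lattice_simple_integral fund_span) (auto simp: coroot_pairing_def fund_inner simple_nonzero)

lemma rho_lattice: "rho \<in> X"
  unfolding rho_def by (intro lattice_sum fund_lattice)

text \<open>An element is determined by its permutation of the roots, since it fixes the orthogonal
  complement of their span pointwise.\<close>

lemma finite_weyl: "finite W"
proof -
  have "inj_on (\<lambda>w. restrict w \<Phi>) W"
  proof (rule inj_onI)
    fix w u assume wu: "w \<in> W" "u \<in> W" "restrict w \<Phi> = restrict u \<Phi>"
    have roots: "w b = u b" if "b \<in> \<Phi>" for b using wu(3) that by (metis restrict_apply')
    have fixed: "v x = x" if "v \<in> W" "\<And>b. b \<in> span \<Phi> \<Longrightarrow> Linear_Algebra.orthogonal x b" for v x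
      using that
    proof (induction rule: weyl_group.induct)
      case (step v \<alpha>)
      have "x \<bullet> \<alpha> = 0" using step by (auto simp: Linear_Algebra.orthogonal_def intro: span_base)
      then show ?case using step by (simp add: reflection_def coroot_pairing_def)
    qed auto
    show "w = u"
    proof
      fix x
      obtain y z where yz: "y \<in> span \<Phi>" "\<And>v. v \<in> span \<Phi> \<Longrightarrow> Linear_Algebra.orthogonal z v" "x = y + z"
        using orthogonal_subspace_decomp_exists[of \<Phi> x] by metis
      have "w y = u y"
        using linear_eq_on[OF weyl_linear[OF wu(1)] weyl_linear[OF wu(2)] yz(1)] roots by blast
      then show "w x = u x"
        using fixed[OF wu(1) yz(2)] fixed[OF wu(2) yz(2)] yz(3)
        by (simp add: linear_add[OF weyl_linear[OF wu(1)]] linear_add[OF weyl_linear[OF wu(2)]])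
    qed
  qed
  moreover have "(\<lambda>w. restrict w \<Phi>) ` W \<subseteq> \<Phi> \<rightarrow>\<^sub>E \<Phi>"
    using weyl_root by auto
  ultimately show ?thesis
    using finite_PiE[OF finite_roots, of "\<lambda>_. \<Phi>"] finite_roots by (meson finite_imageD finite_subset)
qed

end

lemma set_eq_union_if:
  assumes "\<And>x. x \<noteq> a \<Longrightarrow> x \<in> A \<longleftrightarrow> x \<in> B" "a \<in> A \<longleftrightarrow> P" "a \<notin> B"
  shows "A = B \<union> (if P then {a} else {})"
proof (rule Set.set_eqI)
  show "x \<in> A \<longleftrightarrow> x \<in> B \<union> (if P then {a} else {})" for x
    using assms by (cases "x = a") auto
qed

context root_base begin

subsection \<open>Inversions and lengths\<close>

definition inversions :: "('a \<Rightarrow> 'a) \<Rightarrow> 'a set" where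
  "inversions w = {\<beta> \<in> pos. w \<beta> \<notin> pos}"

text \<open>Counting inversions makes the sign a function of the element from the outset. That it is
  the parity of every word, and therefore multiplicative, is derived in
  \<open>sgn_weyl_word\<close>.\<close>

definition sgn_weyl :: "('a \<Rightarrow> 'a) \<Rightarrow> int" where
  "sgn_weyl w = (-1) ^ card (inversions w)"

lemma finite_inversions: "finite (inversions w)"
  by (simp add: inversions_def finite_pos)

lemma simple_not_reflection_inversion:
  assumes "\<alpha> \<in> \<Delta>"
  shows "\<alpha> \<notin> reflection \<alpha> ` (inversions w - {\<alpha>})"
proof
  assume "\<alpha> \<in> reflection \<alpha> ` (inversions w - {\<alpha>})"
  then obtain \<beta> where "\<beta> \<in> pos" "\<beta> \<noteq> \<alpha>" "\<alpha> = reflection \<alpha> \<beta>"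
    unfolding inversions_def by blast
  then show False using reflection_pos[OF assms, of \<beta>] by (metis Diff_iff singletonI)
qed

text \<open>The simple reflection permutes the positive roots other than \<open>\<alpha>\<close>, so
  the inversions are carried along and only the status of \<open>\<alpha>\<close> itself
  changes.\<close>

lemma inversions_reflection:
  assumes "w \<in> W" "\<alpha> \<in> \<Delta>"
  shows "inversions (w \<circ> reflection \<alpha>) =
    reflection \<alpha> ` (inversions w - {\<alpha>}) \<union> (if w \<alpha> \<in> pos then {\<alpha>} else {})"
proof -
  have ra: "reflection \<alpha> \<alpha> = - \<alpha>" using assms simple_nonzero reflection_self by auto
  have wa: "w (- \<alpha>) = - w \<alpha>" using weyl_linear[OF assms(1)] by (rule linear_neg)
  have "\<beta> \<in> inversions (w \<circ> reflection \<alpha>) \<longleftrightarrow> \<beta> \<in> reflection \<alpha> ` (inversions w - {\<alpha>})"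
    if "\<beta> \<noteq> \<alpha>" for \<beta>
  proof
    assume "\<beta> \<in> inversions (w \<circ> reflection \<alpha>)"
    then have "reflection \<alpha> \<beta> \<in> inversions w - {\<alpha>}"
      using reflection_pos[OF assms(2) _ that] by (auto simp: inversions_def)
    then show "\<beta> \<in> reflection \<alpha> ` (inversions w - {\<alpha>})"
      by (metis image_eqI reflection_invol)
  next
    assume "\<beta> \<in> reflection \<alpha> ` (inversions w - {\<alpha>})"
    then obtain \<delta> where "\<delta> \<in> pos" "\<delta> \<noteq> \<alpha>" "w \<delta> \<notin> pos" "\<beta> = reflection \<alpha> \<delta>"
      unfolding inversions_def by blast
    then show "\<beta> \<in> inversions (w \<circ> reflection \<alpha>)"
      using reflection_pos[OF assms(2), of \<delta>] by (simp add: inversions_def)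
  qed
  moreover have "\<alpha> \<in> inversions (w \<circ> reflection \<alpha>) \<longleftrightarrow> w \<alpha> \<in> pos"
    using simple_pos[OF assms(2)] pos_iff_not_neg[OF weyl_root[OF assms(1) simple_root[OF assms(2)]]]
    unfolding inversions_def mem_Collect_eq comp_apply ra wa by blast
  moreover have "\<alpha> \<notin> reflection \<alpha> ` (inversions w - {\<alpha>})"
    by (rule simple_not_reflection_inversion[OF assms(2)])
  ultimately show ?thesis by (rule set_eq_union_if)
qed

lemma card_inversions_reflection:
  assumes "w \<in> W" "\<alpha> \<in> \<Delta>"
  shows "w \<alpha> \<in> pos \<Longrightarrow> card (inversions (w \<circ> reflection \<alpha>)) = Suc (card (inversions w))"
    and "w \<alpha> \<notin> pos \<Longrightarrow> Suc (card (inversions (w \<circ> reflection \<alpha>))) = card (inversions w)"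
proof -
  have inj: "inj_on (reflection \<alpha>) A" for A by (metis inj_onI reflection_invol)
  have ni: "\<alpha> \<notin> reflection \<alpha> ` (inversions w - {\<alpha>})"
    by (rule simple_not_reflection_inversion[OF assms(2)])
  show "card (inversions (w \<circ> reflection \<alpha>)) = Suc (card (inversions w))" if "w \<alpha> \<in> pos"
  proof -
    have "inversions w - {\<alpha>} = inversions w" using that by (auto simp: inversions_def)
    then have "inversions (w \<circ> reflection \<alpha>) = insert \<alpha> (reflection \<alpha> ` inversions w)"
      and "\<alpha> \<notin> reflection \<alpha> ` inversions w"
      using that ni inversions_reflection[OF assms] by auto
    then show ?thesis
      by (simp add: card_image[OF inj] finite_inversions)
  qed
  show "Suc (card (inversions (w \<circ> reflection \<alpha>))) = card (inversions w)" if "w \<alpha> \<notin> pos"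
  proof -
    have "\<alpha> \<in> inversions w" using that simple_pos[OF assms(2)] by (simp add: inversions_def)
    moreover have "inversions (w \<circ> reflection \<alpha>) = reflection \<alpha> ` (inversions w - {\<alpha>})"
      using that inversions_reflection[OF assms] by simp
    ultimately show ?thesis
      by (simp only: card_image[OF inj] card.remove[OF finite_inversions])
  qed
qed

lemma sgn_weyl_simple: "w \<in> W \<Longrightarrow> \<alpha> \<in> \<Delta> \<Longrightarrow> sgn_weyl (w \<circ> reflection \<alpha>) = - sgn_weyl w"
proof -
  assume "w \<in> W" "\<alpha> \<in> \<Delta>"
  then consider "card (inversions (w \<circ> reflection \<alpha>)) = Suc (card (inversions w))"
    | "card (inversions w) = Suc (card (inversions (w \<circ> reflection \<alpha>)))"
    using card_inversions_reflection[of w \<alpha>] by metis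
  then show ?thesis unfolding sgn_weyl_def by cases simp_all
qed

lemma sgn_weyl_id [simp]: "sgn_weyl id = 1"
  by (simp add: sgn_weyl_def inversions_def)

lemma sgn_weyl_word: "w \<in> W \<Longrightarrow> set \<alpha>s \<subseteq> \<Delta> \<Longrightarrow> sgn_weyl (w \<circ> word_prod \<alpha>s) = sgn_weyl w * (-1) ^ length \<alpha>s"
proof (induction \<alpha>s arbitrary: w)
  case (Cons \<alpha> \<alpha>s)
  have "sgn_weyl (w \<circ> word_prod (\<alpha> # \<alpha>s)) = sgn_weyl ((w \<circ> reflection \<alpha>) \<circ> word_prod \<alpha>s)"
    by (simp only: word_prod_simps comp_assoc)
  also have "\<dots> = sgn_weyl (w \<circ> reflection \<alpha>) * (-1) ^ length \<alpha>s"
    using Cons.prems by (intro Cons.IH weyl_comp simple_in_weyl) auto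
  also have "\<dots> = sgn_weyl w * (-1) ^ length (\<alpha> # \<alpha>s)"
    using Cons.prems by (simp add: sgn_weyl_simple)
  finally show ?case unfolding comp_def .
qed simp

lemma sgn_word_prod: "set \<alpha>s \<subseteq> \<Delta> \<Longrightarrow> sgn_weyl (word_prod \<alpha>s) = (-1) ^ length \<alpha>s"
  using sgn_weyl_word[OF weyl_group.id] by simp

lemma sgn_weyl_comp: "w \<in> W \<Longrightarrow> u \<in> W \<Longrightarrow> sgn_weyl (w \<circ> u) = sgn_weyl w * sgn_weyl u"
  using weyl_word[of u] sgn_weyl_word sgn_word_prod by metis

lemma sgn_weyl_square [simp]: "sgn_weyl w * sgn_weyl w = 1"
  by (simp add: sgn_weyl_def flip: power_mult_distrib)

lemma sgn_weyl_reflection: "\<alpha> \<in> \<Delta> \<Longrightarrow> sgn_weyl (reflection \<alpha>) = -1"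
  using sgn_weyl_simple[OF weyl_group.id, of \<alpha>] by simp

text \<open>Follow \<open>\<alpha>\<close> through the word from right to left. At the letter where
  the image turns negative, the image before it is exactly the simple root of that letter, so this
  letter can be moved to the right end as \<open>reflection \<alpha>\<close>, where it
  cancels.\<close>

lemma exchange:
  "set \<alpha>s \<subseteq> \<Delta> \<Longrightarrow> \<alpha> \<in> \<Delta> \<Longrightarrow> word_prod \<alpha>s \<alpha> \<notin> pos \<Longrightarrow>
    \<exists>\<beta>s. set \<beta>s \<subseteq> \<Delta> \<and> length \<beta>s < length \<alpha>s \<and> word_prod \<alpha>s \<circ> reflection \<alpha> = word_prod \<beta>s"
proof (induction \<alpha>s)
  case (Cons \<gamma> \<alpha>s)
  have g: "\<gamma> \<in> \<Delta>" "set \<alpha>s \<subseteq> \<Delta>" using Cons by auto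
  show ?case
  proof (cases "word_prod \<alpha>s \<alpha> \<in> pos")
    case True
    then have "word_prod \<alpha>s \<alpha> = \<gamma>" using Cons.prems reflection_pos[OF g(1)] by auto
    then have "reflection \<gamma> \<circ> word_prod \<alpha>s = word_prod \<alpha>s \<circ> reflection \<alpha>"
      using reflection_conj_weyl[OF word_prod_weyl[OF g(2)], of \<alpha>] by simp
    then have "word_prod (\<gamma> # \<alpha>s) \<circ> reflection \<alpha> = word_prod \<alpha>s \<circ> (reflection \<alpha> \<circ> reflection \<alpha>)"
      by (simp only: word_prod_simps comp_assoc)
    then show ?thesis using g by (intro exI[of _ \<alpha>s]) (simp only: reflection_comp_self comp_id, simp)
  next
    case False
    then obtain \<beta>s where b: "set \<beta>s \<subseteq> \<Delta>" "length \<beta>s < length \<alpha>s" "word_prod \<alpha>s \<circ> reflection \<alpha> = word_prod \<beta>s"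
      using Cons g by blast
    then have "word_prod (\<gamma> # \<alpha>s) \<circ> reflection \<alpha> = word_prod (\<gamma> # \<beta>s)"
      by (simp only: word_prod_simps comp_assoc)
    then have "length (\<gamma> # \<beta>s) < length (\<gamma> # \<alpha>s) \<and> word_prod (\<gamma> # \<alpha>s) \<circ> reflection \<alpha> = word_prod (\<gamma> # \<beta>s)"
      using b by simp
    moreover have "set (\<gamma> # \<beta>s) \<subseteq> \<Delta>" using b g by simp
    ultimately show ?thesis unfolding comp_def by blast
  qed
qed (simp add: simple_pos)

text \<open>If a shortest word for \<open>u\<close> ended in \<open>\<alpha>\<close>, positivity of
  \<open>u \<alpha>\<close> would make the rest of the word send \<open>\<alpha>\<close> to a
  negative root, and \<open>exchange\<close> would produce a shorter word.\<close>

lemma weyl_positive_id: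
  assumes "u \<in> W" "\<And>\<alpha>. \<alpha> \<in> \<Delta> \<Longrightarrow> u \<alpha> \<in> pos"
  shows "u = id"
proof -
  define P where "P n \<longleftrightarrow> (\<exists>\<alpha>s. set \<alpha>s \<subseteq> \<Delta> \<and> u = word_prod \<alpha>s \<and> length \<alpha>s = n)" for n
  have ex: "\<exists>n. P n" using weyl_word[OF assms(1)] by (auto simp: P_def)
  have "P (LEAST n. P n)" using ex by (rule LeastI_ex)
  then obtain \<alpha>s where a: "set \<alpha>s \<subseteq> \<Delta>" "u = word_prod \<alpha>s" and min: "length \<alpha>s = (LEAST n. P n)"
    by (auto simp: P_def)
  show ?thesis
  proof (cases \<alpha>s rule: rev_cases)
    case (snoc \<beta>s \<alpha>)
    have al: "\<alpha> \<in> \<Delta>" "set \<beta>s \<subseteq> \<Delta>" using snoc a by auto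
    have ub: "u = word_prod \<beta>s \<circ> reflection \<alpha>" using snoc a by (simp add: word_prod_append)
    have "u \<alpha> = - word_prod \<beta>s \<alpha>"
      using al by (simp add: ub reflection_self simple_nonzero linear_neg[OF weyl_linear[OF word_prod_weyl]])
    then have "- word_prod \<beta>s \<alpha> \<in> pos" using assms(2)[OF al(1)] by simp
    then have "word_prod \<beta>s \<alpha> \<notin> pos"
      using pos_iff_not_neg weyl_root[OF word_prod_weyl[OF al(2)] simple_root[OF al(1)]] by auto
    then obtain \<gamma>s where "set \<gamma>s \<subseteq> \<Delta>" "length \<gamma>s < length \<beta>s" "u = word_prod \<gamma>s"
      using exchange[OF al(2) al(1)] ub by metis
    then have "P (length \<gamma>s)" "length \<gamma>s < length \<alpha>s" using snoc by (auto simp: P_def)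
    then show ?thesis using min not_less_Least by metis
  qed (use a in simp)
qed

lemma weyl_fixes_rho:
  assumes "u \<in> W" "u rho = rho"
  shows "u = id"
proof (rule weyl_positive_id[OF assms(1)])
  fix \<alpha> assume a: "\<alpha> \<in> \<Delta>"
  have "rho \<bullet> u \<alpha> = rho \<bullet> \<alpha>" using weyl_inner[OF assms(1), of rho \<alpha>] assms(2) by simp
  then show "u \<alpha> \<in> pos"
    using rho_simple_pos[OF a] weyl_root[OF assms(1) simple_root[OF a]] by (simp add: pos_def)
qed

text \<open>Split off on the right a simple reflection that lowers the number of inversions:
  \<open>u = v \<circ> reflection \<alpha>\<close> with \<open>v \<alpha>\<close> positive. Then
  \<open>u x\<close> is \<open>v x\<close> minus a nonnegative multiple of the positive root
  \<open>v \<alpha>\<close>.\<close>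

lemma dominant_max:
  assumes "u \<in> W" "\<And>\<alpha>. \<alpha> \<in> \<Delta> \<Longrightarrow> x \<bullet> \<alpha> \<ge> 0" "\<gamma> \<in> \<Delta>"
  shows "fund \<gamma> \<bullet> u x \<le> fund \<gamma> \<bullet> x"
  using assms(1)
proof (induction "card (inversions u)" arbitrary: u)
  case 0
  then have "inversions u = {}" using finite_inversions by simp
  then have "u = id"
    using simple_pos by (intro weyl_positive_id[OF 0(2)]) (auto simp: inversions_def)
  then show ?case by simp
next
  case (Suc n)
  have "u \<noteq> id" using Suc(2) by (auto simp: inversions_def)
  then obtain \<alpha> where a: "\<alpha> \<in> \<Delta>" "u \<alpha> \<notin> pos" using weyl_positive_id[OF Suc(3)] by auto
  define v where "v = u \<circ> reflection \<alpha>"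
  have v: "v \<in> W" unfolding v_def using Suc(3) a by (intro weyl_comp simple_in_weyl)
  have "n = card (inversions v)"
    using card_inversions_reflection(2)[OF Suc(3) a] Suc(2) by (simp add: v_def)
  from Suc(1)[OF this v] have IH: "fund \<gamma> \<bullet> v x \<le> fund \<gamma> \<bullet> x" .
  have va: "v \<alpha> = - u \<alpha>"
    using a by (simp add: v_def reflection_self simple_nonzero linear_neg[OF weyl_linear[OF Suc(3)]])
  have "v \<alpha> \<in> pos"
    using a(2) pos_iff_not_neg[OF weyl_root[OF Suc(3) simple_root[OF a(1)]]] va by simp
  then have f: "fund \<gamma> \<bullet> v \<alpha> \<ge> 0" using fund_pos_nonneg assms(3) by blast
  have "u x = v (reflection \<alpha> x)" by (simp add: v_def)
  also have "\<dots> = v x - coroot_pairing x \<alpha> *\<^sub>R v \<alpha>"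
    unfolding reflection_def by (simp add: linear_diff[OF weyl_linear[OF v]] linear_scale[OF weyl_linear[OF v]])
  finally have "fund \<gamma> \<bullet> u x = fund \<gamma> \<bullet> v x - coroot_pairing x \<alpha> * (fund \<gamma> \<bullet> v \<alpha>)"
    by (simp add: inner_diff_right)
  moreover have "coroot_pairing x \<alpha> \<ge> 0" using assms(2)[OF a(1)] by (simp add: coroot_pairing_def)
  ultimately have "fund \<gamma> \<bullet> u x \<le> fund \<gamma> \<bullet> v x" using f by simp
  then show ?case using IH by simp
qed

lemma dominant_max_rho:
  assumes "u \<in> W" "\<And>\<alpha>. \<alpha> \<in> \<Delta> \<Longrightarrow> x \<bullet> \<alpha> \<ge> 0" "x \<in> span \<Phi>"
  shows "rho \<bullet> u x \<le> rho \<bullet> x" and "rho \<bullet> u x = rho \<bullet> x \<Longrightarrow> u x = x"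
proof -
  have r: "rho \<bullet> y = (\<Sum>\<gamma>\<in>\<Delta>. fund \<gamma> \<bullet> y)" for y by (simp add: rho_def inner_sum_left)
  have le: "fund \<gamma> \<bullet> u x \<le> fund \<gamma> \<bullet> x" if "\<gamma> \<in> \<Delta>" for \<gamma>
    using dominant_max[OF assms(1,2) that] by blast
  then show "rho \<bullet> u x \<le> rho \<bullet> x" unfolding r by (intro sum_mono)
  assume "rho \<bullet> u x = rho \<bullet> x"
  then have "(\<Sum>\<gamma>\<in>\<Delta>. fund \<gamma> \<bullet> (x - u x)) = 0"
    by (simp add: r inner_diff_right sum_subtractf)
  then have "\<forall>\<gamma>\<in>\<Delta>. fund \<gamma> \<bullet> (x - u x) = 0"
    by (subst (asm) sum_nonneg_eq_0_iff[OF finite_base]) (auto simp: inner_diff_right le)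
  then have "x - u x = 0"
    using span_fund_zero[OF span_diff[OF assms(3) weyl_span[OF assms(1,3)]]] by blast
  then show "u x = x" by simp
qed

subsection \<open>Steinberg weights\<close>

text \<open>The inverse makes these left descents: left multiplication by the reflection in such a
  \<open>\<gamma>\<close> shortens \<open>w\<close>.\<close>

definition descents :: "('a \<Rightarrow> 'a) \<Rightarrow> 'a set" where
  "descents w = {\<gamma> \<in> \<Delta>. winv w \<gamma> \<notin> pos}"

definition descent_weight :: "('a \<Rightarrow> 'a) \<Rightarrow> 'a" where
  "descent_weight w = (\<Sum>\<gamma>\<in>descents w. fund \<gamma>)"

definition steinberg_weight :: "('a \<Rightarrow> 'a) \<Rightarrow> 'a" where
  "steinberg_weight w = winv w (descent_weight w)"

lemma descents_base: "descents w \<subseteq> \<Delta>" and finite_descents: "finite (descents w)"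
  using finite_base by (auto simp: descents_def)

lemma descent_weight_lattice: "descent_weight w \<in> X"
  unfolding descent_weight_def using descents_base by (intro lattice_sum fund_lattice) auto

lemma lattice_span: "x \<in> X \<Longrightarrow> x \<in> span \<Phi>"
  by (simp add: weight_lattice_def)

lemma steinberg_weight_lattice: "w \<in> W \<Longrightarrow> steinberg_weight w \<in> X"
  unfolding steinberg_weight_def using weyl_lattice[OF weyl_inv descent_weight_lattice] .

lemma descent_weight_inner:
  "\<delta> \<in> \<Delta> \<Longrightarrow> descent_weight w \<bullet> \<delta> = (if \<delta> \<in> descents w then (\<delta> \<bullet> \<delta>) / 2 else 0)"
  unfolding descent_weight_def
  by (simp add: inner_sum_left fund_inner finite_descents)

lemma descent_weight_dominant: "\<delta> \<in> \<Delta> \<Longrightarrow> descent_weight w \<bullet> \<delta> \<ge> 0"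
  by (simp add: descent_weight_inner)

text \<open>The vector \<open>y\<close>, the difference of \<open>rho\<close> and its image under
  the inverse of \<open>u\<close>, is a nonnegative combination of simple roots. It is orthogonal to
  the descent weight, hence involves only simple roots outside \<open>descents w\<close>, and on
  these \<open>w rho\<close> is positive. So \<open>y \<bullet> w rho\<close>, which is the
  difference of the two heights, is nonnegative and vanishes only for \<open>y = 0\<close>.\<close>

lemma stabilizer_descent_weight:
  assumes "w \<in> W" "u \<in> W" "u (descent_weight w) = descent_weight w"
  shows "rho \<bullet> u (w rho) \<le> rho \<bullet> w rho" "rho \<bullet> u (w rho) = rho \<bullet> w rho \<Longrightarrow> u = id"
proof -
  define v where "v = winv u"
  have v: "v \<in> W" using weyl_inv assms(2) by (simp add: v_def)
  define y where "y = rho - v rho"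
  have ys: "y \<in> span \<Phi>" unfolding y_def using span_diff[OF rho_span weyl_span[OF v rho_span]] .
  have f: "fund \<gamma> \<bullet> y \<ge> 0" if "\<gamma> \<in> \<Delta>" for \<gamma>
    using dominant_max[OF v less_imp_le[OF rho_simple_pos] that] by (simp add: y_def inner_diff_right)
  have rv: "v rho \<bullet> x = rho \<bullet> u x" for x unfolding v_def by (rule weyl_inv_inner[OF assms(2)])
  have "y \<bullet> descent_weight w = 0" using assms(3) by (simp add: y_def inner_diff_left rv)
  then have "(\<Sum>\<gamma>\<in>descents w. fund \<gamma> \<bullet> y) = 0"
    by (simp add: descent_weight_def inner_sum_right inner_commute)
  then have fz: "\<forall>\<gamma>\<in>descents w. fund \<gamma> \<bullet> y = 0"
    using f descents_base by (subst (asm) sum_nonneg_eq_0_iff[OF finite_descents]) auto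
  have wp: "\<gamma> \<bullet> w rho > 0" if "\<gamma> \<in> \<Delta>" "\<gamma> \<notin> descents w" for \<gamma>
    using that weyl_inv_inner[OF assms(1), of \<gamma> rho] by (simp add: descents_def pos_def inner_commute)
  define t where "t \<gamma> = (2 * (fund \<gamma> \<bullet> y) / (\<gamma> \<bullet> \<gamma>)) * (\<gamma> \<bullet> w rho)" for \<gamma>
  have t: "t \<gamma> \<ge> 0" if "\<gamma> \<in> \<Delta>" for \<gamma>
    unfolding t_def using f[OF that] fz wp[OF that] by (cases "\<gamma> \<in> descents w") auto
  have yw: "y \<bullet> w rho = sum t \<Delta>"
    by (subst span_expansion[OF ys]) (simp add: inner_sum_left t_def)
  have e: "y \<bullet> w rho = rho \<bullet> w rho - rho \<bullet> u (w rho)"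
    by (simp add: y_def inner_diff_left rv)
  show "rho \<bullet> u (w rho) \<le> rho \<bullet> w rho" using e yw sum_nonneg[of \<Delta> t] t by simp
  assume "rho \<bullet> u (w rho) = rho \<bullet> w rho"
  then have "\<forall>\<gamma>\<in>\<Delta>. t \<gamma> = 0"
    using e yw sum_nonneg_eq_0_iff[OF finite_base, of t] t by simp
  then have "fund \<gamma> \<bullet> y = 0" if "\<gamma> \<in> \<Delta>" for \<gamma>
    using that fz wp[OF that] simple_nonzero[OF that] by (cases "\<gamma> \<in> descents w") (auto simp: t_def)
  then have "v rho = rho" using span_fund_zero[OF ys] by (simp add: y_def)
  then have "v = id" using weyl_fixes_rho v by auto
  then show "u = id" using weyl_bij[OF assms(2)] by (metis v_def inv_id inv_inv_eq)
qed

text \<open>Two comparisons of sums. Each \<open>u w\<close> sends the dominant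
  \<open>descent_weight w\<close> to a weight of at most the same height, so the hypothesis forces
  equality in every term and \<open>u w\<close> fixes the weight. Then the height of
  \<open>p w rho\<close> is at most that of \<open>w rho\<close>; as \<open>p\<close> only permutes
  the summands, equality holds again, and the stabilizer lemma gives
  \<open>u w = id\<close>.\<close>

lemma steinberg_permutation:
  assumes p: "bij_betw p W W"
    and ge: "(\<Sum>w\<in>W. rho \<bullet> p w (steinberg_weight w)) \<ge> (\<Sum>w\<in>W. rho \<bullet> descent_weight w)"
    and w: "w \<in> W"
  shows "p w = w"
proof -
  define u where "u w = p w \<circ> winv w" for w
  have pW: "p w \<in> W" if "w \<in> W" for w using p that by (auto simp: bij_betw_def)
  have uW: "u w \<in> W" if "w \<in> W" for w unfolding u_def using pW[OF that] weyl_inv[OF that] weyl_comp by blast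
  have us: "p w (steinberg_weight w) = u w (descent_weight w)" for w
    by (simp add: steinberg_weight_def u_def)
  have le: "rho \<bullet> u w (descent_weight w) \<le> rho \<bullet> descent_weight w"
    and eq: "rho \<bullet> u w (descent_weight w) = rho \<bullet> descent_weight w \<Longrightarrow> u w (descent_weight w) = descent_weight w"
    if "w \<in> W" for w
    using dominant_max_rho[OF uW[OF that], of "descent_weight w"] descent_weight_dominant
      lattice_span[OF descent_weight_lattice] by blast+
  have sums: "(\<Sum>w\<in>W. rho \<bullet> descent_weight w - rho \<bullet> u w (descent_weight w)) = 0"
    using ge sum_mono[of W "\<lambda>w. rho \<bullet> u w (descent_weight w)" "\<lambda>w. rho \<bullet> descent_weight w"] le
    unfolding us sum_subtractf by simp
  have fixd: "u w (descent_weight w) = descent_weight w" if "w \<in> W" for w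
    using sums that le
    by (subst (asm) sum_nonneg_eq_0_iff[OF finite_weyl]) (auto intro!: eq)
  have upw: "u w (w rho) = p w rho" if "w \<in> W" for w
    using weyl_bij[OF that] by (simp add: u_def bij_is_inj)
  have le2: "rho \<bullet> p w rho \<le> rho \<bullet> w rho" if "w \<in> W" for w
    using stabilizer_descent_weight(1)[OF that uW fixd] that by (simp add: upw)
  have "(\<Sum>w\<in>W. rho \<bullet> p w rho) = (\<Sum>w\<in>W. rho \<bullet> w rho)"
    by (rule sum.reindex_bij_betw[OF p])
  then have "(\<Sum>w\<in>W. rho \<bullet> w rho - rho \<bullet> p w rho) = 0" by (simp add: sum_subtractf)
  then have "rho \<bullet> p w rho = rho \<bullet> w rho" using w le2
    by (subst (asm) sum_nonneg_eq_0_iff[OF finite_weyl]) auto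
  then have "u w = id" using stabilizer_descent_weight(2)[OF w uW[OF w] fixd[OF w]] w by (simp add: upw)
  then show "p w = w"
    using weyl_bij[OF w] by (metis u_def bij_is_inj comp_assoc comp_id id_comp inv_o_cancel)
qed

text \<open>The orbit sum is fixed by all reflections and lies in the span of the roots, so it is 0.
  Nonpositive heights that add up to 0 all vanish.\<close>

lemma invariant_weight_zero:
  assumes "x \<in> span \<Phi>" "\<And>w. w \<in> W \<Longrightarrow> rho \<bullet> w x \<le> 0"
  shows "rho \<bullet> x = 0"
proof -
  define y where "y = (\<Sum>w\<in>W. w x)"
  have y: "reflection \<alpha> y = y" if "\<alpha> \<in> \<Phi>" for \<alpha>
  proof -
    have b: "bij_betw (\<lambda>w. reflection \<alpha> \<circ> w) W W"
      by (rule bij_betw_byWitness[where f' = "\<lambda>w. reflection \<alpha> \<circ> w"])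
        (auto simp: comp_assoc[symmetric] intro!: weyl_group.step that)
    have "reflection \<alpha> y = (\<Sum>w\<in>W. (reflection \<alpha> \<circ> w) x)"
      by (simp add: y_def linear_sum[OF linear_reflection])
    also have "\<dots> = y" unfolding y_def by (rule sum.reindex_bij_betw[OF b])
    finally show ?thesis .
  qed
  have yo: "y \<bullet> \<alpha> = 0" if "\<alpha> \<in> \<Phi>" for \<alpha>
    using y[OF that] that zero_not_root by (auto simp: reflection_def coroot_pairing_def)
  have "y \<in> span \<Phi>" unfolding y_def using weyl_span[OF _ assms(1)] by (intro span_sum)
  then have "y \<bullet> y = 0"
    using span_induct[of y \<Phi> "\<lambda>z. y \<bullet> z = 0"] yo
    by (auto simp: subspace_def inner_add_right)
  then have "(\<Sum>w\<in>W. - (rho \<bullet> w x)) = 0" by (simp add: y_def sum_negf flip: inner_sum_right)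
  then have "\<forall>w\<in>W. - (rho \<bullet> w x) = 0"
    by (subst (asm) sum_nonneg_eq_0_iff[OF finite_weyl]) (auto simp: assms(2))
  then show ?thesis using weyl_group.id by fastforce
qed

end

section \<open>Group algebras\<close>

abbreviation lookup :: "('k \<Rightarrow>\<^sub>0 'c::zero) \<Rightarrow> 'k \<Rightarrow> 'c" where "lookup \<equiv> Poly_Mapping.lookup"
abbreviation keys :: "('k \<Rightarrow>\<^sub>0 'c::zero) \<Rightarrow> 'k set" where "keys \<equiv> Poly_Mapping.keys"
abbreviation single :: "'k \<Rightarrow> 'c::zero \<Rightarrow> 'k \<Rightarrow>\<^sub>0 'c" where "single \<equiv> Poly_Mapping.single"

lemma poly_mapping_single_sum:
  fixes p :: "'k \<Rightarrow>\<^sub>0 'c::comm_monoid_add"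
  shows "p = (\<Sum>k\<in>keys p. single k (lookup p k))"
proof (rule poly_mapping_eqI)
  fix k
  have "lookup (\<Sum>k\<in>keys p. single k (lookup p k)) k =
      (\<Sum>j\<in>keys p. if j = k then lookup p j else 0)"
    unfolding lookup_sum by (rule sum.cong) (auto simp: lookup_single when_def)
  also have "\<dots> = lookup p k" by (auto simp: in_keys_iff)
  finally show "lookup p k = lookup (\<Sum>k\<in>keys p. single k (lookup p k)) k" by simp
qed

lemma poly_mapping_induct_on [consumes 1, case_names zero single add]:
  fixes p :: "'k \<Rightarrow>\<^sub>0 'c::comm_monoid_add"
  assumes "keys p \<subseteq> K" "P 0"
    and "\<And>k a. k \<in> K \<Longrightarrow> P (single k a)"
    and add: "\<And>p q. keys p \<subseteq> K \<Longrightarrow> keys q \<subseteq> K \<Longrightarrow> P p \<Longrightarrow> P q \<Longrightarrow> P (p + q)"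
  shows "P p"
proof -
  have "P (\<Sum>k\<in>A. single k (lookup p k)) \<and>
      keys (\<Sum>k\<in>A. single k (lookup p k)) \<subseteq> K" if "finite A" "A \<subseteq> K" for A
    using that
  proof (induction A rule: finite_induct)
    case (insert x A)
    have "keys (single x (lookup p x)) \<subseteq> K" using insert by auto
    moreover have "P (single x (lookup p x))" using insert by (intro assms(3)) auto
    moreover have "P (\<Sum>k\<in>A. single k (lookup p k))" "keys (\<Sum>k\<in>A. single k (lookup p k)) \<subseteq> K"
      using insert by auto
    ultimately have "P (single x (lookup p x) + (\<Sum>k\<in>A. single k (lookup p k)))"
      and "keys (single x (lookup p x) + (\<Sum>k\<in>A. single k (lookup p k))) \<subseteq> K"
      using add keys_add[of "single x (lookup p x)" "\<Sum>k\<in>A. single k (lookup p k)"] by blast+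
    then show ?case using insert(1,2) by simp
  qed (use assms in simp)
  from this[OF finite_keys assms(1)] show ?thesis
    using poly_mapping_single_sum[of p] by simp
qed

lemma poly_mapping_induct_single [case_names zero single add]:
  fixes p :: "'k \<Rightarrow>\<^sub>0 'c::comm_monoid_add"
  assumes "P 0" "\<And>k a. P (single k a)" "\<And>p q. P p \<Longrightarrow> P q \<Longrightarrow> P (p + q)"
  shows "P p"
  by (rule poly_mapping_induct_on[of p UNIV]) (use assms in auto)

lemma keys_uminus' [simp]: "keys (- p) = keys (p :: 'k \<Rightarrow>\<^sub>0 'c::ab_group_add)"
  by (auto simp: in_keys_iff)

lemma keys_diff': "keys (p - q) \<subseteq> keys p \<union> keys (q :: 'k \<Rightarrow>\<^sub>0 'c::ab_group_add)"
  by (auto simp: in_keys_iff lookup_minus)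

lemma lookup_single_mult:
  fixes g :: "'k::ab_group_add \<Rightarrow>\<^sub>0 'c::comm_ring_1"
  shows "lookup (single x a * g) k = a * lookup g (k - x)"
proof (induction g rule: poly_mapping_induct_single)
  case (single y b)
  show ?case by (auto simp: mult_single lookup_single when_def algebra_simps)
qed (simp_all add: distrib_left lookup_add)

lemma lookup_mult_sum:
  fixes f g :: "'k::ab_group_add \<Rightarrow>\<^sub>0 'c::comm_ring_1"
  shows "lookup (f * g) k = (\<Sum>x\<in>keys f. lookup f x * lookup g (k - x))"
proof -
  have "lookup (f * g) k = lookup ((\<Sum>x\<in>keys f. single x (lookup f x)) * g) k"
    using poly_mapping_single_sum[of f] by simp
  then show ?thesis by (simp add: sum_distrib_right lookup_sum lookup_single_mult)
qed

abbreviation E :: "'k \<Rightarrow> 'k \<Rightarrow>\<^sub>0 'c::comm_ring_1" where "E x \<equiv> single x 1"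

lemma E_add: "E (x + y) = E x * (E y :: 'k::ab_group_add \<Rightarrow>\<^sub>0 'c::comm_ring_1)"
  by (simp add: mult_single)

lemma E_sum: "E (\<Sum>i\<in>A. f i) = (\<Prod>i\<in>A. E (f i) :: 'k::ab_group_add \<Rightarrow>\<^sub>0 'c::comm_ring_1)"
  by (induction A rule: infinite_finite_induct) (simp_all add: E_add)

lemma E_power: "E x ^ n = (E ((real n) *\<^sub>R x) :: 'k::real_vector \<Rightarrow>\<^sub>0 'c::comm_ring_1)"
  by (induction n) (simp_all add: mult_single algebra_simps)

subsection \<open>Leading terms\<close>

text \<open>Being monic in this sense replaces any assumption on the coefficients: multiplication by
  such an element is injective over every commutative ring.\<close>

definition top_at :: "'k::real_inner \<Rightarrow> ('k \<Rightarrow>\<^sub>0 'c::comm_ring_1) \<Rightarrow> 'k \<Rightarrow> bool" where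
  "top_at r f \<mu> \<longleftrightarrow> lookup f \<mu> = 1 \<and> (\<forall>x\<in>keys f. x \<noteq> \<mu> \<longrightarrow> r \<bullet> x < r \<bullet> \<mu>)"

lemma top_at_le: "top_at r f \<mu> \<Longrightarrow> x \<in> keys f \<Longrightarrow> r \<bullet> x \<le> r \<bullet> \<mu>"
  unfolding top_at_def by (cases "x = \<mu>") auto

text \<open>Only the exponent \<open>\<mu>\<close> of \<open>f\<close> can reach the height of
  \<open>\<mu> + \<nu>\<close>. The vector \<open>\<nu>\<close> merely bounds the heights in
  \<open>g\<close> and may have coefficient 0 there; below it is a highest key of \<open>g\<close>
  or simply \<open>0\<close>.\<close>

lemma top_lookup_mult:
  assumes f: "top_at r f \<mu>" and g: "\<And>y. y \<in> keys g \<Longrightarrow> r \<bullet> y \<le> r \<bullet> \<nu>"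
  shows "lookup (f * g) (\<mu> + \<nu>) = lookup g \<nu>"
proof -
  have \<mu>: "\<mu> \<in> keys f" "lookup f \<mu> = 1" using f by (auto simp: top_at_def in_keys_iff)
  have "lookup f x * lookup g (\<mu> + \<nu> - x) = (if x = \<mu> then lookup g \<nu> else 0)"
    if "x \<in> keys f" for x
  proof (cases "x = \<mu>")
    case False
    then have "r \<bullet> x < r \<bullet> \<mu>" using f that by (auto simp: top_at_def)
    then have "\<not> r \<bullet> (\<mu> + \<nu> - x) \<le> r \<bullet> \<nu>" by (simp add: inner_diff_right inner_add_right)
    then have "\<mu> + \<nu> - x \<notin> keys g" using g by blast
    then show ?thesis using False by (simp add: in_keys_iff)
  qed (simp add: \<mu>)
  then show ?thesis
    unfolding lookup_mult_sum using \<mu> by simp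
qed

lemma finite_has_max:
  fixes h :: "'k \<Rightarrow> real"
  assumes "finite A" "A \<noteq> {}"
  shows "\<exists>x\<in>A. \<forall>y\<in>A. h y \<le> h x"
proof -
  have "Max (h ` A) \<in> h ` A" using assms by (intro Max_in) auto
  then obtain x where "x \<in> A" "Max (h ` A) = h x" by auto
  then show ?thesis using assms(1) Max_ge[of "h ` A"] by (intro bexI[of _ x]) auto
qed

lemma top_at_E: "top_at r (E x) x"
  by (auto simp: top_at_def split: if_splits)

lemma top_at_one: "top_at r 1 0"
  using top_at_E[of r 0] by simp

lemma top_at_mult:
  assumes f: "top_at r f \<mu>" and g: "top_at r g \<nu>"
  shows "top_at r (f * g) (\<mu> + \<nu>)"
  unfolding top_at_def
proof (intro conjI ballI impI)
  show "lookup (f * g) (\<mu> + \<nu>) = 1"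
    using top_lookup_mult[OF f top_at_le[OF g]] g by (simp add: top_at_def)
  fix x assume x: "x \<in> keys (f * g)" "x \<noteq> \<mu> + \<nu>"
  then obtain a b where ab: "x = a + b" "a \<in> keys f" "b \<in> keys g"
    using keys_mult[of f g] by blast
  then have "a \<noteq> \<mu> \<or> b \<noteq> \<nu>" using x by auto
  then have "r \<bullet> a < r \<bullet> \<mu> \<or> r \<bullet> b < r \<bullet> \<nu>" using f g ab by (auto simp: top_at_def)
  moreover have "r \<bullet> a \<le> r \<bullet> \<mu>" "r \<bullet> b \<le> r \<bullet> \<nu>" using top_at_le f g ab by blast+
  ultimately show "r \<bullet> x < r \<bullet> (\<mu> + \<nu>)" unfolding ab inner_add_right by linarith
qed

lemma top_at_prod:
  "finite A \<Longrightarrow> (\<And>i. i \<in> A \<Longrightarrow> top_at r (f i) (m i)) \<Longrightarrow> top_at r (\<Prod>i\<in>A. f i) (\<Sum>i\<in>A. m i)"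
  by (induction A rule: finite_induct) (auto simp: top_at_one intro: top_at_mult)

lemma top_at_sum:
  assumes "finite A" "a \<in> A" "top_at r (f a) \<mu>"
    and less: "\<And>b x. b \<in> A \<Longrightarrow> b \<noteq> a \<Longrightarrow> x \<in> keys (f b) \<Longrightarrow> r \<bullet> x < r \<bullet> \<mu>"
  shows "top_at r (\<Sum>b\<in>A. f b) \<mu>"
proof -
  have "lookup (f b) \<mu> = (if b = a then 1 else 0)" if "b \<in> A" for b
    using assms(3) less[OF that, of \<mu>] by (auto simp: top_at_def in_keys_iff)
  then have "lookup (\<Sum>b\<in>A. f b) \<mu> = 1"
    using assms(1,2) by (simp add: lookup_sum)
  moreover have "r \<bullet> x < r \<bullet> \<mu>" if x: "x \<in> keys (\<Sum>b\<in>A. f b)" "x \<noteq> \<mu>" for x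
  proof -
    have "(\<Sum>b\<in>A. lookup (f b) x) \<noteq> 0" using x by (simp add: in_keys_iff lookup_sum)
    then obtain b where b: "b \<in> A" "lookup (f b) x \<noteq> 0"
      by (rule sum.not_neutral_contains_not_neutral)
    then have "x \<in> keys (f b)" by (simp add: in_keys_iff)
    then show ?thesis using b less[of b x] assms(3) x(2) by (cases "b = a") (auto simp: top_at_def)
  qed
  ultimately show ?thesis by (auto simp: top_at_def)
qed

lemma top_at_power: "top_at r f \<mu> \<Longrightarrow> top_at r (f ^ n) (real n *\<^sub>R \<mu>)"
  using top_at_prod[of "{..<n}" r "\<lambda>_. f" "\<lambda>_. \<mu>"] by (simp add: scaleR_left.sum sum_constant_scaleR)

lemma top_at_nonzero_divisor:
  assumes f: "top_at r f \<mu>" and "f * g = 0"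
  shows "g = 0"
proof (rule ccontr)
  assume "g \<noteq> 0"
  then have "keys g \<noteq> {}" by (metis in_keys_iff empty_iff lookup_zero poly_mapping_eqI)
  then obtain \<nu> where \<nu>: "\<nu> \<in> keys g" "\<And>y. y \<in> keys g \<Longrightarrow> r \<bullet> y \<le> r \<bullet> \<nu>"
    using finite_has_max[OF finite_keys, of g "\<lambda>y. r \<bullet> y"] by blast
  have "lookup (f * g) (\<mu> + \<nu>) = lookup g \<nu>" by (rule top_lookup_mult[OF f \<nu>(2)])
  then show False using \<nu>(1) assms(2) by (simp add: in_keys_iff)
qed

lemma top_at_cancel: "top_at r f \<mu> \<Longrightarrow> f * g = f * h \<Longrightarrow> g = h"
  using top_at_nonzero_divisor[of r f \<mu> "g - h"] by (simp add: right_diff_distrib)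

text \<open>If \<open>\<nu>\<close> is a key of \<open>g\<close> of maximal height, then
  \<open>\<mu> + \<nu>\<close> survives in \<open>f * g\<close>, so \<open>\<nu>\<close> is 0 or has
  negative height. This is later applied to \<open>f = denom ^ n\<close>.\<close>

lemma top_at_factor:
  assumes f: "top_at r f \<mu>" and fg: "top_at r (f * g) \<mu>"
  shows "lookup g 0 = 1" "\<And>x. x \<in> keys g \<Longrightarrow> r \<bullet> x \<le> 0"
    "\<And>x. x \<in> keys g \<Longrightarrow> r \<bullet> x = 0 \<Longrightarrow> x = 0"
proof -
  have bound: "\<nu> = 0 \<or> r \<bullet> \<nu> < 0"
    if \<nu>: "\<nu> \<in> keys g" "\<And>y. y \<in> keys g \<Longrightarrow> r \<bullet> y \<le> r \<bullet> \<nu>" for \<nu>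
  proof -
    have "lookup (f * g) (\<mu> + \<nu>) \<noteq> 0" using top_lookup_mult[OF f \<nu>(2)] \<nu>(1) by (simp add: in_keys_iff)
    then have "\<mu> + \<nu> \<in> keys (f * g)" by (simp add: in_keys_iff)
    then have "\<mu> + \<nu> = \<mu> \<or> r \<bullet> (\<mu> + \<nu>) < r \<bullet> \<mu>" using fg unfolding top_at_def by blast
    then show ?thesis by (simp add: inner_add_right)
  qed
  show le: "r \<bullet> x \<le> 0" if x: "x \<in> keys g" for x
  proof -
    obtain \<nu> where \<nu>: "\<nu> \<in> keys g" "\<And>y. y \<in> keys g \<Longrightarrow> r \<bullet> y \<le> r \<bullet> \<nu>"
      using finite_has_max[of "keys g" "\<lambda>y. r \<bullet> y"] x by (metis empty_iff finite_keys)
    then show ?thesis using bound[OF \<nu>] \<nu>(2)[OF x] by auto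
  qed
  show "x = 0" if "x \<in> keys g" "r \<bullet> x = 0" for x
    using bound[OF that(1)] le that(2) by auto
  show "lookup g 0 = 1"
    using top_lookup_mult[OF f, of g 0] le fg by (simp add: top_at_def)
qed

subsection \<open>Restriction to a set of exponents and divisibility\<close>

lift_definition restrict_keys :: "'k set \<Rightarrow> ('k \<Rightarrow>\<^sub>0 'c::zero) \<Rightarrow> ('k \<Rightarrow>\<^sub>0 'c)"
  is "\<lambda>K f x. if x \<in> K then f x else 0"
  by (rule finite_subset) auto

lemma keys_restrict: "keys (restrict_keys K f) = keys f \<inter> K"
  by (auto simp: in_keys_iff restrict_keys.rep_eq split: if_splits)

lemma restrict_keys_id: "keys f \<subseteq> K \<Longrightarrow> restrict_keys K f = f"
  by (rule poly_mapping_eqI) (auto simp: restrict_keys.rep_eq in_keys_iff)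

text \<open>Restriction to a set of exponents that is stable under the translations by the keys of
  \<open>f\<close> is linear over \<open>f\<close>. With a lattice it keeps quotients inside
  \<open>S\<close>; with a union of parallel lines it decides divisibility.\<close>

lemma restrict_keys_mult:
  fixes f g :: "'k::ab_group_add \<Rightarrow>\<^sub>0 'c::comm_ring_1"
  assumes "keys f \<subseteq> L" "\<And>x y. y \<in> L \<Longrightarrow> x - y \<in> K \<longleftrightarrow> x \<in> K"
  shows "restrict_keys K (f * g) = f * restrict_keys K g"
proof (rule poly_mapping_eqI)
  fix x
  have "lookup g (x - y) = lookup (restrict_keys K g) (x - y)" if "y \<in> keys f" "x \<in> K" for y
    using assms that by (auto simp: restrict_keys.rep_eq)
  moreover have "lookup (restrict_keys K g) (x - y) = 0" if "y \<in> keys f" "x \<notin> K" for y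
    using assms that by (auto simp: restrict_keys.rep_eq)
  ultimately show "lookup (restrict_keys K (f * g)) x = lookup (f * restrict_keys K g) x"
    by (simp add: restrict_keys.rep_eq[of K "f * g"] lookup_mult_sum cong: sum.cong)
qed

lemma one_minus_E_dvd_multiple:
  "1 - E x dvd (1 :: 'k::real_vector \<Rightarrow>\<^sub>0 'c::comm_ring_1) - E (of_int n *\<^sub>R x)"
proof (cases "n \<ge> 0")
  case True
  then have "E (of_int n *\<^sub>R x) = (E x :: 'k \<Rightarrow>\<^sub>0 'c) ^ nat n" by (simp add: E_power)
  then show ?thesis by (simp add: one_diff_power_eq)
next
  case False
  define m where "m = nat (- n)"
  have m: "of_int n *\<^sub>R x = - (real m *\<^sub>R x)" using False by (simp add: m_def)
  have "1 - E (of_int n *\<^sub>R x) = - E (of_int n *\<^sub>R x) * (1 - E x ^ m :: 'k \<Rightarrow>\<^sub>0 'c)"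
    by (simp add: E_power m algebra_simps mult_single)
  then show ?thesis by (simp add: one_diff_power_eq)
qed

text \<open>Since \<open>1 - E \<beta>\<close> divides \<open>1 - E \<beta> ^ n\<close>, the
  divisibility hypothesis passes to \<open>(1 - E \<beta> ^ n) * g\<close>. For suitable
  \<open>n\<close> the translate of \<open>g\<close> by n\<beta> misses all lines in direction
  \<open>\<alpha>\<close> through keys of \<open>g\<close>, so restriction to these lines leaves
  \<open>g\<close> itself as a multiple of \<open>1 - E \<alpha>\<close>.\<close>

lemma one_minus_E_coprime:
  fixes g :: "'k::real_vector \<Rightarrow>\<^sub>0 'c::comm_ring_1"
  assumes dvd: "1 - E \<alpha> dvd (1 - E \<beta>) * g" and indep: "\<And>c. \<beta> \<noteq> c *\<^sub>R \<alpha>"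
  shows "1 - E \<alpha> dvd g"
proof -
  \<comment> \<open>The \<open>n\<close> for which n\<beta> is congruent to \<open>d\<close> modulo
    the line of \<open>\<alpha>\<close>; two such \<open>n\<close> would make \<open>\<beta>\<close>
    proportional to \<open>\<alpha>\<close>. Only differences of keys of \<open>g\<close> matter as
    \<open>d\<close>, so almost every \<open>n\<close> is good.\<close>
  define bad where "bad d = {n::nat. \<exists>c. real n *\<^sub>R \<beta> - d = c *\<^sub>R \<alpha>}" for d
  have fin: "finite (bad d)" for d
  proof -
    have "m = n" if bad: "m \<in> bad d" "n \<in> bad d" for m n
    proof (rule ccontr)
      assume mn: "m \<noteq> n"
      obtain a b where ab: "real m *\<^sub>R \<beta> - d = a *\<^sub>R \<alpha>" "real n *\<^sub>R \<beta> - d = b *\<^sub>R \<alpha>"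
        using bad by (auto simp: bad_def)
      have "(real m - real n) *\<^sub>R \<beta> = (real m *\<^sub>R \<beta> - d) - (real n *\<^sub>R \<beta> - d)"
        by (simp add: scaleR_diff_left)
      also have "\<dots> = (a - b) *\<^sub>R \<alpha>" unfolding ab by (simp add: scaleR_diff_left)
      finally have "\<beta> = ((a - b) / (real m - real n)) *\<^sub>R \<alpha>"
        using mn by (metis (no_types, lifting) divide_inverse eq_iff_diff_eq_0 mult.commute
            of_nat_eq_iff real_vector_affinity_eq scaleR_scaleR scaleR_one left_inverse)
      then show False using indep by blast
    qed
    then have "bad d = {} \<or> (\<exists>m. bad d \<subseteq> {m})" by blast
    then show ?thesis using finite_subset by auto
  qed
  define D where "D = (\<lambda>(x, y). x - y) ` (keys g \<times> keys g)"
  have "finite (\<Union>d\<in>D. bad d)" using fin by (auto simp: D_def)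
  then obtain n where n: "n \<notin> (\<Union>d\<in>D. bad d)" using ex_new_if_finite infinite_UNIV_nat by blast
  define K where "K = {x. \<exists>y\<in>keys g. \<exists>c. x - y = c *\<^sub>R \<alpha>}"
  have "1 - E \<beta> dvd 1 - (E \<beta> :: 'k \<Rightarrow>\<^sub>0 'c) ^ n"
    by (simp add: one_diff_power_eq)
  then have "1 - E \<alpha> dvd (1 - E \<beta> ^ n) * g"
    using dvd by (meson dvd_trans mult_dvd_mono dvd_refl)
  then obtain k where k: "(1 - E \<beta> ^ n) * g = (1 - E \<alpha>) * k" by (rule dvdE)
  have shift: "x - y \<in> K \<longleftrightarrow> x \<in> K" if y: "y \<in> {0, \<alpha>}" for x y
  proof
    assume "x - y \<in> K"
    then obtain z c where z: "z \<in> keys g" "x - y - z = c *\<^sub>R \<alpha>" by (auto simp: K_def)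
    have "x - z = (if y = 0 then c else c + 1) *\<^sub>R \<alpha>"
      using z(2) y by (auto simp: algebra_simps)
    then show "x \<in> K" using z(1) unfolding K_def by blast
  next
    assume "x \<in> K"
    then obtain z c where z: "z \<in> keys g" "x - z = c *\<^sub>R \<alpha>" by (auto simp: K_def)
    have "x - y - z = (if y = 0 then c else c - 1) *\<^sub>R \<alpha>"
      using z(2) y by (auto simp: algebra_simps)
    then show "x - y \<in> K" using z(1) unfolding K_def by blast
  qed
  have keys1: "keys (1 - E \<alpha> :: 'k \<Rightarrow>\<^sub>0 'c) \<subseteq> {0, \<alpha>}"
    using keys_diff'[of 1 "E \<alpha>"] by auto
  have gK: "keys g \<subseteq> K" unfolding K_def by (auto intro!: exI[of _ 0])
  have "restrict_keys K ((1 - E \<beta> ^ n) * g) = g"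
  proof (rule poly_mapping_eqI)
    fix x
    have "lookup g (x - real n *\<^sub>R \<beta>) = 0" if "x \<in> K"
    proof (rule ccontr)
      assume "lookup g (x - real n *\<^sub>R \<beta>) \<noteq> 0"
      then have xk: "x - real n *\<^sub>R \<beta> \<in> keys g" by (simp add: in_keys_iff)
      obtain y c where y: "y \<in> keys g" "x - y = c *\<^sub>R \<alpha>" using \<open>x \<in> K\<close> by (auto simp: K_def)
      have "real n *\<^sub>R \<beta> - (y - (x - real n *\<^sub>R \<beta>)) = c *\<^sub>R \<alpha>" using y(2) by (simp add: algebra_simps)
      then have "n \<in> bad (y - (x - real n *\<^sub>R \<beta>))" by (auto simp: bad_def)
      moreover have "y - (x - real n *\<^sub>R \<beta>) \<in> D" unfolding D_def using xk y(1) by force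
      ultimately show False using n by blast
    qed
    then show "lookup (restrict_keys K ((1 - E \<beta> ^ n) * g)) x = lookup g x"
      using gK
      by (auto simp: restrict_keys.rep_eq left_diff_distrib lookup_minus E_power lookup_single_mult in_keys_iff)
  qed
  moreover have "restrict_keys K ((1 - E \<alpha>) * k) = (1 - E \<alpha>) * restrict_keys K k"
    by (rule restrict_keys_mult[OF keys1 shift])
  ultimately have "g = (1 - E \<alpha>) * restrict_keys K k" using k by metis
  then show ?thesis by (rule dvdI)
qed

text \<open>The factors are extracted one at a time; the factors already extracted are cancelled
  from the next divisibility by coprimality, one after the other.\<close>

lemma prod_one_minus_E_dvd:
  fixes f :: "'k::real_vector \<Rightarrow>\<^sub>0 'c::comm_ring_1"
  assumes "finite P" "\<And>\<alpha>. \<alpha> \<in> P \<Longrightarrow> 1 - E \<alpha> dvd f"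
    and "\<And>\<alpha> \<beta> c. \<alpha> \<in> P \<Longrightarrow> \<beta> \<in> P \<Longrightarrow> \<alpha> \<noteq> \<beta> \<Longrightarrow> \<beta> \<noteq> c *\<^sub>R \<alpha>"
  shows "(\<Prod>\<alpha>\<in>P. 1 - E \<alpha>) dvd f"
  using assms
proof (induction P arbitrary: rule: finite_induct)
  case (insert \<alpha> P)
  have indep: "\<beta> \<noteq> c *\<^sub>R \<alpha>" if "\<beta> \<in> P" for \<beta> c
    by (rule insert.prems(2)) (use that insert.hyps(2) in auto)
  have "(\<Prod>\<alpha>\<in>P. 1 - E \<alpha>) dvd f"
    using insert.IH insert.prems by blast
  then obtain k where k: "f = (\<Prod>\<alpha>\<in>P. 1 - E \<alpha>) * k" by (rule dvdE)
  have "1 - E \<alpha> dvd g" if "finite Q" "Q \<subseteq> P" "1 - E \<alpha> dvd (\<Prod>\<alpha>\<in>Q. 1 - E \<alpha>) * g" for Q g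
    using that
  proof (induction Q arbitrary: g rule: finite_induct)
    case (insert \<beta> Q)
    have "1 - E \<alpha> dvd (1 - E \<beta>) * ((\<Prod>\<alpha>\<in>Q. 1 - E \<alpha>) * g)"
      using insert.prems insert.hyps by (simp add: mult.assoc)
    moreover have "\<beta> \<noteq> c *\<^sub>R \<alpha>" for c
      using indep insert.prems(1) by blast
    ultimately have "1 - E \<alpha> dvd (\<Prod>\<alpha>\<in>Q. 1 - E \<alpha>) * g" by (rule one_minus_E_coprime)
    then show ?case using insert by blast
  qed simp
  from this[OF insert.hyps(1) order_refl, of k] have "1 - E \<alpha> dvd k"
    using insert.prems(1)[of \<alpha>] k by simp
  then show ?case
    unfolding k prod.insert[OF insert.hyps] by (metis dvd_refl mult.commute mult_dvd_mono)
qed simp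

subsection \<open>The action of linear maps\<close>

text \<open>\<open>map_key\<close> pulls coefficients back along a map, so pushing exponents forward
  by \<open>w\<close> takes the inverse of \<open>w\<close>.\<close>

definition act :: "('k \<Rightarrow> 'k) \<Rightarrow> ('k \<Rightarrow>\<^sub>0 'c::zero) \<Rightarrow> ('k \<Rightarrow>\<^sub>0 'c)" where
  "act w f = Poly_Mapping.map_key (winv w) f"

lemma lookup_act: "bij w \<Longrightarrow> lookup (act w f) x = lookup f (winv w x)"
  by (simp add: act_def Poly_Mapping.map_key.rep_eq bij_imp_bij_inv bij_is_inj)

lemma lookup_act': "bij w \<Longrightarrow> lookup (act w f) (w x) = lookup f x"
  by (simp add: lookup_act bij_is_inj)

lemma act_single: "bij w \<Longrightarrow> act w (single x a) = single (w x) a"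
  by (rule poly_mapping_eqI) (auto simp: lookup_act lookup_single when_def bij_is_inj bij_is_surj surj_f_inv_f)

lemma act_zero [simp]: "bij w \<Longrightarrow> act w 0 = 0"
  by (rule poly_mapping_eqI) (simp add: lookup_act)

lemma act_add: "bij w \<Longrightarrow> act w (f + g) = act w f + act w g"
  by (rule poly_mapping_eqI) (simp add: lookup_act lookup_add)

lemma act_uminus: "bij w \<Longrightarrow> act w (- f) = - act w (f :: 'k \<Rightarrow>\<^sub>0 'c::ab_group_add)"
  by (rule poly_mapping_eqI) (simp add: lookup_act)

lemma act_diff: "bij w \<Longrightarrow> act w (f - g) = act w f - act w (g :: 'k \<Rightarrow>\<^sub>0 'c::ab_group_add)"
  by (rule poly_mapping_eqI) (simp add: lookup_act lookup_minus)

lemma act_sum: "bij w \<Longrightarrow> act w (\<Sum>i\<in>A. f i) = (\<Sum>i\<in>A. act w (f i))"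
  by (induction A rule: infinite_finite_induct) (simp_all add: act_add)

lemma act_id [simp]: "act id f = f"
  by (rule poly_mapping_eqI) (simp add: lookup_act)

lemma act_comp: "bij w \<Longrightarrow> bij u \<Longrightarrow> act (w \<circ> u) f = act w (act u f)"
  by (rule poly_mapping_eqI) (simp add: lookup_act bij_comp o_inv_distrib)

lemma keys_act: "bij w \<Longrightarrow> keys (act w f) = w ` keys f"
proof (intro equalityI subsetI)
  assume w: "bij w"
  fix x
  show "x \<in> w ` keys f" if "x \<in> keys (act w f)"
    using that w by (intro image_eqI[of _ _ "winv w x"]) (auto simp: in_keys_iff lookup_act bij_is_surj surj_f_inv_f)
  show "x \<in> keys (act w f)" if "x \<in> w ` keys f"
    using that w by (auto simp: in_keys_iff lookup_act')
qed

lemma act_mult: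
  fixes f g :: "'k::real_vector \<Rightarrow>\<^sub>0 'c::comm_ring_1"
  assumes "bij w" "linear w"
  shows "act w (f * g) = act w f * act w g"
proof (induction f rule: poly_mapping_induct_single)
  case (single x a)
  show ?case
  proof (induction g rule: poly_mapping_induct_single)
    case (single y b)
    show ?case by (simp add: mult_single act_single assms linear_add)
  qed (simp_all add: distrib_left act_add assms)
qed (simp_all add: distrib_right act_add assms)

lemma act_one [simp]: "bij w \<Longrightarrow> linear w \<Longrightarrow> act w 1 = (1 :: 'k::real_vector \<Rightarrow>\<^sub>0 'c::comm_ring_1)"
  using act_single[of w 0 "1 :: 'c"] linear_0[of w] by simp

lemma act_prod:
  fixes f :: "'i \<Rightarrow> 'k::real_vector \<Rightarrow>\<^sub>0 'c::comm_ring_1"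
  shows "bij w \<Longrightarrow> linear w \<Longrightarrow> act w (\<Prod>i\<in>A. f i) = (\<Prod>i\<in>A. act w (f i))"
  by (induction A rule: infinite_finite_induct) (simp_all add: act_mult)

section \<open>Weyl group invariants\<close>

text \<open>A right inverse up to a scalar is a left one if the scalar is no zero divisor: the
  defect \<open>C\<close> satisfies \<open>C * B = 0\<close>, so the adjugate shows that the
  determinant of \<open>B\<close> kills \<open>C\<close>, and this determinant divides
  \<open>d ^ n\<close>. It later turns biorthogonality of two families into an expansion
  formula.\<close>

lemma matrix_scalar_inverse_commute:
  fixes A B :: "'c::comm_ring_1 mat"
  assumes A: "A \<in> carrier_mat n n" and B: "B \<in> carrier_mat n n"
    and AB: "A * B = d \<cdot>\<^sub>m 1\<^sub>m n" and d: "\<And>y. d * y = 0 \<Longrightarrow> y = 0"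
  shows "B * A = d \<cdot>\<^sub>m 1\<^sub>m n"
proof -
  define C where "C = B * A - d \<cdot>\<^sub>m 1\<^sub>m n"
  have C: "C \<in> carrier_mat n n" using A B by (auto simp: C_def)
  have dn: "y = 0" if "d ^ k * y = 0" for y k
    using that by (induction k) (auto simp: mult.assoc dest: d)
  have "C * B = B * A * B - (d \<cdot>\<^sub>m 1\<^sub>m n) * B"
    unfolding C_def by (rule minus_mult_distrib_mat) (use A B in auto)
  also have "B * A * B = B * (A * B)" using A B by (intro assoc_mult_mat)
  also have "\<dots> = d \<cdot>\<^sub>m B" by (simp add: AB mult_smult_distrib[OF B one_carrier_mat] right_mult_one_mat[OF B])
  also have "(d \<cdot>\<^sub>m 1\<^sub>m n) * B = d \<cdot>\<^sub>m B" by (simp add: mult_smult_assoc_mat[OF one_carrier_mat B] left_mult_one_mat[OF B])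
  finally have CB: "C * B = 0\<^sub>m n n" using B by auto
  have "Determinant.det B \<cdot>\<^sub>m C = C * (B * adj_mat B)"
    by (simp add: adj_mat(2)[OF B] mult_smult_distrib[OF C one_carrier_mat] right_mult_one_mat[OF C])
  also have "\<dots> = C * B * adj_mat B"
    using adj_mat[OF B] B C by (intro assoc_mult_mat[symmetric])
  also have "\<dots> = 0\<^sub>m n n" using adj_mat[OF B] by (simp add: CB)
  finally have dC: "Determinant.det B \<cdot>\<^sub>m C = 0\<^sub>m n n" .
  have det: "Determinant.det A * Determinant.det B = d ^ n"
    using det_mult[OF A B] by (simp add: AB)
  have "C $$ (i, j) = 0" if "i < n" "j < n" for i j
  proof -
    have "Determinant.det B * C $$ (i, j) = (Determinant.det B \<cdot>\<^sub>m C) $$ (i, j)"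
      using that C by simp
    then have "Determinant.det B * C $$ (i, j) = 0" using dC that by simp
    then have "d ^ n * C $$ (i, j) = 0" by (simp add: det[symmetric] mult.assoc)
    then show ?thesis by (rule dn)
  qed
  then have "(B * A) $$ (i, j) = (d \<cdot>\<^sub>m 1\<^sub>m n) $$ (i, j)" if "i < n" "j < n" for i j
    using that A B by (simp add: C_def del: index_mult_mat(1) index_smult_mat(1))
  then show ?thesis using A B by (intro eq_matI) auto
qed

context root_base begin

definition S :: "('a \<Rightarrow>\<^sub>0 laurent) set" where "S = {f. keys f \<subseteq> X}"

lemma S_zero: "0 \<in> S" and S_one: "1 \<in> S" and S_single: "x \<in> X \<Longrightarrow> single x a \<in> S"
  and S_uminus: "f \<in> S \<Longrightarrow> - f \<in> S"
  by (auto simp: S_def lattice_zero)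

lemma S_add: "f \<in> S \<Longrightarrow> g \<in> S \<Longrightarrow> f + g \<in> S"
  using keys_add[of f g] by (auto simp: S_def)

lemma S_diff: "f \<in> S \<Longrightarrow> g \<in> S \<Longrightarrow> f - g \<in> S"
  using keys_diff'[of f g] by (auto simp: S_def)

lemma S_mult: "f \<in> S \<Longrightarrow> g \<in> S \<Longrightarrow> f * g \<in> S"
  using keys_mult[of f g] lattice_add by (fastforce simp: S_def)

lemma S_sum: "(\<And>i. i \<in> A \<Longrightarrow> f i \<in> S) \<Longrightarrow> (\<Sum>i\<in>A. f i) \<in> S"
  by (induction A rule: infinite_finite_induct) (auto simp: S_zero S_add)

lemma S_prod: "(\<And>i. i \<in> A \<Longrightarrow> f i \<in> S) \<Longrightarrow> (\<Prod>i\<in>A. f i) \<in> S"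
  by (induction A rule: infinite_finite_induct) (auto simp: S_one S_mult)

lemma S_act: "w \<in> W \<Longrightarrow> f \<in> S \<Longrightarrow> act w f \<in> S"
  using weyl_lattice by (auto simp: S_def keys_act weyl_bij)

text \<open>As \<open>X\<close> is a group, restricting the exponents of \<open>g\<close> to
  \<open>X\<close> gives another quotient of \<open>D * g\<close> by \<open>D\<close>; cancellation
  identifies the two.\<close>

lemma S_factor:
  assumes "D \<in> S" "D * g \<in> S" "top_at r D \<mu>"
  shows "g \<in> S"
proof -
  have "x - y \<in> X \<longleftrightarrow> x \<in> X" if "y \<in> X" for x y
    using lattice_diff[of x y] lattice_add[of "x - y" y] that by auto
  then have "restrict_keys X (D * g) = D * restrict_keys X g"
    using assms(1) by (intro restrict_keys_mult[of _ X]) (auto simp: S_def)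
  then have "D * g = D * restrict_keys X g" using assms(2) by (simp add: S_def restrict_keys_id)
  then have "g = restrict_keys X g" using top_at_cancel[OF assms(3)] by blast
  then show ?thesis by (metis S_def keys_restrict inf_le2 mem_Collect_eq)
qed

lemma S_induct [consumes 1, case_names zero single add]:
  assumes "f \<in> S" "P 0" "\<And>x a. x \<in> X \<Longrightarrow> P (single x a)"
    "\<And>f g. f \<in> S \<Longrightarrow> g \<in> S \<Longrightarrow> P f \<Longrightarrow> P g \<Longrightarrow> P (f + g)"
  shows "P f"
  by (rule poly_mapping_induct_on[of f X]) (use assms in \<open>auto simp: S_def\<close>)

lemma reflection_diff_dvd:
  assumes "\<alpha> \<in> \<Phi>" "f \<in> S"
  shows "1 - E (- \<alpha>) dvd f - act (reflection \<alpha>) f"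
  using assms(2)
proof (induction f rule: S_induct)
  case (single x a)
  have b: "bij (reflection \<alpha>)" using weyl_bij[OF weyl_reflection[OF assms(1)]] .
  obtain n where n: "coroot_pairing x \<alpha> = of_int n"
    using single assms(1) by (auto simp: weight_lattice_def elim: Ints_cases)
  have "single x a - act (reflection \<alpha>) (single x a) = single x a * (1 - E (of_int n *\<^sub>R (- \<alpha>)))"
    by (simp add: act_single[OF b] right_diff_distrib mult_single reflection_def n)
  then show ?case by (simp only: dvd_mult[OF one_minus_E_dvd_multiple])
next
  case (add f g)
  have "f + g - act (reflection \<alpha>) (f + g) = (f - act (reflection \<alpha>) f) + (g - act (reflection \<alpha>) g)"
    using weyl_bij[OF weyl_reflection[OF assms(1)]] by (simp add: act_add)
  then show ?case using dvd_add[OF add(3,4)] by (simp only:)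
qed (use weyl_bij[OF weyl_reflection[OF assms(1)]] in simp)

text \<open>The scalar 2 is invertible, and \<open>f\<close> is half of
  \<open>f - act (reflection \<alpha>) f\<close>.\<close>

lemma antisymmetric_dvd:
  assumes "\<alpha> \<in> \<Phi>" "f \<in> S" "act (reflection \<alpha>) f = - f"
  shows "1 - E (- \<alpha>) dvd f"
proof -
  define h :: laurent where "h = single 0 (1/2)"
  have h: "h + h = 1" unfolding h_def by (simp flip: single_add)
  have "single 0 h * (f - act (reflection \<alpha>) f) = f"
  proof (rule poly_mapping_eqI)
    fix x
    have "lookup (single 0 h * (f - act (reflection \<alpha>) f)) x = h * (lookup f x + lookup f x)"
      by (simp only: lookup_single_mult assms(3) lookup_minus lookup_uminus lookup_add diff_minus_eq_add diff_0_right)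
    also have "\<dots> = (h + h) * lookup f x" by (simp only: distrib_left distrib_right)
    finally show "lookup (single 0 h * (f - act (reflection \<alpha>) f)) x = lookup f x" by (simp add: h)
  qed
  then show ?thesis using reflection_diff_dvd[OF assms(1,2)] by (metis dvd_mult)
qed

subsection \<open>The Weyl denominator and the alternating quotient\<close>

text \<open>The Weyl denominator in product form, from which the leading exponent \<open>rho\<close>
  and the divisibility of antisymmetric elements can be read off directly.\<close>

definition denom :: "'a \<Rightarrow>\<^sub>0 laurent" where
  "denom = E rho * (\<Prod>\<beta>\<in>pos. 1 - E (- \<beta>))"

lemma denom_S: "denom \<in> S"
  unfolding denom_def
  by (intro S_mult S_prod S_diff S_single rho_lattice S_one lattice_uminus root_lattice pos_root)

lemma one_minus_E_top:
  assumes "\<beta> \<in> pos"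
  shows "top_at rho (1 - E (- \<beta>) :: 'a \<Rightarrow>\<^sub>0 laurent) 0"
proof -
  have "rho \<bullet> \<beta> > 0" using assms by (simp add: pos_def)
  moreover from this have "\<beta> \<noteq> 0" by auto
  ultimately show ?thesis
    unfolding top_at_def
    using keys_diff'[of 1 "E (- \<beta>) :: 'a \<Rightarrow>\<^sub>0 laurent"]
    by (auto simp: lookup_minus lookup_single when_def split: if_splits)
qed

lemma denom_top: "top_at rho denom rho"
proof -
  have "top_at rho (\<Prod>\<beta>\<in>pos. 1 - E (- \<beta>) :: 'a \<Rightarrow>\<^sub>0 laurent) (\<Sum>\<beta>\<in>pos. 0)"
    by (rule top_at_prod[OF finite_pos one_minus_E_top])
  from top_at_mult[OF top_at_E this, of rho] show ?thesis by (simp add: denom_def)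
qed

lemmas denom_cancel = top_at_cancel[OF denom_top]

abbreviation sg :: "('a \<Rightarrow> 'a) \<Rightarrow> 'a \<Rightarrow>\<^sub>0 laurent" where "sg w \<equiv> of_int (sgn_weyl w)"

lemma sg_square: "sg w * sg w = 1"
  by (metis of_int_1 of_int_mult sgn_weyl_square)

lemma sg_square': "sg w * (sg w * f) = f"
  by (simp add: sg_square mult.assoc[symmetric])

lemma sg_cases: "sg w = 1 \<or> sg w = - 1"
  unfolding sgn_weyl_def by (cases "even (card (inversions w))") auto

lemma act_sg_mult: "w \<in> W \<Longrightarrow> act w (sg u * f) = sg u * act w f"
  using sg_cases[of u] by (auto simp: act_uminus weyl_bij)

text \<open>The factors of the positive roots other than \<open>\<alpha>\<close> are permuted. The
  sign comes from the remaining factor together with \<open>E rho\<close>, because the reflection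
  sends \<open>rho\<close> to \<open>rho - \<alpha>\<close>.\<close>

lemma act_denom_simple:
  assumes "\<alpha> \<in> \<Delta>"
  shows "act (reflection \<alpha>) denom = - denom"
proof -
  let ?s = "reflection \<alpha>"
  have b: "bij ?s" and l: "linear ?s"
    using weyl_bij weyl_linear simple_in_weyl[OF assms] by blast+
  define P where "P = (\<Prod>\<beta>\<in>pos - {\<alpha>}. 1 - E (- \<beta>) :: 'a \<Rightarrow>\<^sub>0 laurent)"
  have d: "denom = E rho * ((1 - E (- \<alpha>)) * P)"
    unfolding denom_def P_def by (simp add: prod.remove[OF finite_pos simple_pos[OF assms]])
  have "act ?s P = (\<Prod>\<beta>\<in>pos - {\<alpha>}. 1 - E (- ?s \<beta>))"
    unfolding P_def by (simp add: act_prod act_diff act_single b l linear_neg)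
  also have "\<dots> = (\<Prod>\<beta>\<in>?s ` (pos - {\<alpha>}). 1 - E (- \<beta>))"
    by (rule prod.reindex[symmetric, unfolded comp_def]) (metis inj_onI reflection_invol)
  finally have P: "act ?s P = P" unfolding reflection_pos_image[OF assms] P_def .
  have "?s rho = rho - \<alpha>"
    by (simp add: reflection_def coroot_pairing_def rho_inner_simple assms simple_nonzero)
  moreover have "?s (- \<alpha>) = \<alpha>" by (simp add: linear_neg[OF l] reflection_self simple_nonzero assms)
  ultimately have "act ?s denom = E (rho - \<alpha>) * ((1 - E \<alpha>) * P)"
    unfolding d by (simp add: act_mult act_diff act_single b l P)
  also have "\<dots> = (E (rho - \<alpha>) - E rho) * P"
    by (simp add: algebra_simps mult_single)
  also have "\<dots> = - denom" unfolding d by (simp add: algebra_simps mult_single)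
  finally show ?thesis .
qed

lemma act_denom:
  assumes "w \<in> W"
  shows "act w denom = sg w * denom"
proof -
  have *: "set \<alpha>s \<subseteq> \<Delta> \<Longrightarrow> act (word_prod \<alpha>s) denom = (-1) ^ length \<alpha>s * denom" for \<alpha>s
  proof (induction \<alpha>s)
    case (Cons \<alpha> \<alpha>s)
    have b: "bij (reflection \<alpha>)" using Cons weyl_bij simple_in_weyl by auto
    have b2: "bij (word_prod \<alpha>s)" using Cons weyl_bij word_prod_weyl by auto
    have "act (word_prod (\<alpha> # \<alpha>s)) denom = act (reflection \<alpha>) ((-1) ^ length \<alpha>s * denom)"
      using Cons by (simp only: word_prod_simps act_comp[OF b b2]) simp
    also have "\<dots> = (-1) ^ length \<alpha>s * act (reflection \<alpha>) denom"
      using b by (cases "even (length \<alpha>s)") (auto simp: act_uminus)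
    also have "\<dots> = (-1) ^ length (\<alpha> # \<alpha>s) * denom"
      using Cons by (simp add: act_denom_simple)
    finally show ?case .
  qed (simp add: act_id[unfolded id_def])
  obtain \<alpha>s where "set \<alpha>s \<subseteq> \<Delta>" "w = word_prod \<alpha>s" using weyl_word[OF assms] by blast
  then show ?thesis using * sgn_word_prod by simp
qed

definition alternate :: "('a \<Rightarrow>\<^sub>0 laurent) \<Rightarrow> ('a \<Rightarrow>\<^sub>0 laurent)" where
  "alternate f = (\<Sum>w\<in>W. sg w * act w f)"

lemma bij_betw_weyl_left: "u \<in> W \<Longrightarrow> bij_betw (\<lambda>w. u \<circ> w) W W"
proof (rule bij_betw_byWitness[where f' = "\<lambda>w. winv u \<circ> w"])
  assume u: "u \<in> W"
  have "winv u \<circ> u = id" "u \<circ> winv u = id"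
    using weyl_bij[OF u] by (auto simp: bij_is_inj bij_is_surj surj_iff[symmetric])
  then show "\<forall>a\<in>W. winv u \<circ> (u \<circ> a) = a" "\<forall>a\<in>W. u \<circ> (winv u \<circ> a) = a"
    by (metis comp_assoc id_comp)+
  show "(\<lambda>w. u \<circ> w) ` W \<subseteq> W" "(\<lambda>w. winv u \<circ> w) ` W \<subseteq> W"
    using weyl_comp u weyl_inv by blast+
qed

lemma bij_betw_weyl_right: "u \<in> W \<Longrightarrow> bij_betw (\<lambda>w. w \<circ> u) W W"
proof (rule bij_betw_byWitness[where f' = "\<lambda>w. w \<circ> winv u"])
  assume u: "u \<in> W"
  have "winv u \<circ> u = id" "u \<circ> winv u = id"
    using weyl_bij[OF u] by (auto simp: bij_is_inj bij_is_surj surj_iff[symmetric])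
  then show "\<forall>a\<in>W. (a \<circ> u) \<circ> winv u = a" "\<forall>a\<in>W. (a \<circ> winv u) \<circ> u = a"
    by (metis comp_assoc comp_id)+
  show "(\<lambda>w. w \<circ> u) ` W \<subseteq> W" "(\<lambda>w. w \<circ> winv u) ` W \<subseteq> W"
    using weyl_comp u weyl_inv by blast+
qed

lemma act_alternate:
  assumes u: "u \<in> W"
  shows "act u (alternate f) = sg u * alternate f"
proof -
  have "act u (alternate f) = (\<Sum>w\<in>W. sg u * (sg (u \<circ> w) * act (u \<circ> w) f))"
    unfolding alternate_def
  proof (subst act_sum[OF weyl_bij[OF u]], rule sum.cong[OF refl])
    fix w assume w: "w \<in> W"
    have "sg u * sg (u \<circ> w) = sg w"
      unfolding sgn_weyl_comp[OF u w] of_int_mult by (simp add: sg_square')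
    then show "act u (sg w * act w f) = sg u * (sg (u \<circ> w) * act (u \<circ> w) f)"
      by (simp add: act_sg_mult[OF u] act_comp weyl_bij[OF u] weyl_bij[OF w] flip: mult.assoc)
  qed
  also have "\<dots> = sg u * (\<Sum>w\<in>W. sg (u \<circ> w) * act (u \<circ> w) f)" by (simp add: sum_distrib_left)
  also have "(\<Sum>w\<in>W. sg (u \<circ> w) * act (u \<circ> w) f) = alternate f"
    unfolding alternate_def by (rule sum.reindex_bij_betw[OF bij_betw_weyl_left[OF u]])
  finally show ?thesis .
qed

lemma alternate_act:
  assumes u: "u \<in> W"
  shows "alternate (act u f) = sg u * alternate f"
proof -
  have "alternate (act u f) = (\<Sum>w\<in>W. sg u * (sg (w \<circ> u) * act (w \<circ> u) f))"
    unfolding alternate_def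
  proof (rule sum.cong[OF refl])
    fix w assume w: "w \<in> W"
    have "sg u * sg (w \<circ> u) = sg w"
      unfolding sgn_weyl_comp[OF w u] of_int_mult by (simp add: sg_square' mult.commute)
    then show "sg w * act w (act u f) = sg u * (sg (w \<circ> u) * act (w \<circ> u) f)"
      by (simp add: act_comp weyl_bij[OF u] weyl_bij[OF w] flip: mult.assoc)
  qed
  also have "\<dots> = sg u * (\<Sum>w\<in>W. sg (w \<circ> u) * act (w \<circ> u) f)" by (simp add: sum_distrib_left)
  also have "(\<Sum>w\<in>W. sg (w \<circ> u) * act (w \<circ> u) f) = alternate f"
    unfolding alternate_def by (rule sum.reindex_bij_betw[OF bij_betw_weyl_right[OF u]])
  finally show ?thesis .
qed

lemma sg_S: "sg w \<in> S"
  using sg_cases[of w] S_one S_uminus by metis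

lemma alternate_S: "f \<in> S \<Longrightarrow> alternate f \<in> S"
  unfolding alternate_def by (intro S_sum S_mult sg_S S_act)

text \<open>Every reflection is conjugate to a simple one and so has sign -1; hence the alternating
  sum is antisymmetric under it and divisible by the corresponding factor. In a reduced system
  distinct positive roots are not proportional, so the product divides as well, and
  \<open>E rho\<close> is a unit.\<close>

lemma denom_dvd_alternate:
  assumes "f \<in> S"
  shows "denom dvd alternate f"
proof -
  have P: "(\<Prod>\<beta>\<in>uminus ` pos. 1 - E \<beta>) dvd alternate f"
  proof (rule prod_one_minus_E_dvd)
    fix \<alpha> assume "\<alpha> \<in> uminus ` pos"
    then obtain \<beta> where b: "\<beta> \<in> pos" "\<alpha> = - \<beta>" by auto
    have W: "reflection \<beta> \<in> W" using weyl_reflection[OF pos_root[OF b(1)]] .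
    obtain \<alpha>s \<delta> where a: "set \<alpha>s \<subseteq> \<Delta>" "\<delta> \<in> \<Delta>" "\<beta> = word_prod \<alpha>s \<delta>"
      using root_conj_simple[OF pos_root[OF b(1)]] by blast
    define u where "u = word_prod \<alpha>s"
    have u: "u \<in> W" unfolding u_def using word_prod_weyl[OF a(1)] .
    have "reflection \<beta> \<circ> u = u \<circ> reflection \<delta>"
      using reflection_conj_weyl[OF u, of \<delta>] a(3) by (simp add: u_def)
    then have "sgn_weyl (reflection \<beta>) * sgn_weyl u = sgn_weyl u * sgn_weyl (reflection \<delta>)"
      using sgn_weyl_comp u W simple_in_weyl[OF a(2)] by metis
    then have "sgn_weyl (reflection \<beta>) * (sgn_weyl u * sgn_weyl u) = - (sgn_weyl u * sgn_weyl u)"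
      by (simp only: mult.assoc[symmetric]) (simp add: sgn_weyl_reflection[OF a(2)])
    then have "sgn_weyl (reflection \<beta>) = -1" by simp
    then have "act (reflection \<beta>) (alternate f) = - alternate f"
      by (simp add: act_alternate[OF W])
    then show "1 - E \<alpha> dvd alternate f"
      unfolding b(2) by (rule antisymmetric_dvd[OF pos_root[OF b(1)] alternate_S[OF assms]])
  next
    fix \<alpha> \<beta> c assume ab: "\<alpha> \<in> uminus ` pos" "\<beta> \<in> uminus ` pos" "\<alpha> \<noteq> \<beta>"
    then obtain \<gamma> \<delta> where g: "\<gamma> \<in> pos" "\<delta> \<in> pos" "\<alpha> = - \<gamma>" "\<beta> = - \<delta>" by auto
    show "\<beta> \<noteq> c *\<^sub>R \<alpha>"
    proof
      assume "\<beta> = c *\<^sub>R \<alpha>"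
      then have d: "\<delta> = c *\<^sub>R \<gamma>" using g by simp
      then have "c = 1 \<or> c = -1" using reduced_root[OF pos_root[OF g(1)]] pos_root[OF g(2)] by blast
      then show False
        using d ab(3) g pos_iff_not_neg[OF pos_root[OF g(1)]] by auto
    qed
  qed (simp add: finite_pos)
  have "(\<Prod>\<beta>\<in>uminus ` pos. 1 - E \<beta>) = (\<Prod>\<beta>\<in>pos. 1 - E (- \<beta>) :: 'a \<Rightarrow>\<^sub>0 laurent)"
    by (rule prod.reindex[unfolded comp_def]) (simp add: inj_on_def)
  with P obtain k where k: "alternate f = (\<Prod>\<beta>\<in>pos. 1 - E (- \<beta>)) * k" by (metis dvdE)
  have "E rho * E (- rho) = (1 :: 'a \<Rightarrow>\<^sub>0 laurent)" by (simp add: mult_single)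
  then have "alternate f = denom * (E (- rho) * k)"
    unfolding denom_def k by (metis (no_types, lifting) mult.assoc mult.commute mult.left_neutral)
  then show ?thesis by (rule dvdI)
qed

text \<open>On \<open>E (x + rho)\<close> with \<open>x\<close> dominant in the lattice this is the
  Weyl character of highest weight \<open>x\<close>. The description is unique on \<open>S\<close>
  because \<open>denom\<close> can be cancelled.\<close>

definition alt_quot :: "('a \<Rightarrow>\<^sub>0 laurent) \<Rightarrow> ('a \<Rightarrow>\<^sub>0 laurent)" where
  "alt_quot f = (THE g. denom * g = alternate f)"

lemma denom_alt_quot:
  assumes "f \<in> S"
  shows "denom * alt_quot f = alternate f"
proof -
  obtain g where g: "denom * g = alternate f" using denom_dvd_alternate[OF assms] by (metis dvdE)
  then have "(THE g. denom * g = alternate f) = g"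
    by (intro the_equality) (auto intro: denom_cancel)
  then show ?thesis using g by (simp add: alt_quot_def)
qed

lemma alt_quot_unique: "f \<in> S \<Longrightarrow> denom * g = alternate f \<Longrightarrow> alt_quot f = g"
  using denom_alt_quot denom_cancel by metis

definition Z :: "('a \<Rightarrow>\<^sub>0 laurent) set" where "Z = {f \<in> S. \<forall>w\<in>W. act w f = f}"

lemma Z_S: "f \<in> Z \<Longrightarrow> f \<in> S" and Z_act: "f \<in> Z \<Longrightarrow> w \<in> W \<Longrightarrow> act w f = f"
  by (auto simp: Z_def)

lemma Z_zero: "0 \<in> Z" and Z_one: "1 \<in> Z"
  and Z_add: "f \<in> Z \<Longrightarrow> g \<in> Z \<Longrightarrow> f + g \<in> Z"
  and Z_uminus: "f \<in> Z \<Longrightarrow> - f \<in> Z"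
  and Z_mult: "f \<in> Z \<Longrightarrow> g \<in> Z \<Longrightarrow> f * g \<in> Z"
  by (auto simp: Z_def S_zero S_one S_add S_uminus S_mult act_add act_mult act_uminus weyl_bij weyl_linear)

lemma Z_sum: "(\<And>i. i \<in> A \<Longrightarrow> f i \<in> Z) \<Longrightarrow> (\<Sum>i\<in>A. f i) \<in> Z"
  by (induction A rule: infinite_finite_induct) (auto simp: Z_zero Z_add)

lemma Z_prod: "(\<And>i. i \<in> A \<Longrightarrow> f i \<in> Z) \<Longrightarrow> (\<Prod>i\<in>A. f i) \<in> Z"
  by (induction A rule: infinite_finite_induct) (auto simp: Z_one Z_mult)

lemma Z_sg: "sg w \<in> Z"
  using sg_cases[of w] Z_one Z_uminus by metis

text \<open>Numerator and denominator change by the same sign, so the quotient is invariant.\<close>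

lemma alt_quot_Z:
  assumes f: "f \<in> S"
  shows "alt_quot f \<in> Z"
proof -
  have "alt_quot f \<in> S" using S_factor[OF denom_S _ denom_top] denom_alt_quot[OF f] alternate_S[OF f] by metis
  moreover have "act w (alt_quot f) = alt_quot f" if w: "w \<in> W" for w
  proof -
    have "sg w * (denom * act w (alt_quot f)) = act w (denom * alt_quot f)"
      by (simp add: act_mult weyl_bij[OF w] weyl_linear[OF w] act_denom[OF w] mult.assoc)
    also have "\<dots> = sg w * (denom * alt_quot f)" by (simp add: denom_alt_quot[OF f] act_alternate[OF w])
    finally show ?thesis using denom_cancel sg_square' by metis
  qed
  ultimately show ?thesis by (simp add: Z_def)
qed

lemma alt_quot_add: "f \<in> S \<Longrightarrow> g \<in> S \<Longrightarrow> alt_quot (f + g) = alt_quot f + alt_quot g"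
  by (rule alt_quot_unique) (auto simp: S_add distrib_left denom_alt_quot alternate_def act_add weyl_bij sum.distrib)

lemma alt_quot_mult_Z: "f \<in> S \<Longrightarrow> z \<in> Z \<Longrightarrow> alt_quot (z * f) = z * alt_quot f"
proof (rule alt_quot_unique)
  assume f: "f \<in> S" "z \<in> Z"
  show "z * f \<in> S" using f by (simp add: S_mult Z_S)
  have "denom * (z * alt_quot f) = z * alternate f" by (simp add: denom_alt_quot[OF f(1), symmetric] mult.left_commute)
  then show "denom * (z * alt_quot f) = alternate (z * f)"
    using f by (simp add: alternate_def act_mult weyl_bij weyl_linear Z_act sum_distrib_left mult.left_commute)
qed

lemma alt_quot_zero: "alt_quot 0 = 0"
  using alt_quot_mult_Z[OF S_zero Z_zero] by simp

lemma alt_quot_sum: "(\<And>i. i \<in> A \<Longrightarrow> f i \<in> S) \<Longrightarrow> alt_quot (\<Sum>i\<in>A. f i) = (\<Sum>i\<in>A. alt_quot (f i))"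
  by (induction A rule: infinite_finite_induct) (auto simp: alt_quot_zero alt_quot_add S_sum)

lemma alt_quot_act: "f \<in> S \<Longrightarrow> w \<in> W \<Longrightarrow> alt_quot (act w f) = sg w * alt_quot f"
  by (rule alt_quot_unique) (auto simp: S_act alternate_act denom_alt_quot mult.left_commute[of denom])


subsection \<open>Dual bases over the invariants\<close>

text \<open>Perfectness of the form in coordinates: \<open>e\<close> is Steinberg's family and
  \<open>b\<close> its dual family, found by inverting the Gram matrix over the invariants. The
  expansion serves later both to represent functionals and to obtain freeness.\<close>

theorem dual_bases:
  "\<exists>(n::nat) (e :: nat \<Rightarrow> 'a \<Rightarrow>\<^sub>0 laurent) b. (\<forall>i<n. e i \<in> S) \<and> (\<forall>i<n. b i \<in> S) \<and>
    (\<forall>i<n. \<forall>j<n. alt_quot (e i * b j) = (if i = j then 1 else 0)) \<and>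
    (\<forall>f\<in>S. f = (\<Sum>i<n. alt_quot (f * b i) * e i))"
proof -
  define n where "n = card W"
  obtain en where en: "bij_betw en {0..<n} W"
    using ex_bij_betw_nat_finite[OF finite_weyl] n_def by blast
  have enW: "en i \<in> W" if "i < n" for i using en that by (auto simp: bij_betw_def)
  have bl [simp]: "bij (en i)" "linear (en i)" if "i < n" for i
    using weyl_bij[OF enW[OF that]] weyl_linear[OF enW[OF that]] by auto
  have reindex: "(\<Sum>i<n. g (en i)) = (\<Sum>w\<in>W. g w)" for g :: "('a \<Rightarrow> 'a) \<Rightarrow> 'b::comm_monoid_add"
    using sum.reindex_bij_betw[OF en, of g] by (simp add: atLeast0LessThan)
  define e :: "nat \<Rightarrow> 'a \<Rightarrow>\<^sub>0 laurent" where "e i = E (steinberg_weight (en i))" for i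
  have eS: "e i \<in> S" if "i < n" for i
    unfolding e_def by (intro S_single steinberg_weight_lattice enW that)
  \<comment> \<open>The rows of \<open>M\<close> are indexed by W and its columns by the family. In
    \<open>A * M\<close> the sum over the rows of \<open>M\<close> is an alternating sum over W,
    hence \<open>denom\<close> times an entry of the Gram matrix \<open>N\<close>.\<close>
  define M where "M = mat n n (\<lambda>(k, j). act (en k) (e j))"
  define A where "A = mat n n (\<lambda>(i, k). sg (en k) * act (en k) (e i))"
  define N where "N = mat n n (\<lambda>(i, j). alt_quot (e i * e j))"
  have carrier [simp]: "M \<in> carrier_mat n n" "A \<in> carrier_mat n n" "N \<in> carrier_mat n n"
    by (auto simp: M_def A_def N_def)
  have AM: "A * M = denom \<cdot>\<^sub>m N"
  proof (rule eq_matI)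
    fix i j assume "i < dim_row (denom \<cdot>\<^sub>m N)" "j < dim_col (denom \<cdot>\<^sub>m N)"
    then have ij: "i < n" "j < n" by (auto simp: N_def)
    have "(A * M) $$ (i, j) = (\<Sum>k<n. sg (en k) * act (en k) (e i) * act (en k) (e j))"
      using ij by (simp add: A_def M_def scalar_prod_def atLeast0LessThan)
    also have "\<dots> = (\<Sum>k<n. sg (en k) * act (en k) (e i * e j))"
      by (rule sum.cong) (simp_all add: act_mult mult.assoc)
    also have "\<dots> = alternate (e i * e j)" unfolding alternate_def by (rule reindex)
    also have "\<dots> = (denom \<cdot>\<^sub>m N) $$ (i, j)"
      using ij by (simp add: N_def denom_alt_quot S_mult eS)
    finally show "(A * M) $$ (i, j) = (denom \<cdot>\<^sub>m N) $$ (i, j)" .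
  qed (auto simp: A_def M_def N_def)

  \<comment> \<open>The product of all signs is the factor by which the signed columns of
    \<open>A\<close> change the determinant of \<open>M\<close>. It is its own inverse.\<close>
  define s where "s = (\<Prod>k<n. sg (en k))"
  have ss: "s * s = 1" unfolding s_def by (simp add: sg_square flip: prod.distrib)
  have sZ: "s \<in> Z" unfolding s_def by (intro Z_prod Z_sg)
  have detA: "Determinant.det A = s * Determinant.det M"
  proof -
    have "Determinant.det A = Determinant.det (transpose_mat A)"
      by (rule det_transpose[symmetric, of _ n]) simp
    also have "\<dots> = (\<Sum>p\<in>{p. p permutes {0..<n}}. signof p * (\<Prod>i = 0..<n. transpose_mat A $$ (i, p i)))"
      by (rule det_def') simp
    also have "\<dots> = (\<Sum>p\<in>{p. p permutes {0..<n}}. s * (signof p * (\<Prod>i = 0..<n. M $$ (i, p i))))"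
    proof (rule sum.cong[OF refl])
      fix p assume "p \<in> {p. p permutes {0..<n}}"
      then have p: "p i < n" if "i < n" for i using that permutes_in_image[of p "{0..<n}" i] by auto
      have "(\<Prod>i = 0..<n. transpose_mat A $$ (i, p i)) = (\<Prod>i = 0..<n. sg (en i) * M $$ (i, p i))"
        by (rule prod.cong) (auto simp: A_def M_def p)
      then show "signof p * (\<Prod>i = 0..<n. transpose_mat A $$ (i, p i)) = s * (signof p * (\<Prod>i = 0..<n. M $$ (i, p i)))"
        by (simp add: prod.distrib s_def atLeast0LessThan mult.left_commute)
    qed
    also have "\<dots> = s * Determinant.det M"
      by (simp add: det_def'[of M n] sum_distrib_left)
    finally show ?thesis .
  qed

  \<comment> \<open>The exponent contributed by the identity permutation, since each
    \<open>w\<close> undoes the inverse inside \<open>steinberg_weight w\<close>.\<close>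
  define \<mu> where "\<mu> = (\<Sum>w\<in>W. descent_weight w)"
  have topM: "top_at rho (Determinant.det M) \<mu>"
  proof -
    have "Determinant.det M = Determinant.det (transpose_mat M)"
      by (rule det_transpose[symmetric, of _ n]) simp
    also have "\<dots> = (\<Sum>p\<in>{p. p permutes {0..<n}}. signof p * (\<Prod>i = 0..<n. transpose_mat M $$ (i, p i)))"
      by (rule det_def') simp
    also have "\<dots> = (\<Sum>p\<in>{p. p permutes {0..<n}}. signof p * E (\<Sum>i<n. en (p i) (steinberg_weight (en i))))"
    proof (rule sum.cong[OF refl])
      fix p assume "p \<in> {p. p permutes {0..<n}}"
      then have p: "p i < n" if "i < n" for i using that permutes_in_image[of p "{0..<n}" i] by auto
      have "(\<Prod>i = 0..<n. transpose_mat M $$ (i, p i)) = (\<Prod>i = 0..<n. E (en (p i) (steinberg_weight (en i))))"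
        by (rule prod.cong) (auto simp: M_def p e_def act_single)
      then show "signof p * (\<Prod>i = 0..<n. transpose_mat M $$ (i, p i)) =
          signof p * E (\<Sum>i<n. en (p i) (steinberg_weight (en i)))"
        by (simp add: E_sum atLeast0LessThan)
    qed
    also have "top_at rho \<dots> \<mu>"
    proof (rule top_at_sum[where a = id])
      have "(\<Sum>i<n. en i (steinberg_weight (en i))) = (\<Sum>w\<in>W. w (steinberg_weight w))" by (rule reindex)
      also have "\<dots> = \<mu>"
        unfolding \<mu>_def steinberg_weight_def
        by (rule sum.cong) (auto simp: bij_is_surj weyl_bij surj_f_inv_f)
      finally show "top_at rho (signof id * E (\<Sum>i<n. en (id i) (steinberg_weight (en i))) :: 'a \<Rightarrow>\<^sub>0 laurent) \<mu>"
        by (simp add: top_at_E)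
    next
      fix p x
      assume p: "p \<in> {p. p permutes {0..<n}}" "p \<noteq> id"
        and x: "x \<in> keys (signof p * E (\<Sum>i<n. en (p i) (steinberg_weight (en i))) :: 'a \<Rightarrow>\<^sub>0 laurent)"
      have "x = (\<Sum>i<n. en (p i) (steinberg_weight (en i)))"
        using x by (cases "evenperm p") (auto simp: sign_def split: if_splits)
      show "rho \<bullet> x < rho \<bullet> \<mu>"
      proof (rule ccontr)
        assume "\<not> rho \<bullet> x < rho \<bullet> \<mu>"
        then have ge: "rho \<bullet> x \<ge> rho \<bullet> \<mu>" by simp
        \<comment> \<open>The permutation \<open>p\<close> of indices is carried over to a
          permutation of W. If its exponent were high enough, \<open>steinberg_permutation\<close>
          would make it the identity.\<close>
        define q where "q = en \<circ> p \<circ> inv_into {0..<n} en"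
        have inv: "inv_into {0..<n} en (en i) = i" if "i < n" for i
          using en that by (intro inv_into_f_f) (auto simp: bij_betw_def)
        have q: "bij_betw q W W"
          unfolding q_def
          by (rule bij_betw_trans[OF bij_betw_inv_into[OF en] bij_betw_trans[OF permutes_imp_bij en]])
            (use p(1) in simp)
        have "(\<Sum>w\<in>W. rho \<bullet> q w (steinberg_weight w)) = (\<Sum>i<n. rho \<bullet> q (en i) (steinberg_weight (en i)))"
          by (rule reindex[symmetric])
        also have "\<dots> = rho \<bullet> x"
          unfolding \<open>x = _\<close> inner_sum_right by (rule sum.cong) (auto simp: q_def inv)
        finally have "(\<Sum>w\<in>W. rho \<bullet> q w (steinberg_weight w)) \<ge> (\<Sum>w\<in>W. rho \<bullet> descent_weight w)"
          using ge by (simp add: \<mu>_def inner_sum_right)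
        from steinberg_permutation[OF q this] have qid: "q w = w" if "w \<in> W" for w using that by blast
        have "p i = i" if "i < n" for i
        proof -
          have pi: "p i < n" using p(1) that permutes_in_image[of p "{0..<n}" i] by auto
          have "en (p i) = en i" using qid[OF enW[OF that]] inv[OF that] by (simp add: q_def)
          then show ?thesis using en that pi by (auto simp: bij_betw_def inj_on_def)
        qed
        moreover have "p i = i" if "\<not> i < n" for i using p(1) that by (auto simp: permutes_def)
        ultimately have "p = id" by (metis eq_id_iff)
        then show False using p(2) by simp
      qed
    qed (auto simp: permutes_id finite_permutations)
    finally show ?thesis .
  qed

  have \<mu>2: "\<mu> + \<mu> = real n *\<^sub>R rho"
  proof -
    \<comment> \<open>The indicator of the descent \<open>\<gamma>\<close>. It takes complementary
      values at \<open>w\<close> and \<open>reflection \<gamma> \<circ> w\<close>, so twice its sum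
      over W is \<open>n\<close>.\<close>
    define c where "c w \<gamma> = (if winv w \<gamma> \<in> pos then (0::real) else 1)" for w \<gamma>
    have dw: "descent_weight w = (\<Sum>\<gamma>\<in>\<Delta>. c w \<gamma> *\<^sub>R fund \<gamma>)" for w
    proof -
      have "(\<Sum>\<gamma>\<in>\<Delta>. c w \<gamma> *\<^sub>R fund \<gamma>) = (\<Sum>\<gamma>\<in>\<Delta>. if winv w \<gamma> \<notin> pos then fund \<gamma> else 0)"
        by (rule sum.cong) (auto simp: c_def)
      then show ?thesis unfolding descent_weight_def descents_def
        by (simp add: sum.inter_filter[OF finite_base])
    qed
    have flip: "c (reflection \<gamma> \<circ> w) \<gamma> = 1 - c w \<gamma>" if "w \<in> W" "\<gamma> \<in> \<Delta>" for w \<gamma>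
    proof -
      have "winv (reflection \<gamma> \<circ> w) \<gamma> = winv w (winv (reflection \<gamma>) \<gamma>)"
        using o_inv_distrib[OF weyl_bij[OF simple_in_weyl[OF that(2)]] weyl_bij[OF that(1)]] by (metis comp_apply)
      also have "winv (reflection \<gamma>) \<gamma> = - \<gamma>"
        by (rule inv_f_eq) (metis inj_onI reflection_invol,
            metis minus_minus reflection_invol reflection_self simple_nonzero that(2))
      also have "winv w (- \<gamma>) = - winv w \<gamma>" by (rule linear_neg[OF weyl_linear[OF weyl_inv[OF that(1)]]])
      finally have "winv (reflection \<gamma> \<circ> w) \<gamma> = - winv w \<gamma>" .
      then show ?thesis
        unfolding c_def
        using pos_iff_not_neg[OF weyl_root[OF weyl_inv[OF that(1)] simple_root[OF that(2)]]]
        by (cases "winv w \<gamma> \<in> pos"; simp only:; simp)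
    qed
    have count: "(\<Sum>w\<in>W. c w \<gamma>) + (\<Sum>w\<in>W. c w \<gamma>) = real n" if g: "\<gamma> \<in> \<Delta>" for \<gamma>
    proof -
      have "(\<Sum>w\<in>W. c w \<gamma>) = (\<Sum>w\<in>W. c (reflection \<gamma> \<circ> w) \<gamma>)"
        by (rule sum.reindex_bij_betw[OF bij_betw_weyl_left[OF simple_in_weyl[OF g]], symmetric])
      also have "\<dots> = (\<Sum>w\<in>W. 1 - c w \<gamma>)" by (rule sum.cong) (auto simp: flip g)
      finally show ?thesis by (simp add: sum_subtractf n_def)
    qed
    have "\<mu> = (\<Sum>\<gamma>\<in>\<Delta>. (\<Sum>w\<in>W. c w \<gamma>) *\<^sub>R fund \<gamma>)"
      unfolding \<mu>_def dw by (subst sum.swap) (simp add: scaleR_left.sum)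
    then have "\<mu> + \<mu> = (\<Sum>\<gamma>\<in>\<Delta>. ((\<Sum>w\<in>W. c w \<gamma>) + (\<Sum>w\<in>W. c w \<gamma>)) *\<^sub>R fund \<gamma>)"
      by (simp only: scaleR_add_left sum.distrib)
    also have "\<dots> = real n *\<^sub>R rho"
      unfolding rho_def scaleR_sum_right by (rule sum.cong) (simp_all only: count)
    finally show ?thesis .
  qed

  \<comment> \<open>The factor \<open>s\<close> makes \<open>denom ^ n * g\<close> equal to the
    square of the determinant of \<open>M\<close> exactly, without a sign.\<close>
  define g where "g = s * Determinant.det N"
  have NZ: "N $$ (i, j) \<in> Z" if "i < n" "j < n" for i j
    using that by (simp add: N_def alt_quot_Z S_mult eS)
  have det_Z: "Determinant.det B \<in> Z" if B: "B \<in> carrier_mat m m" "\<And>i j. i < m \<Longrightarrow> j < m \<Longrightarrow> B $$ (i, j) \<in> Z" for B m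
  proof -
    have "signof p \<in> Z" for p :: "nat \<Rightarrow> nat" by (auto simp: sign_def Z_one Z_uminus)
    moreover have "p i < m" if "p permutes {0..<m}" "i < m" for p i
      using that permutes_in_image[of p "{0..<m}" i] by auto
    ultimately show ?thesis
      unfolding det_def'[OF B(1)] by (intro Z_sum Z_mult Z_prod) (auto intro: B(2))
  qed
  have gZ: "g \<in> Z" unfolding g_def by (intro Z_mult sZ det_Z[of _ n] NZ) auto
  have "denom ^ n * Determinant.det N = Determinant.det (denom \<cdot>\<^sub>m N)" by (simp add: N_def)
  also have "\<dots> = s * Determinant.det M * Determinant.det M"
    by (simp add: AM[symmetric] det_mult[of _ n] detA)
  finally have "denom ^ n * g = s * (s * Determinant.det M * Determinant.det M)"
    unfolding g_def by (metis mult.left_commute)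
  then have Dg: "denom ^ n * g = Determinant.det M * Determinant.det M"
    by (simp add: ss flip: mult.assoc)
  have topD: "top_at rho (denom ^ n) (real n *\<^sub>R rho)" by (rule top_at_power[OF denom_top])
  have topDg: "top_at rho (denom ^ n * g) (real n *\<^sub>R rho)"
    unfolding Dg \<mu>2[symmetric] by (rule top_at_mult[OF topM topM])
  note factor = top_at_factor[OF topD topDg]
  \<comment> \<open>The keys of the invariant \<open>g\<close> form whole orbits of nonpositive
    height, so all of them have height 0, and \<open>factor\<close> then allows only the exponent
    0.\<close>
  have "keys g \<subseteq> {0}"
  proof
    fix x assume x: "x \<in> keys g"
    have "w x \<in> keys g" if "w \<in> W" for w
      using keys_act[OF weyl_bij[OF that], of g] Z_act[OF gZ that] x by auto
    then have "rho \<bullet> w x \<le> 0" if "w \<in> W" for w using factor(2) that by blast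
    moreover have "x \<in> span \<Phi>" using Z_S[OF gZ] x by (auto simp: S_def intro: lattice_span)
    ultimately have "rho \<bullet> x = 0" by (intro invariant_weight_zero)
    then show "x \<in> {0}" using factor(3)[OF x] by simp
  qed
  then have "lookup g x = 0" if "x \<noteq> 0" for x
    using that by (meson in_keys_iff singletonD subsetD)
  then have "lookup g x = lookup 1 x" for x
    using factor(1) by (cases "x = 0") (simp_all add: lookup_one)
  then have "s * Determinant.det N = 1"
    using poly_mapping_eqI[of g 1] by (simp add: g_def)
  then have "s * (s * Determinant.det N) = s" by simp
  then have detN: "Determinant.det N = s" by (simp add: ss flip: mult.assoc)

  \<comment> \<open>The determinant \<open>s\<close> is its own inverse, and the entries of the
    adjugate are minors of \<open>N\<close> up to sign, so the inverse has entries in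
    \<open>Z\<close> again.\<close>
  define Ninv where "Ninv = s \<cdot>\<^sub>m adj_mat N"
  have Nc: "Ninv \<in> carrier_mat n n" by (simp add: Ninv_def adj_mat)
  have NNinv: "N * Ninv = 1\<^sub>m n"
    unfolding Ninv_def mult_smult_distrib[OF carrier(3) adj_mat(1)[OF carrier(3)]] adj_mat(2)[OF carrier(3)]
    by (rule eq_matI) (auto simp: detN ss)
  have NinvZ: "Ninv $$ (i, j) \<in> Z" if "i < n" "j < n" for i j
  proof -
    have "cofactor N j i \<in> Z" unfolding cofactor_def
    proof (intro Z_mult det_Z)
      show "(- 1) ^ (j + i) \<in> Z" by (cases "even (j + i)") (auto simp: Z_one Z_uminus)
      show "mat_delete N j i \<in> carrier_mat (n - 1) (n - 1)" by (rule mat_delete_carrier[OF carrier(3)])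
      fix k l assume "k < n - 1" "l < n - 1"
      then show "mat_delete N j i $$ (k, l) \<in> Z"
        by (auto simp: mat_delete_def N_def intro!: alt_quot_Z S_mult eS)
    qed
    then show ?thesis using that by (simp add: Ninv_def adj_mat_def N_def Z_mult sZ)
  qed
  define b where "b j = (\<Sum>k<n. Ninv $$ (k, j) * e k)" for j
  have bS: "b j \<in> S" if "j < n" for j
    unfolding b_def by (intro S_sum S_mult Z_S[OF NinvZ] eS that) auto
  have dual: "alt_quot (e i * b j) = (if i = j then 1 else 0)" if ij: "i < n" "j < n" for i j
  proof -
    have "alt_quot (e i * b j) = alt_quot (\<Sum>k<n. Ninv $$ (k, j) * (e i * e k))"
      by (simp add: b_def sum_distrib_left mult.left_commute)
    also have "\<dots> = (\<Sum>k<n. alt_quot (Ninv $$ (k, j) * (e i * e k)))"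
      using ij by (intro alt_quot_sum S_mult Z_S[OF NinvZ] eS) auto
    also have "\<dots> = (\<Sum>k<n. N $$ (i, k) * Ninv $$ (k, j))"
    proof (rule sum.cong[OF refl])
      fix k assume "k \<in> {..<n}"
      then have k: "k < n" by simp
      show "alt_quot (Ninv $$ (k, j) * (e i * e k)) = N $$ (i, k) * Ninv $$ (k, j)"
        using ij k alt_quot_mult_Z[OF S_mult[OF eS eS] NinvZ, of i k k j] by (simp add: N_def)
    qed
    also have "\<dots> = (N * Ninv) $$ (i, j)"
      using ij Nc by (simp add: scalar_prod_def atLeast0LessThan N_def)
    finally show ?thesis using ij by (simp add: NNinv)
  qed
  \<comment> \<open>Biorthogonality says that \<open>A * B\<close> is \<open>denom\<close> times the
    identity matrix. In \<open>B * A\<close> the sum runs over the family instead of over W, and the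
    column of the identity element of W yields the expansion.\<close>
  define B where "B = mat n n (\<lambda>(k, j). act (en k) (b j))"
  have B: "B \<in> carrier_mat n n" by (simp add: B_def)
  have "A * B = denom \<cdot>\<^sub>m 1\<^sub>m n"
  proof (rule eq_matI)
    fix i j assume "i < dim_row (denom \<cdot>\<^sub>m 1\<^sub>m n)" "j < dim_col (denom \<cdot>\<^sub>m 1\<^sub>m n)"
    then have ij: "i < n" "j < n" by auto
    have "(A * B) $$ (i, j) = (\<Sum>k<n. sg (en k) * act (en k) (e i) * act (en k) (b j))"
      using ij by (simp add: A_def B_def scalar_prod_def atLeast0LessThan)
    also have "\<dots> = (\<Sum>k<n. sg (en k) * act (en k) (e i * b j))"
      by (rule sum.cong) (simp_all add: act_mult mult.assoc)
    also have "\<dots> = alternate (e i * b j)" unfolding alternate_def by (rule reindex)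
    also have "\<dots> = (denom \<cdot>\<^sub>m 1\<^sub>m n) $$ (i, j)"
      using ij denom_alt_quot[OF S_mult[OF eS bS], of i j] by (simp add: dual)
    finally show "(A * B) $$ (i, j) = (denom \<cdot>\<^sub>m 1\<^sub>m n) $$ (i, j)" .
  qed (auto simp: A_def B_def)
  then have BA: "B * A = denom \<cdot>\<^sub>m 1\<^sub>m n"
    by (rule matrix_scalar_inverse_commute[OF carrier(2) B]) (rule top_at_nonzero_divisor[OF denom_top])
  obtain l where l: "l < n" "en l = id"
    using en weyl_group.id by (metis atLeastLessThan_iff bij_betw_def imageE)
  have expand: "f = (\<Sum>i<n. alt_quot (f * b i) * e i)" if f: "f \<in> S" for f
  proof (rule denom_cancel)
    have "denom * (\<Sum>i<n. alt_quot (f * b i) * e i) = (\<Sum>i<n. alternate (f * b i) * e i)"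
      unfolding sum_distrib_left
      by (rule sum.cong) (auto simp: denom_alt_quot[symmetric] S_mult f bS mult.assoc)
    also have "\<dots> = (\<Sum>i<n. (\<Sum>k<n. sg (en k) * act (en k) (f * b i)) * e i)"
      unfolding alternate_def reindex[symmetric] ..
    also have "\<dots> = (\<Sum>i<n. \<Sum>k<n. sg (en k) * act (en k) f * (act (en k) (b i) * e i))"
      unfolding sum_distrib_right by (intro sum.cong refl) (simp add: act_mult mult.assoc)
    also have "\<dots> = (\<Sum>k<n. sg (en k) * act (en k) f * (\<Sum>i<n. act (en k) (b i) * e i))"
      by (subst sum.swap) (simp add: sum_distrib_left)
    also have "\<dots> = (\<Sum>k<n. sg (en k) * act (en k) f * (if k = l then denom else 0))"
    proof (rule sum.cong[OF refl])
      fix k assume "k \<in> {..<n}"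
      then have k: "k < n" by simp
      have "(\<Sum>i<n. act (en k) (b i) * e i) = (B * A) $$ (k, l)"
        using k l by (simp add: A_def B_def scalar_prod_def atLeast0LessThan)
      also have "\<dots> = (if k = l then denom else 0)" using k l by (simp add: BA)
      finally show "sg (en k) * act (en k) f * (\<Sum>i<n. act (en k) (b i) * e i) =
          sg (en k) * act (en k) f * (if k = l then denom else 0)" by simp
    qed
    also have "\<dots> = denom * f" using l by (simp add: if_distrib cong: if_cong)
    finally show "denom * f = denom * (\<Sum>i<n. alt_quot (f * b i) * e i)" by simp
  qed
  show ?thesis
    by (intro exI[of _ n] exI[of _ e] exI[of _ b] conjI allI impI ballI eS bS dual expand)
qed

end

section \<open>Word length and nonzero divisors of the group algebra\<close>

context root_base begin

abbreviation len :: "('a \<Rightarrow> 'a) \<Rightarrow> nat" where "len \<equiv> weyl_length \<Delta>"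

lemma len_eq: "len w = (LEAST n. \<exists>\<alpha>s. set \<alpha>s \<subseteq> \<Delta> \<and> length \<alpha>s = n \<and> w = word_prod \<alpha>s)"
  by (simp add: weyl_length_def word_prod_def)

lemma len_word:
  assumes "w \<in> W"
  obtains \<alpha>s where "set \<alpha>s \<subseteq> \<Delta>" "length \<alpha>s = len w" "w = word_prod \<alpha>s"
proof -
  have "\<exists>n \<alpha>s. set \<alpha>s \<subseteq> \<Delta> \<and> length \<alpha>s = n \<and> w = word_prod \<alpha>s" using weyl_word[OF assms] by blast
  then have "\<exists>\<alpha>s. set \<alpha>s \<subseteq> \<Delta> \<and> length \<alpha>s = len w \<and> w = word_prod \<alpha>s"
    unfolding len_eq by (rule LeastI_ex)
  then show thesis using that by blast
qed

lemma len_le: "set \<alpha>s \<subseteq> \<Delta> \<Longrightarrow> len (word_prod \<alpha>s) \<le> length \<alpha>s"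
  unfolding len_eq by (rule Least_le) blast

lemma len_id [simp]: "len id = 0"
  using len_le[of "[]"] by simp

lemma len_zero: "w \<in> W \<Longrightarrow> len w = 0 \<Longrightarrow> w = id"
  using len_word[of w] by (metis length_0_conv word_prod_simps(1))

lemma sgn_len: "w \<in> W \<Longrightarrow> sgn_weyl w = (-1) ^ len w"
  using len_word[of w] sgn_word_prod by metis

lemma len_inv: "w \<in> W \<Longrightarrow> len (winv w) = len w"
proof -
  have le: "len (winv w) \<le> len w" if w: "w \<in> W" for w
  proof -
    obtain \<alpha>s where a: "set \<alpha>s \<subseteq> \<Delta>" "length \<alpha>s = len w" "w = word_prod \<alpha>s" using len_word[OF w] .
    have "word_prod (rev \<alpha>s) \<circ> word_prod \<alpha>s = id" "word_prod \<alpha>s \<circ> word_prod (rev \<alpha>s) = id"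
      using word_prod_rev[of \<alpha>s] word_prod_rev[of "rev \<alpha>s"] by simp_all
    then have "winv w = word_prod (rev \<alpha>s)" using a(3) inv_unique_comp by metis
    then show ?thesis using len_le[of "rev \<alpha>s"] a by simp
  qed
  assume w: "w \<in> W"
  have "winv (winv w) = w" using weyl_bij[OF w] by (simp add: inv_inv_eq)
  then show ?thesis using le[OF w] le[OF weyl_inv[OF w]] by simp
qed

text \<open>The lengths differ by at most one, and the sign excludes equality.\<close>

lemma len_left:
  assumes "w \<in> W" "\<alpha> \<in> \<Delta>"
  shows "len (reflection \<alpha> \<circ> w) = Suc (len w) \<or> len w = Suc (len (reflection \<alpha> \<circ> w))"
proof -
  have le: "len (reflection \<alpha> \<circ> w) \<le> Suc (len w)" if w: "w \<in> W" for w
  proof -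
    obtain \<alpha>s where a: "set \<alpha>s \<subseteq> \<Delta>" "length \<alpha>s = len w" "w = word_prod \<alpha>s" using len_word[OF w] .
    then show ?thesis using len_le[of "\<alpha> # \<alpha>s"] assms(2) by simp
  qed
  have sW: "reflection \<alpha> \<circ> w \<in> W" using assms weyl_comp simple_in_weyl by blast
  have "reflection \<alpha> \<circ> (reflection \<alpha> \<circ> w) = w" by (simp only: comp_assoc[symmetric] reflection_comp_self id_comp)
  then have "len w \<le> Suc (len (reflection \<alpha> \<circ> w))" using le[OF sW] by simp
  moreover have "len (reflection \<alpha> \<circ> w) \<le> Suc (len w)" by (rule le[OF assms(1)])
  moreover have "len (reflection \<alpha> \<circ> w) \<noteq> len w"
  proof
    assume e: "len (reflection \<alpha> \<circ> w) = len w"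
    have "sgn_weyl (reflection \<alpha> \<circ> w) = - sgn_weyl w"
      using sgn_weyl_comp[OF simple_in_weyl[OF assms(2)] assms(1)] by (simp add: sgn_weyl_reflection assms)
    then have "sgn_weyl w = - sgn_weyl w" using e sgn_len[OF sW] sgn_len[OF assms(1)] by simp
    then show False using sgn_weyl_square[of w] by simp
  qed
  ultimately show ?thesis by linarith
qed

lemma len_simple: "\<alpha> \<in> \<Delta> \<Longrightarrow> len (reflection \<alpha>) = 1"
  using len_left[OF weyl_group.id, of \<alpha>] by simp

lemma len_Suc_decomp:
  assumes "w \<in> W" "len w = Suc k"
  obtains \<alpha> u where "\<alpha> \<in> \<Delta>" "u \<in> W" "w = reflection \<alpha> \<circ> u" "len u = k"
proof -
  obtain \<alpha>s where a: "set \<alpha>s \<subseteq> \<Delta>" "length \<alpha>s = len w" "w = word_prod \<alpha>s" using len_word[OF assms(1)] .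
  then obtain \<alpha> \<beta>s where ab: "\<alpha>s = \<alpha> # \<beta>s" using assms(2) by (cases \<alpha>s) auto
  have b: "\<alpha> \<in> \<Delta>" "set \<beta>s \<subseteq> \<Delta>" "length \<beta>s = k" using a ab assms(2) by auto
  have u: "word_prod \<beta>s \<in> W" using word_prod_weyl b by blast
  have w: "w = reflection \<alpha> \<circ> word_prod \<beta>s" using a(3) ab by simp
  have "len (word_prod \<beta>s) = k"
    using len_left[OF u b(1)] len_le[OF b(2)] b(3) assms(2) w by auto
  then show thesis using that b u w by blast
qed

lemma len_Suc_decomp_right:
  assumes "w \<in> W" "len w = Suc k"
  obtains \<alpha> u where "\<alpha> \<in> \<Delta>" "u \<in> W" "w = u \<circ> reflection \<alpha>" "len u = k"
proof -
  obtain \<alpha> u where a: "\<alpha> \<in> \<Delta>" "u \<in> W" "winv w = reflection \<alpha> \<circ> u" "len u = k"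
    using len_Suc_decomp[OF weyl_inv[OF assms(1)]] len_inv[OF assms(1)] assms(2) by metis
  have "w = winv (winv w)" using weyl_bij[OF assms(1)] by (simp add: inv_inv_eq)
  also have "\<dots> = winv u \<circ> winv (reflection \<alpha>)"
    unfolding a(3) using o_inv_distrib weyl_bij[OF a(2)] weyl_bij[OF simple_in_weyl[OF a(1)]] by blast
  also have "winv (reflection \<alpha>) = reflection \<alpha>"
    using inv_unique_comp reflection_comp_self by blast
  finally show thesis using that[OF a(1) weyl_inv[OF a(2)]] len_inv[OF a(2)] a(4) by blast
qed

lemma one_minus_E_pos_nonzero_divisor:
  "\<beta> \<in> pos \<Longrightarrow> (1 - E (- \<beta>)) * g = (0 :: 'a \<Rightarrow>\<^sub>0 laurent) \<Longrightarrow> g = 0"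
  using top_at_nonzero_divisor[OF one_minus_E_top] .

text \<open>In the direction of \<open>x - y\<close> the exponent \<open>x\<close> is the leading
  one.\<close>

lemma E_diff_nonzero_divisor:
  assumes "x \<noteq> y" "(E x - E y) * g = (0 :: 'a \<Rightarrow>\<^sub>0 laurent)"
  shows "g = 0"
proof (rule top_at_nonzero_divisor[OF _ assms(2)])
  have "(x - y) \<bullet> (x - y) > 0" using assms(1) by simp
  then have "(x - y) \<bullet> y < (x - y) \<bullet> x" by (simp add: inner_diff_right)
  then show "top_at (x - y) (E x - E y :: 'a \<Rightarrow>\<^sub>0 laurent) x"
    unfolding top_at_def
    using assms(1) keys_diff'[of "E x" "E y :: 'a \<Rightarrow>\<^sub>0 laurent"]
    by (auto simp: lookup_minus lookup_single when_def split: if_splits)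
qed

lemma Z_simple:
  assumes "f \<in> S" "\<And>\<alpha>. \<alpha> \<in> \<Delta> \<Longrightarrow> act (reflection \<alpha>) f = f"
  shows "f \<in> Z"
proof -
  have *: "set \<alpha>s \<subseteq> \<Delta> \<Longrightarrow> act (word_prod \<alpha>s) f = f" for \<alpha>s
  proof (induction \<alpha>s)
    case (Cons \<alpha> \<alpha>s)
    have b: "bij (reflection \<alpha>)" using Cons weyl_bij simple_in_weyl by auto
    have b2: "bij (word_prod \<alpha>s)" using Cons weyl_bij word_prod_weyl by auto
    have "act (word_prod (\<alpha> # \<alpha>s)) f = act (reflection \<alpha>) (act (word_prod \<alpha>s) f)"
      by (simp only: word_prod_simps act_comp[OF b b2])
    also have "\<dots> = f" using Cons assms(2) by simp
    finally show ?case .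
  qed (simp add: act_id[unfolded id_def])
  have "act w f = f" if "w \<in> W" for w
  proof -
    obtain \<alpha>s where "set \<alpha>s \<subseteq> \<Delta>" "w = word_prod \<alpha>s" using weyl_word[OF \<open>w \<in> W\<close>] by blast
    then show ?thesis using * by blast
  qed
  then show ?thesis using assms(1) by (simp add: Z_def)
qed

end

section \<open>The affine Hecke algebra\<close>

lemma (in ring) finsum_closed_under:
  assumes "finite A" "\<zero> \<in> M" "M \<subseteq> carrier R" "\<And>x y. x \<in> M \<Longrightarrow> y \<in> M \<Longrightarrow> x \<oplus> y \<in> M"
    and "\<And>a. a \<in> A \<Longrightarrow> F a \<in> M"
  shows "finsum R F A \<in> M"
  using assms(1,5)
proof (induction A rule: finite_induct)
  case (insert a A)
  then have "finsum R F (insert a A) = F a \<oplus> finsum R F A"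
    using assms(3) by (intro finsum_insert) auto
  then show ?case using insert assms(4) by auto
qed (use assms in simp)

text \<open>The coefficient of \<open>T w\<close> as one element of the group algebra. It converts
  the basis of all T_w \<theta>_x over the Laurent polynomials into the basis of all T_w over
  \<open>S\<close>.\<close>

definition slice :: "('w \<times> 'k \<Rightarrow>\<^sub>0 'c::zero) \<Rightarrow> 'w \<Rightarrow> 'k \<Rightarrow>\<^sub>0 'c" where
  "slice c w = Poly_Mapping.map_key (Pair w) c"

lemma lookup_slice: "lookup (slice c w) x = lookup c (w, x)"
  by (simp add: slice_def Poly_Mapping.map_key.rep_eq inj_on_def)

lemma slice_add: "slice (c + d) w = slice c w + slice d w"
  by (rule poly_mapping_eqI) (simp add: lookup_slice lookup_add)

lemma slice_single: "slice (single (w, x) a) u = (if u = w then single x a else 0)"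
  by (rule poly_mapping_eqI) (auto simp: lookup_slice lookup_single when_def)

lemma slice_zero: "slice 0 w = 0"
  by (rule poly_mapping_eqI) (simp add: lookup_slice)

locale hecke = root_base \<Phi> \<Delta> + affine_hecke_algebra \<Phi> \<Delta> L H \<iota> T \<theta>
  for \<Phi> \<Delta> :: "'a::euclidean_space set" and L :: "'a \<Rightarrow> nat"
    and H :: "('h, 'm) ring_scheme" (structure)
    and \<iota> :: "laurent \<Rightarrow> 'h" and T :: "('a \<Rightarrow> 'a) \<Rightarrow> 'h" and \<theta> :: "'a \<Rightarrow> 'h"
begin

abbreviation em :: "('a \<Rightarrow>\<^sub>0 laurent) \<Rightarrow> 'h" where "em \<equiv> theta_embed H \<iota> \<theta>"

lemma scalar_zero: "\<iota> 0 = \<zero>"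
proof -
  have "\<iota> 0 \<oplus> \<iota> 0 = \<iota> 0" using scalar_add[of 0 0] by simp
  then show ?thesis using add.l_cancel_one[of "\<iota> 0" "\<iota> 0"] scalar_closed[of 0] by simp
qed

lemma em_superset:
  assumes "finite A" "keys f \<subseteq> A" "A \<subseteq> X"
  shows "em f = finsum H (\<lambda>x. \<iota> (lookup f x) \<otimes> \<theta> x) A"
  unfolding theta_embed_def
  by (rule add.finprod_mono_neutral_cong_left)
    (use assms in \<open>auto simp: in_keys_iff scalar_zero scalar_closed theta_closed\<close>)

lemma em_closed [simp, intro]: "f \<in> S \<Longrightarrow> em f \<in> carrier H"
  unfolding theta_embed_def S_def by (intro finsum_closed) (auto simp: scalar_closed theta_closed)

lemma em_add: "f \<in> S \<Longrightarrow> g \<in> S \<Longrightarrow> em (f + g) = em f \<oplus> em g"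
proof -
  assume fg: "f \<in> S" "g \<in> S"
  let ?A = "keys f \<union> keys g"
  have A: "?A \<subseteq> X" using fg by (auto simp: S_def)
  have "em (f + g) = finsum H (\<lambda>x. \<iota> (lookup (f + g) x) \<otimes> \<theta> x) ?A"
    using keys_add[of f g] A by (intro em_superset) auto
  also have "\<dots> = finsum H (\<lambda>x. \<iota> (lookup f x) \<otimes> \<theta> x \<oplus> \<iota> (lookup g x) \<otimes> \<theta> x) ?A"
    using A by (intro finsum_cong') (auto simp: lookup_add scalar_add l_distr scalar_closed theta_closed)
  also have "\<dots> = finsum H (\<lambda>x. \<iota> (lookup f x) \<otimes> \<theta> x) ?A \<oplus> finsum H (\<lambda>x. \<iota> (lookup g x) \<otimes> \<theta> x) ?A"
    using A by (intro finsum_addf) (auto simp: scalar_closed theta_closed)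
  also have "finsum H (\<lambda>x. \<iota> (lookup f x) \<otimes> \<theta> x) ?A = em f"
    using A by (intro em_superset[symmetric]) auto
  also have "finsum H (\<lambda>x. \<iota> (lookup g x) \<otimes> \<theta> x) ?A = em g"
    using A by (intro em_superset[symmetric]) auto
  finally show ?thesis .
qed

lemma em_single: "x \<in> X \<Longrightarrow> em (single x a) = \<iota> a \<otimes> \<theta> x"
  using em_superset[of "{x}" "single x a"] by (simp add: scalar_closed theta_closed)

lemma em_zero [simp]: "em 0 = \<zero>"
  by (simp add: theta_embed_def)

lemma em_scalar: "em (single 0 a) = \<iota> a"
  by (simp add: em_single lattice_zero theta_zero scalar_closed)

lemma em_one [simp]: "em 1 = \<one>"
  using em_scalar[of 1] by (simp add: scalar_one)

lemma em_mult: "f \<in> S \<Longrightarrow> g \<in> S \<Longrightarrow> em (f * g) = em f \<otimes> em g"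
proof (induction f rule: S_induct)
  case (single x a)
  from \<open>g \<in> S\<close> show ?case
  proof (induction g rule: S_induct)
    case (single y b)
    have "em (single x a * single y b) = (\<iota> a \<otimes> \<iota> b) \<otimes> (\<theta> x \<otimes> \<theta> y)"
      by (simp add: mult_single em_single lattice_add \<open>x \<in> X\<close> single scalar_mult theta_mult)
    also have "\<dots> = \<iota> a \<otimes> (\<iota> b \<otimes> \<theta> x) \<otimes> \<theta> y"
      by (simp add: m_assoc scalar_closed theta_closed \<open>x \<in> X\<close> single)
    also have "\<iota> b \<otimes> \<theta> x = \<theta> x \<otimes> \<iota> b" by (rule scalar_central) (simp add: theta_closed \<open>x \<in> X\<close>)
    finally show ?case
      by (simp add: em_single \<open>x \<in> X\<close> single m_assoc scalar_closed theta_closed)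
  next
    case (add f g)
    then show ?case
      using \<open>x \<in> X\<close> by (simp add: distrib_left em_add S_mult S_single r_distr)
  qed (simp_all add: \<open>x \<in> X\<close> S_single)
next
  case (add f h)
  then show ?case by (simp add: distrib_right em_add S_mult l_distr)
qed simp

lemma em_uminus: "f \<in> S \<Longrightarrow> em (- f) = \<ominus> em f"
proof -
  assume f: "f \<in> S"
  then have "em (- f) \<oplus> em f = \<zero>" using em_add[of "- f" f] S_uminus[of f] by simp
  then show ?thesis using f S_uminus[OF f] by (metis em_closed minus_equality)
qed

lemma em_diff: "f \<in> S \<Longrightarrow> g \<in> S \<Longrightarrow> em (f - g) = em f \<ominus> em g"
  using em_add[of f "- g"] by (simp add: em_uminus S_uminus a_minus_def)

lemma em_commute: "f \<in> S \<Longrightarrow> g \<in> S \<Longrightarrow> em f \<otimes> em g = em g \<otimes> em f"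
  by (simp add: mult.commute flip: em_mult)

lemma em_sum: "(\<And>i. i \<in> A \<Longrightarrow> f i \<in> S) \<Longrightarrow> em (\<Sum>i\<in>A. f i) = finsum H (\<lambda>i. em (f i)) A"
proof (induction A rule: infinite_finite_induct)
  case (insert a A)
  then show ?case by (subst finsum_insert) (auto simp: em_add S_sum)
qed simp_all

subsection \<open>Coefficients\<close>

text \<open>Vanishing outside W makes a family equal to any other one with the same values on W, so
  that coefficients can be compared as functions.\<close>

definition fam :: "(('a \<Rightarrow> 'a) \<Rightarrow> 'a \<Rightarrow>\<^sub>0 laurent) \<Rightarrow> bool" where
  "fam f \<longleftrightarrow> (\<forall>w\<in>W. f w \<in> S) \<and> (\<forall>w. w \<notin> W \<longrightarrow> f w = 0)"

definition comb :: "(('a \<Rightarrow> 'a) \<Rightarrow> 'a \<Rightarrow>\<^sub>0 laurent) \<Rightarrow> 'h" where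
  "comb f = finsum H (\<lambda>w. T w \<otimes> em (f w)) W"

lemma fam_S: "fam f \<Longrightarrow> f w \<in> S"
  unfolding fam_def using S_zero by metis

lemma comb_closed: "fam f \<Longrightarrow> comb f \<in> carrier H"
  unfolding comb_def by (intro finsum_closed) (auto simp: fam_S T_closed)

lemma fam_add: "fam f \<Longrightarrow> fam g \<Longrightarrow> fam (\<lambda>w. f w + g w)"
  and fam_mult: "fam f \<Longrightarrow> s \<in> S \<Longrightarrow> fam (\<lambda>w. f w * s)"
  and fam_delta: "w \<in> W \<Longrightarrow> s \<in> S \<Longrightarrow> fam (\<lambda>u. if u = w then s else 0)"
  by (auto simp: fam_def S_add S_mult S_zero)

lemma comb_add:
  assumes "fam f" "fam g"
  shows "comb (\<lambda>w. f w + g w) = comb f \<oplus> comb g"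
proof -
  have "comb (\<lambda>w. f w + g w) = finsum H (\<lambda>w. T w \<otimes> em (f w) \<oplus> T w \<otimes> em (g w)) W"
    unfolding comb_def using assms by (intro finsum_cong') (auto simp: em_add fam_S r_distr T_closed)
  also have "\<dots> = comb f \<oplus> comb g"
    unfolding comb_def using assms by (intro finsum_addf) (auto simp: fam_S T_closed)
  finally show ?thesis .
qed

lemma comb_mult:
  assumes "fam f" "s \<in> S"
  shows "comb (\<lambda>w. f w * s) = comb f \<otimes> em s"
proof -
  have "comb f \<otimes> em s = finsum H (\<lambda>w. T w \<otimes> em (f w) \<otimes> em s) W"
    unfolding comb_def using assms by (intro finsum_ldistr) (auto simp: fam_S T_closed finite_weyl)
  also have "\<dots> = comb (\<lambda>w. f w * s)"
    unfolding comb_def using assms by (intro finsum_cong') (auto simp: em_mult fam_S S_mult m_assoc T_closed)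
  finally show ?thesis by simp
qed

lemma comb_delta:
  assumes "w \<in> W" "s \<in> S"
  shows "comb (\<lambda>u. if u = w then s else 0) = T w \<otimes> em s"
proof -
  have "comb (\<lambda>u. if u = w then s else 0) = finsum H (\<lambda>u. if w = u then T u \<otimes> em s else \<zero>) W"
    unfolding comb_def using assms by (intro finsum_cong') (auto simp: T_closed)
  also have "\<dots> = T w \<otimes> em s"
    using assms by (intro add.finprod_singleton) (auto simp: T_closed finite_weyl)
  finally show ?thesis .
qed

lemma fam_slice: "keys c \<subseteq> W \<times> X \<Longrightarrow> fam (slice c)"
proof -
  assume c: "keys c \<subseteq> W \<times> X"
  have z: "lookup c (w, x) = 0" if "w \<notin> W \<or> x \<notin> X" for w x
    using c that in_keys_iff[of "(w, x)" c] by blast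
  have "slice c w \<in> S" for w
    using z unfolding S_def by (metis in_keys_iff lookup_slice mem_Collect_eq subsetI)
  moreover have "slice c w = 0" if "w \<notin> W" for w
    using z that by (intro poly_mapping_eqI) (simp add: lookup_slice)
  ultimately show ?thesis by (simp add: fam_def)
qed

lemma combination_superset:
  assumes "finite A" "keys c \<subseteq> A" "A \<subseteq> W \<times> X"
  shows "hecke_combination H \<iota> T \<theta> c = finsum H (\<lambda>(w, x). \<iota> (lookup c (w, x)) \<otimes> (T w \<otimes> \<theta> x)) A"
  unfolding hecke_combination_def
  by (rule add.finprod_mono_neutral_cong_left)
    (use assms in \<open>auto simp: in_keys_iff scalar_zero scalar_closed theta_closed T_closed\<close>)

lemma combination_add:
  assumes "keys c \<subseteq> W \<times> X" "keys d \<subseteq> W \<times> X"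
  shows "hecke_combination H \<iota> T \<theta> (c + d) = hecke_combination H \<iota> T \<theta> c \<oplus> hecke_combination H \<iota> T \<theta> d"
proof -
  let ?A = "keys c \<union> keys d"
  let ?t = "\<lambda>c (w, x). \<iota> (lookup c (w, x)) \<otimes> (T w \<otimes> \<theta> x)"
  have A: "?A \<subseteq> W \<times> X" using assms by auto
  have tc: "?t c p \<in> carrier H" if "p \<in> ?A" for p c
    using that A by (auto simp: scalar_closed theta_closed T_closed split: prod.splits)
  have "hecke_combination H \<iota> T \<theta> (c + d) = finsum H (?t (c + d)) ?A"
    using keys_add[of c d] A by (intro combination_superset) auto
  also have "\<dots> = finsum H (\<lambda>p. ?t c p \<oplus> ?t d p) ?A"
    using A tc by (intro finsum_cong')
      (auto simp: lookup_add scalar_add l_distr scalar_closed theta_closed T_closed split: prod.splits)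
  also have "\<dots> = finsum H (?t c) ?A \<oplus> finsum H (?t d) ?A"
    using tc by (intro finsum_addf) blast+
  also have "finsum H (?t c) ?A = hecke_combination H \<iota> T \<theta> c"
    using A by (intro combination_superset[symmetric]) auto
  also have "finsum H (?t d) ?A = hecke_combination H \<iota> T \<theta> d"
    using A by (intro combination_superset[symmetric]) auto
  finally show ?thesis .
qed

lemma combination_comb:
  assumes "keys c \<subseteq> W \<times> X"
  shows "hecke_combination H \<iota> T \<theta> c = comb (slice c)"
  using assms
proof (induction c rule: poly_mapping_induct_on)
  case zero
  have "comb (slice 0) = finsum H (\<lambda>w. \<zero>) W"
    unfolding comb_def by (intro finsum_cong') (auto simp: slice_zero T_closed)
  then show ?case by (simp add: hecke_combination_def)
next
  case (single p a)
  obtain w x where p: "p = (w, x)" "w \<in> W" "x \<in> X" using single by auto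
  have "comb (slice (single p a)) = comb (\<lambda>u. if u = w then single x a else 0)"
    unfolding p(1) slice_single ..
  also have "\<dots> = T w \<otimes> (\<iota> a \<otimes> \<theta> x)" using p by (simp add: comb_delta S_single em_single)
  also have "\<dots> = (T w \<otimes> \<iota> a) \<otimes> \<theta> x" using p by (simp add: m_assoc T_closed scalar_closed theta_closed)
  also have "T w \<otimes> \<iota> a = \<iota> a \<otimes> T w" using p by (simp add: scalar_central T_closed)
  also have "(\<iota> a \<otimes> T w) \<otimes> \<theta> x = \<iota> a \<otimes> (T w \<otimes> \<theta> x)"
    using p by (simp add: m_assoc T_closed scalar_closed theta_closed)
  also have "\<dots> = hecke_combination H \<iota> T \<theta> (single p a)"
    using combination_superset[of "{p}" "single p a"] p by (simp add: T_closed scalar_closed theta_closed)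
  finally show ?case by simp
next
  case (add c d)
  then show ?case
    using comb_add[OF fam_slice fam_slice] by (simp add: combination_add slice_add)
qed

text \<open>The inverse of \<open>slice\<close>, through which the uniqueness in the axiom
  \<open>basis\<close> passes to families with values in \<open>S\<close>.\<close>

lemma exists_glue:
  assumes "fam f"
  shows "\<exists>c. keys c \<subseteq> W \<times> X \<and> slice c = f"
proof -
  define F where "F = (\<lambda>(w, x). lookup (f w) x)"
  have "{p. F p \<noteq> 0} \<subseteq> (\<Union>w\<in>W. {w} \<times> keys (f w))"
    using assms by (auto simp: F_def in_keys_iff fam_def)
  then have "finite {p. F p \<noteq> 0}" by (rule finite_subset) (simp add: finite_weyl)
  then have l: "lookup (Poly_Mapping.Abs_poly_mapping F) = F" by (rule lookup_Abs_poly_mapping)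
  have "slice (Poly_Mapping.Abs_poly_mapping F) = f"
    by (rule ext, rule poly_mapping_eqI, simp only: lookup_slice l, simp add: F_def)
  moreover have "keys (Poly_Mapping.Abs_poly_mapping F) \<subseteq> W \<times> X"
  proof
    fix p assume "p \<in> keys (Poly_Mapping.Abs_poly_mapping F)"
    then have p: "lookup (f (fst p)) (snd p) \<noteq> 0" 
      unfolding in_keys_iff l by (simp add: F_def split_beta)
    then have "fst p \<in> W" using assms by (auto simp: fam_def)
    moreover have "snd p \<in> X" using fam_S[OF assms, of "fst p"] p by (auto simp: S_def in_keys_iff)
    ultimately show "p \<in> W \<times> X" by (simp add: mem_Times_iff)
  qed
  ultimately show ?thesis by blast
qed

lemma comb_surj: "h \<in> carrier H \<Longrightarrow> \<exists>f. fam f \<and> h = comb f"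
  using basis[of h] combination_comb fam_slice by metis

lemma comb_inj:
  assumes "fam f" "fam g" "comb f = comb g"
  shows "f = g"
proof -
  obtain c d where c: "keys c \<subseteq> W \<times> X" "slice c = f" and d: "keys d \<subseteq> W \<times> X" "slice d = g"
    using exists_glue assms(1,2) by metis
  then have "hecke_combination H \<iota> T \<theta> c = hecke_combination H \<iota> T \<theta> d"
    using assms(3) by (simp add: combination_comb)
  then have "c = d"
    using basis[OF comb_closed[OF assms(1)]] combination_comb[OF c(1)] c d by metis
  then show ?thesis using c d by simp
qed

definition coeff :: "'h \<Rightarrow> ('a \<Rightarrow> 'a) \<Rightarrow> 'a \<Rightarrow>\<^sub>0 laurent" where
  "coeff h = (THE f. fam f \<and> h = comb f)"

lemma coeff_comb: "fam f \<Longrightarrow> coeff (comb f) = f"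
  unfolding coeff_def by (rule the_equality) (auto intro: comb_inj)

lemma comb_coeff: "h \<in> carrier H \<Longrightarrow> comb (coeff h) = h" and fam_coeff: "h \<in> carrier H \<Longrightarrow> fam (coeff h)"
  using comb_surj coeff_comb by metis+

lemma coeff_S: "h \<in> carrier H \<Longrightarrow> coeff h w \<in> S"
  using fam_coeff fam_S by blast

lemma coeff_eqI: "h \<in> carrier H \<Longrightarrow> k \<in> carrier H \<Longrightarrow> (\<And>w. w \<in> W \<Longrightarrow> coeff h w = coeff k w) \<Longrightarrow> h = k"
proof -
  assume h: "h \<in> carrier H" and k: "k \<in> carrier H" and eq: "\<And>w. w \<in> W \<Longrightarrow> coeff h w = coeff k w"
  have "coeff h w = coeff k w" for w
    using fam_coeff[OF h] fam_coeff[OF k] eq by (cases "w \<in> W") (auto simp: fam_def)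
  then have "coeff h = coeff k" by (rule ext)
  then have "comb (coeff h) = comb (coeff k)" by (rule arg_cong)
  then show "h = k" unfolding comb_coeff[OF h] comb_coeff[OF k] .
qed

lemma coeff_add: "h \<in> carrier H \<Longrightarrow> k \<in> carrier H \<Longrightarrow> coeff (h \<oplus> k) = (\<lambda>w. coeff h w + coeff k w)"
proof -
  assume h: "h \<in> carrier H" and k: "k \<in> carrier H"
  have "comb (\<lambda>w. coeff h w + coeff k w) = h \<oplus> k"
    by (simp only: comb_add[OF fam_coeff[OF h] fam_coeff[OF k]] comb_coeff[OF h] comb_coeff[OF k])
  then show ?thesis using coeff_comb[OF fam_add[OF fam_coeff[OF h] fam_coeff[OF k]]] by (simp only:)
qed

lemma coeff_zero: "coeff \<zero> = (\<lambda>w. 0)"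
proof
  fix w
  have "coeff (\<zero> \<oplus> \<zero>) w = coeff \<zero> w + coeff \<zero> w" by (subst coeff_add) auto
  then show "coeff \<zero> w = 0" by simp
qed

lemma coeff_mult_em: "h \<in> carrier H \<Longrightarrow> s \<in> S \<Longrightarrow> coeff (h \<otimes> em s) = (\<lambda>w. coeff h w * s)"
  using coeff_comb[OF fam_mult[OF fam_coeff]] comb_mult[OF fam_coeff] comb_coeff by metis

lemma coeff_T_em: "w \<in> W \<Longrightarrow> s \<in> S \<Longrightarrow> coeff (T w \<otimes> em s) = (\<lambda>u. if u = w then s else 0)"
  using coeff_comb[OF fam_delta] comb_delta by metis

lemma coeff_T: "w \<in> W \<Longrightarrow> coeff (T w) = (\<lambda>u. if u = w then 1 else 0)"
  using coeff_T_em[OF _ S_one, of w] by (simp add: T_closed)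

text \<open>\<open>T_mult\<close> makes \<open>T id\<close> a left identity for every
  \<open>T w\<close>, hence for all combinations with coefficients on the right. The unit of
  \<open>H\<close> is one of these.\<close>

lemma T_id: "T id = \<one>"
proof -
  have TT: "T id \<otimes> T w = T w" if "w \<in> W" for w
    using T_mult[OF weyl_group.id that] by simp
  have c: "T id \<otimes> comb f = comb f" if "fam f" for f
  proof -
    have "T id \<otimes> comb f = finsum H (\<lambda>w. T id \<otimes> (T w \<otimes> em (f w))) W"
      unfolding comb_def using that
      by (intro finsum_rdistr) (auto simp: fam_S T_closed finite_weyl weyl_group.id)
    also have "\<dots> = comb f"
      unfolding comb_def
    proof (rule finsum_cong'[OF refl])
      fix w assume w: "w \<in> W"
      show "T id \<otimes> (T w \<otimes> em (f w)) = T w \<otimes> em (f w)"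
        using w TT[OF w] fam_S[OF that, of w]
        by (simp add: T_closed weyl_group.id flip: m_assoc)
    qed (auto simp: fam_S[OF that] T_closed)
    finally show ?thesis .
  qed
  have "T id \<otimes> \<one> = \<one>" using c[OF fam_coeff[OF one_closed]] comb_coeff[OF one_closed] by simp
  then show ?thesis using T_closed[OF weyl_group.id] by simp
qed

lemma coeff_em: "s \<in> S \<Longrightarrow> coeff (em s) = (\<lambda>u. if u = id then s else 0)"
  using coeff_T_em[OF weyl_group.id, of s] by (simp add: T_id)

lemma em_inj: "f \<in> S \<Longrightarrow> g \<in> S \<Longrightarrow> em f = em g \<Longrightarrow> f = g"
  using coeff_em by metis

subsection \<open>The filtration by length\<close>

text \<open>The bound is strict, so that \<open>Fil 0\<close> contains only zero and the error of
  moving \<open>em f\<close> past \<open>T w\<close> lies in \<open>Fil (len w)\<close>.\<close>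

definition Fil :: "nat \<Rightarrow> 'h set" where
  "Fil k = {h \<in> carrier H. \<forall>w\<in>W. coeff h w \<noteq> 0 \<longrightarrow> len w < k}"

lemma Fil_closed: "h \<in> Fil k \<Longrightarrow> h \<in> carrier H"
  by (simp add: Fil_def)

lemma Fil_zero: "\<zero> \<in> Fil k"
  by (simp add: Fil_def coeff_zero)

lemma Fil_add: "h \<in> Fil k \<Longrightarrow> h' \<in> Fil k \<Longrightarrow> h \<oplus> h' \<in> Fil k"
  unfolding Fil_def by (auto simp: coeff_add)

lemma Fil_mult_em: "h \<in> Fil k \<Longrightarrow> s \<in> S \<Longrightarrow> h \<otimes> em s \<in> Fil k"
  unfolding Fil_def by (auto simp: coeff_mult_em)

lemma Fil_mono: "h \<in> Fil k \<Longrightarrow> k \<le> m \<Longrightarrow> h \<in> Fil m"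
  unfolding Fil_def by force

lemma Fil_T_em: "w \<in> W \<Longrightarrow> s \<in> S \<Longrightarrow> len w < k \<Longrightarrow> T w \<otimes> em s \<in> Fil k"
  unfolding Fil_def by (auto simp: coeff_T_em T_closed)

lemma Fil_coeff_zero: "h \<in> Fil k \<Longrightarrow> w \<in> W \<Longrightarrow> k \<le> len w \<Longrightarrow> coeff h w = 0"
  unfolding Fil_def by force

lemma Fil_induct [consumes 1, case_names zero T_em add]:
  assumes h: "h \<in> Fil k" and "P \<zero>"
    and T: "\<And>w s. w \<in> W \<Longrightarrow> s \<in> S \<Longrightarrow> len w < k \<Longrightarrow> P (T w \<otimes> em s)"
    and add: "\<And>x y. x \<in> carrier H \<Longrightarrow> y \<in> carrier H \<Longrightarrow> P x \<Longrightarrow> P y \<Longrightarrow> P (x \<oplus> y)"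
  shows "P h"
proof -
  have hc: "h \<in> carrier H" using h by (simp add: Fil_def)
  have "comb (coeff h) \<in> {x \<in> carrier H. P x}"
    unfolding comb_def
  proof (rule finsum_closed_under[OF finite_weyl])
    fix w assume w: "w \<in> W"
    show "T w \<otimes> em (coeff h w) \<in> {x \<in> carrier H. P x}"
    proof (cases "coeff h w = 0")
      case True then show ?thesis using assms(2) w by (simp add: T_closed)
    next
      case False
      then have "len w < k" using h w by (simp add: Fil_def)
      then show ?thesis using T[OF w coeff_S[OF hc]] w coeff_S[OF hc, of w] by (simp add: T_closed)
    qed
  qed (use assms in auto)
  then show ?thesis by (simp add: comb_coeff[OF hc])
qed

lemma exists_len_bound: "\<exists>K. \<forall>w\<in>W. len w < K"
proof -
  have "len w < Suc (Max (len ` W))" if "w \<in> W" for w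
    using that finite_weyl by (simp add: less_Suc_eq_le)
  then show ?thesis by blast
qed

lemma hecke_induct [consumes 1, case_names zero T_em add]:
  assumes h: "h \<in> carrier H" and "P \<zero>"
    and "\<And>w s. w \<in> W \<Longrightarrow> s \<in> S \<Longrightarrow> P (T w \<otimes> em s)"
    and "\<And>x y. x \<in> carrier H \<Longrightarrow> y \<in> carrier H \<Longrightarrow> P x \<Longrightarrow> P y \<Longrightarrow> P (x \<oplus> y)"
  shows "P h"
proof -
  obtain K where "\<forall>w\<in>W. len w < K" using exists_len_bound by blast
  then have "h \<in> Fil K" using h by (simp add: Fil_def)
  then show ?thesis by (rule Fil_induct) (use assms in auto)
qed

subsection \<open>Multiplication rules\<close>

definition quad_param :: "'a \<Rightarrow> 'a \<Rightarrow>\<^sub>0 laurent" where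
  "quad_param \<alpha> = single 0 (v_power (2 * int (L \<alpha>)))"

lemma quad_param_S: "quad_param \<alpha> \<in> S"
  unfolding quad_param_def by (intro S_single lattice_zero)

lemma scalar_em_central: "h \<in> carrier H \<Longrightarrow> em (single 0 a) \<otimes> h = h \<otimes> em (single 0 a)"
  by (simp add: em_scalar scalar_central)

lemma T_up:
  "\<alpha> \<in> \<Delta> \<Longrightarrow> w \<in> W \<Longrightarrow> len (reflection \<alpha> \<circ> w) = Suc (len w) \<Longrightarrow>
    T (reflection \<alpha>) \<otimes> T w = T (reflection \<alpha> \<circ> w)"
  by (rule T_mult) (auto simp: simple_in_weyl len_simple)

lemma T_square:
  assumes "\<alpha> \<in> \<Delta>"
  shows "T (reflection \<alpha>) \<otimes> T (reflection \<alpha>) = em (quad_param \<alpha>) \<oplus> T (reflection \<alpha>) \<otimes> em (quad_param \<alpha> - 1)"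
proof -
  let ?t = "T (reflection \<alpha>)" and ?q = "em (quad_param \<alpha>)"
  have t: "?t \<in> carrier H" using T_closed simple_in_weyl assms by blast
  have q: "?q \<in> carrier H" using quad_param_S by blast
  have "(?t \<oplus> \<one>) \<otimes> (?t \<ominus> ?q) = \<zero>"
    using T_quadratic[OF assms] by (simp add: quad_param_def em_scalar)
  then have "(?t \<otimes> ?t \<oplus> ?t) \<ominus> (?t \<otimes> ?q \<oplus> ?q) = \<zero>"
    using t q by (simp add: a_minus_def l_distr r_distr r_minus minus_add a_ac)
  then have e: "?t \<otimes> ?t \<oplus> ?t = ?t \<otimes> ?q \<oplus> ?q" using t q by (simp add: r_right_minus_eq)
  have "?t \<otimes> ?t = (?t \<otimes> ?t \<oplus> ?t) \<ominus> ?t"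
    using t by (simp add: a_minus_def a_assoc r_neg)
  also have "\<dots> = ?q \<oplus> (?t \<otimes> ?q \<ominus> ?t)"
    unfolding e using t q by (simp add: a_minus_def a_ac)
  also have "?t \<otimes> ?q \<ominus> ?t = ?t \<otimes> em (quad_param \<alpha> - 1)"
    using t q by (simp add: em_diff quad_param_S S_one a_minus_def r_distr r_minus)
  finally show ?thesis .
qed

text \<open>Write \<open>T w\<close> as the product of the reflection's generator with a shorter
  element and apply the quadratic relation. The parameters are central and are moved to the right,
  where \<open>coeff\<close> reads them off.\<close>

lemma T_down:
  assumes "\<alpha> \<in> \<Delta>" "w \<in> W" "len w = Suc (len (reflection \<alpha> \<circ> w))"
  shows "T (reflection \<alpha>) \<otimes> T w = T (reflection \<alpha> \<circ> w) \<otimes> em (quad_param \<alpha>) \<oplus> T w \<otimes> em (quad_param \<alpha> - 1)"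
proof -
  let ?t = "T (reflection \<alpha>)" and ?u = "reflection \<alpha> \<circ> w"
  have uW: "?u \<in> W" using assms weyl_comp simple_in_weyl by blast
  have su: "reflection \<alpha> \<circ> ?u = w" by (simp only: comp_assoc[symmetric] reflection_comp_self id_comp)
  have t: "?t \<in> carrier H" "T ?u \<in> carrier H" "T w \<in> carrier H"
    using T_closed simple_in_weyl assms uW by blast+
  have e: "em (quad_param \<alpha>) \<in> carrier H" "em (quad_param \<alpha> - 1) \<in> carrier H" using quad_param_S S_diff S_one by blast+
  have tu: "?t \<otimes> T ?u = T w" using T_up[OF assms(1) uW] su assms(3) by simp
  have sc: "quad_param \<alpha> - 1 = single 0 (v_power (2 * int (L \<alpha>)) - 1)" by (simp add: quad_param_def single_diff)
  have "?t \<otimes> T w = (?t \<otimes> ?t) \<otimes> T ?u" using t by (simp add: tu[symmetric] m_assoc del: comp_apply)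
  also have "\<dots> = em (quad_param \<alpha>) \<otimes> T ?u \<oplus> ?t \<otimes> (em (quad_param \<alpha> - 1) \<otimes> T ?u)"
    using t e unfolding T_square[OF assms(1)] by (simp add: l_distr m_assoc)
  also have "em (quad_param \<alpha>) \<otimes> T ?u = T ?u \<otimes> em (quad_param \<alpha>)"
    unfolding quad_param_def by (rule scalar_em_central[OF t(2)])
  also have "em (quad_param \<alpha> - 1) \<otimes> T ?u = T ?u \<otimes> em (quad_param \<alpha> - 1)"
    unfolding sc by (rule scalar_em_central[OF t(2)])
  also have "?t \<otimes> (T ?u \<otimes> em (quad_param \<alpha> - 1)) = T w \<otimes> em (quad_param \<alpha> - 1)"
    using t e by (simp add: tu flip: m_assoc)
  finally show ?thesis .
qed

text \<open>The Bernstein relation extended from monomials to \<open>S\<close>. Of the remainder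
  only two cases of vanishing are kept: invariant elements, which yields the centre, and zero
  parameter, which yields the smash product relation of the example.\<close>

lemma bernstein_em:
  assumes "\<alpha> \<in> \<Delta>" "f \<in> S"
  shows "\<exists>g\<in>S. em f \<otimes> T (reflection \<alpha>) = T (reflection \<alpha>) \<otimes> em (act (reflection \<alpha>) f) \<oplus> em g \<and>
    (act (reflection \<alpha>) f = f \<or> L \<alpha> = 0 \<longrightarrow> g = 0)"
proof -
  let ?s = "reflection \<alpha>" and ?t = "T (reflection \<alpha>)"
  have sW: "?s \<in> W" using simple_in_weyl assms by blast
  note b = weyl_bij[OF sW]
  have t: "?t \<in> carrier H" using T_closed sW by blast
  have "\<exists>g\<in>S. em f \<otimes> ?t = ?t \<otimes> em (act ?s f) \<oplus> em g \<and>
      g * (1 - E (- \<alpha>)) = (quad_param \<alpha> - 1) * (f - act ?s f)"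
    using assms(2)
  proof (induction f rule: S_induct)
    case zero
    show ?case by (rule bexI[of _ 0]) (use t b S_zero in auto)
  next
    case (single x a)
    obtain q where q: "keys q \<subseteq> X" "q * (1 - E (- \<alpha>)) = E x - E (?s x)"
      "\<theta> x \<otimes> ?t \<ominus> ?t \<otimes> \<theta> (?s x) = \<iota> (v_power (2 * int (L \<alpha>)) - 1) \<otimes> em q"
      using bernstein[OF assms(1) single] by blast
    have qS: "q \<in> S" using q by (simp add: S_def)
    have sx: "?s x \<in> X" using weyl_lattice[OF sW single] .
    have th: "\<theta> x \<in> carrier H" "\<theta> (?s x) \<in> carrier H" using theta_closed single sx by blast+
    have a: "\<iota> a \<in> carrier H" by (rule scalar_closed)
    have qd: "quad_param \<alpha> - 1 = single 0 (v_power (2 * int (L \<alpha>)) - 1)" by (simp add: quad_param_def single_diff)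
    have c: "\<iota> (v_power (2 * int (L \<alpha>)) - 1) \<otimes> em q = em ((quad_param \<alpha> - 1) * q)"
      unfolding qd by (simp add: em_mult S_single lattice_zero qS em_scalar)
    have cS: "(quad_param \<alpha> - 1) * q \<in> S" by (intro S_mult S_diff quad_param_S S_one qS)
    define g where "g = single 0 a * ((quad_param \<alpha> - 1) * q)"
    have gS: "g \<in> S" unfolding g_def by (intro S_mult[OF S_single[OF lattice_zero]] cS)
    have "\<theta> x \<otimes> ?t = ?t \<otimes> \<theta> (?s x) \<oplus> em ((quad_param \<alpha> - 1) * q)"
    proof -
      have "\<theta> x \<otimes> ?t = ?t \<otimes> \<theta> (?s x) \<oplus> (\<theta> x \<otimes> ?t \<ominus> ?t \<otimes> \<theta> (?s x))"
        using th t by (simp add: a_minus_def a_comm[of "\<theta> x \<otimes> ?t"] flip: a_assoc) (simp add: r_neg)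
      then show ?thesis unfolding q(3) c .
    qed
    then have "em (single x a) \<otimes> ?t = \<iota> a \<otimes> (?t \<otimes> \<theta> (?s x) \<oplus> em ((quad_param \<alpha> - 1) * q))"
      using th t a by (simp add: em_single single m_assoc)
    also have "\<dots> = \<iota> a \<otimes> ?t \<otimes> \<theta> (?s x) \<oplus> \<iota> a \<otimes> em ((quad_param \<alpha> - 1) * q)"
      using th t a em_closed[OF cS] by (simp add: r_distr m_assoc)
    also have "\<iota> a \<otimes> ?t = ?t \<otimes> \<iota> a" using scalar_central t by blast
    also have "?t \<otimes> \<iota> a \<otimes> \<theta> (?s x) = ?t \<otimes> em (act ?s (single x a))"
      using th t a by (simp add: act_single[OF b] em_single sx m_assoc)
    also have "\<iota> a \<otimes> em ((quad_param \<alpha> - 1) * q) = em g"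
      unfolding g_def em_mult[OF S_single[OF lattice_zero] cS] em_scalar ..
    finally have eq: "em (single x a) \<otimes> ?t = ?t \<otimes> em (act ?s (single x a)) \<oplus> em g" .
    have "g * (1 - E (- \<alpha>)) = single 0 a * (quad_param \<alpha> - 1) * (q * (1 - E (- \<alpha>)))"
      by (simp add: g_def mult.assoc)
    also have "\<dots> = (quad_param \<alpha> - 1) * (single 0 a * (E x - E (?s x)))"
      unfolding q(2) by (simp only: mult.assoc mult.left_commute)
    also have "single 0 a * (E x - E (?s x)) = single x a - act ?s (single x a)"
      by (simp add: right_diff_distrib mult_single act_single[OF b])
    finally show ?case using eq gS by blast
  next
    case (add f h)
    then obtain g k where g: "g \<in> S" "em f \<otimes> ?t = ?t \<otimes> em (act ?s f) \<oplus> em g"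
        "g * (1 - E (- \<alpha>)) = (quad_param \<alpha> - 1) * (f - act ?s f)"
      and k: "k \<in> S" "em h \<otimes> ?t = ?t \<otimes> em (act ?s h) \<oplus> em k"
        "k * (1 - E (- \<alpha>)) = (quad_param \<alpha> - 1) * (h - act ?s h)" by blast
    have c: "em g \<in> carrier H" "em k \<in> carrier H" "em f \<in> carrier H" "em h \<in> carrier H"
      "em (act ?s f) \<in> carrier H" "em (act ?s h) \<in> carrier H"
      using g k add S_act[OF sW] by auto
    have "em (f + h) \<otimes> ?t = (?t \<otimes> em (act ?s f) \<oplus> em g) \<oplus> (?t \<otimes> em (act ?s h) \<oplus> em k)"
      using add c t g(2) k(2) by (simp add: em_add l_distr)
    also have "\<dots> = ?t \<otimes> em (act ?s (f + h)) \<oplus> em (g + k)"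
      using c t add g(1) k(1) by (simp add: act_add[OF b] em_add S_act[OF sW] r_distr a_ac)
    finally have "em (f + h) \<otimes> ?t = ?t \<otimes> em (act ?s (f + h)) \<oplus> em (g + k)" .
    moreover have "(g + k) * (1 - E (- \<alpha>)) = (quad_param \<alpha> - 1) * (f + h - act ?s (f + h))"
      unfolding act_add[OF b] distrib_right g(3) k(3) by (simp add: algebra_simps)
    ultimately show ?case using S_add[OF g(1) k(1)] by blast
  qed
  then obtain g where g: "g \<in> S" "em f \<otimes> ?t = ?t \<otimes> em (act ?s f) \<oplus> em g"
    "g * (1 - E (- \<alpha>)) = (quad_param \<alpha> - 1) * (f - act ?s f)" by blast
  have "g = 0" if "act ?s f = f \<or> L \<alpha> = 0"
  proof -
    have "quad_param \<alpha> = 1" if "L \<alpha> = 0" using that by (simp add: quad_param_def v_power_def)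
    then have "(quad_param \<alpha> - 1) * (f - act ?s f) = 0" using \<open>act ?s f = f \<or> L \<alpha> = 0\<close> by auto
    then have "g * (1 - E (- \<alpha>)) = 0" using g(3) by (rule trans[rotated])
    then have "(1 - E (- \<alpha>)) * g = 0" by (simp only: mult.commute)
    then show ?thesis by (rule one_minus_E_pos_nonzero_divisor[OF simple_pos[OF assms(1)]])
  qed
  then show ?thesis using g(1,2) by (intro bexI[of _ g] conjI impI)
qed

lemma Fil_T_left:
  assumes "\<alpha> \<in> \<Delta>" "h \<in> Fil k"
  shows "T (reflection \<alpha>) \<otimes> h \<in> Fil (Suc k)"
  using assms(2)
proof (induction h rule: Fil_induct)
  case zero
  then show ?case using T_closed[OF simple_in_weyl[OF assms(1)]] by (simp add: Fil_zero)
next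
  case (T_em w s)
  let ?t = "T (reflection \<alpha>)"
  have uW: "reflection \<alpha> \<circ> w \<in> W" using assms T_em weyl_comp simple_in_weyl by blast
  have t: "?t \<in> carrier H" "T w \<in> carrier H" "T (reflection \<alpha> \<circ> w) \<in> carrier H" "em s \<in> carrier H"
    using T_closed simple_in_weyl assms uW T_em by blast+
  have e: "em (quad_param \<alpha>) \<in> carrier H" "em (quad_param \<alpha> - 1) \<in> carrier H" using quad_param_S S_diff S_one by blast+
  consider "len (reflection \<alpha> \<circ> w) = Suc (len w)" | "len w = Suc (len (reflection \<alpha> \<circ> w))"
    using len_left[OF T_em(1) assms(1)] by blast
  then show ?case
  proof cases
    case 1
    then have "?t \<otimes> (T w \<otimes> em s) = T (reflection \<alpha> \<circ> w) \<otimes> em s"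
      using t T_up[OF assms(1) T_em(1) 1] by (simp flip: m_assoc)
    then show ?thesis using Fil_T_em[OF uW T_em(2), of "Suc k"] 1 T_em(3) by simp
  next
    case 2
    have "?t \<otimes> (T w \<otimes> em s) = T (reflection \<alpha> \<circ> w) \<otimes> em (quad_param \<alpha> * s) \<oplus> T w \<otimes> em ((quad_param \<alpha> - 1) * s)"
      using t e T_em(2) T_down[OF assms(1) T_em(1) 2]
      by (simp add: em_mult quad_param_S S_diff S_one l_distr m_assoc flip: m_assoc[of ?t "T w"])
    moreover have "T (reflection \<alpha> \<circ> w) \<otimes> em (quad_param \<alpha> * s) \<in> Fil (Suc k)"
      using 2 T_em by (intro Fil_T_em[OF uW] S_mult quad_param_S) auto
    moreover have "T w \<otimes> em ((quad_param \<alpha> - 1) * s) \<in> Fil (Suc k)"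
      using T_em by (intro Fil_T_em S_mult S_diff quad_param_S S_one) auto
    ultimately show ?thesis using Fil_add by simp
  qed
next
  case (add x y)
  then show ?case using T_closed[OF simple_in_weyl[OF assms(1)]] by (simp add: r_distr Fil_add)
qed

text \<open>Split off a simple reflection on the left. The Bernstein remainder only has to pass the
  shorter element \<open>T u\<close>, and the generator in front raises the filtration degree of the
  inductive error by one.\<close>

lemma em_T:
  assumes "w \<in> W" "f \<in> S"
  shows "\<exists>r\<in>Fil (len w). em f \<otimes> T w = T w \<otimes> em (act (winv w) f) \<oplus> r"
  using assms
proof (induction "len w" arbitrary: w f)
  case 0
  then have "w = id" using len_zero by simp
  then have "em f \<otimes> T w = T w \<otimes> em (act (winv w) f) \<oplus> \<zero>" using 0 by (simp add: T_id)
  then show ?case using Fil_zero by blast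
next
  case (Suc k)
  obtain \<alpha> u where u: "\<alpha> \<in> \<Delta>" "u \<in> W" "w = reflection \<alpha> \<circ> u" "len u = k"
    using len_Suc_decomp[OF Suc(3)] Suc(2) by metis
  let ?s = "reflection \<alpha>"
  have sW: "?s \<in> W" using simple_in_weyl u by blast
  obtain g where g: "g \<in> S" "em f \<otimes> T ?s = T ?s \<otimes> em (act ?s f) \<oplus> em g"
    using bernstein_em[OF u(1) Suc(4)] by blast
  have fs: "act ?s f \<in> S" using S_act[OF sW Suc(4)] .
  obtain r1 where r1: "r1 \<in> Fil k" "em (act ?s f) \<otimes> T u = T u \<otimes> em (act (winv u) (act ?s f)) \<oplus> r1"
    using Suc(1)[of u, OF _ u(2) fs] u(4) by blast
  obtain r2 where r2: "r2 \<in> Fil k" "em g \<otimes> T u = T u \<otimes> em (act (winv u) g) \<oplus> r2"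
    using Suc(1)[of u, OF _ u(2) g(1)] u(4) by blast
  have Tw: "T ?s \<otimes> T u = T w" using T_up[OF u(1,2)] u Suc(2) by simp
  have iW: "winv u \<in> W" using weyl_inv[OF u(2)] .
  have ws: "winv ?s = ?s" using inv_unique_comp reflection_comp_self by blast
  have "winv w = winv u \<circ> ?s"
    unfolding u(3) using o_inv_distrib[OF weyl_bij[OF sW] weyl_bij[OF u(2)]] ws by simp
  then have a: "act (winv u) (act ?s f) = act (winv w) f"
    using act_comp[OF weyl_bij[OF iW] weyl_bij[OF sW], of f] by simp
  have c: "T ?s \<in> carrier H" "T u \<in> carrier H" "em (act (winv w) f) \<in> carrier H" "em g \<in> carrier H"
    "em (act ?s f) \<in> carrier H" "em f \<in> carrier H" "r1 \<in> carrier H" "r2 \<in> carrier H"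
    "em (act (winv u) g) \<in> carrier H"
    using T_closed sW u(2) g(1) fs Suc(3,4) S_act[OF weyl_inv[OF Suc(3)]] S_act[OF iW] r1(1) r2(1) Fil_closed
    by auto
  have "em f \<otimes> T w = (em f \<otimes> T ?s) \<otimes> T u" using c by (simp add: Tw m_assoc)
  also have "\<dots> = T ?s \<otimes> (em (act ?s f) \<otimes> T u) \<oplus> em g \<otimes> T u"
    unfolding g(2) using c by (simp add: l_distr m_assoc)
  also have "\<dots> = T w \<otimes> em (act (winv w) f) \<oplus> (T ?s \<otimes> r1 \<oplus> (T u \<otimes> em (act (winv u) g) \<oplus> r2))"
    unfolding r1(2) r2(2) a using c by (simp add: r_distr a_assoc flip: Tw m_assoc)
  finally have "em f \<otimes> T w =
      T w \<otimes> em (act (winv w) f) \<oplus> (T ?s \<otimes> r1 \<oplus> (T u \<otimes> em (act (winv u) g) \<oplus> r2))" .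
  moreover have "T ?s \<otimes> r1 \<oplus> (T u \<otimes> em (act (winv u) g) \<oplus> r2) \<in> Fil (len w)"
    unfolding Suc(2)[symmetric] using u(4) r2(1)
    by (intro Fil_add Fil_T_left[OF u(1) r1(1)] Fil_T_em[OF u(2) S_act[OF iW g(1)]]) (auto intro: Fil_mono)
  ultimately show ?case by blast
qed

text \<open>At an element of maximal possible length no correction terms arrive: those from other
  elements of that length are of smaller length.\<close>

lemma coeff_em_left:
  assumes "h \<in> Fil (Suc (len w))" "w \<in> W" "f \<in> S"
  shows "coeff (em f \<otimes> h) w = act (winv w) f * coeff h w"
  using assms(1)
proof (induction h rule: Fil_induct)
  case (T_em u s)
  obtain r where r: "r \<in> Fil (len u)" "em f \<otimes> T u = T u \<otimes> em (act (winv u) f) \<oplus> r"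
    using em_T[OF T_em(1) assms(3)] by blast
  have c: "T u \<in> carrier H" "em s \<in> carrier H" "em f \<in> carrier H" "r \<in> carrier H" "em (act (winv u) f) \<in> carrier H"
    using T_em assms T_closed Fil_closed[OF r(1)] S_act[OF weyl_inv[OF T_em(1)] assms(3)] by auto
  have aS: "act (winv u) f * s \<in> S" using S_mult[OF S_act[OF weyl_inv[OF T_em(1)] assms(3)] T_em(2)] .
  have "em f \<otimes> (T u \<otimes> em s) = (em f \<otimes> T u) \<otimes> em s" using c by (simp add: m_assoc)
  also have "\<dots> = T u \<otimes> em (act (winv u) f * s) \<oplus> r \<otimes> em s"
    unfolding r(2) using c S_act[OF weyl_inv[OF T_em(1)] assms(3)] T_em(2) by (simp add: l_distr m_assoc em_mult)
  finally have "coeff (em f \<otimes> (T u \<otimes> em s)) w = (if w = u then act (winv u) f * s else 0) + coeff (r \<otimes> em s) w"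
    using c aS T_em(1) by (simp add: coeff_add coeff_T_em)
  moreover have "coeff (r \<otimes> em s) w = 0"
    using Fil_coeff_zero[OF Fil_mult_em[OF r(1) T_em(2)] assms(2)] T_em(3) by simp
  ultimately show ?case using T_em by (simp add: coeff_T_em)
qed (use assms in \<open>simp_all add: coeff_zero coeff_add r_distr distrib_left\<close>)

subsection \<open>The centre\<close>

text \<open>For an invariant the Bernstein remainder vanishes, so it commutes with the generators
  and, along reduced words, with every \<open>T w\<close>.\<close>

lemma em_Z_central:
  assumes "f \<in> Z" "h \<in> carrier H"
  shows "em f \<otimes> h = h \<otimes> em f"
proof -
  note fS = Z_S[OF assms(1)]
  have s: "em f \<otimes> T (reflection \<alpha>) = T (reflection \<alpha>) \<otimes> em f" if a: "\<alpha> \<in> \<Delta>" for \<alpha>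
    using bernstein_em[OF a fS] Z_act[OF assms(1) simple_in_weyl[OF a]] T_closed[OF simple_in_weyl[OF a]] fS
    by auto
  have T: "em f \<otimes> T w = T w \<otimes> em f" if "w \<in> W" for w
    using that
  proof (induction "len w" arbitrary: w)
    case 0
    then have "w = id" using len_zero by simp
    moreover have "em f \<otimes> T id = T id \<otimes> em f" using fS by (simp only: T_id em_closed l_one r_one)
    ultimately show ?case by (simp only:)
  next
    case (Suc k)
    obtain \<alpha> u where u: "\<alpha> \<in> \<Delta>" "u \<in> W" "w = reflection \<alpha> \<circ> u" "len u = k"
      using len_Suc_decomp[OF Suc(3)] Suc(2) by metis
    let ?t = "T (reflection \<alpha>)"
    have Tw: "T w = ?t \<otimes> T u" using T_up[OF u(1,2)] u Suc(2) by simp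
    have c: "?t \<in> carrier H" "T u \<in> carrier H" "em f \<in> carrier H"
      using T_closed simple_in_weyl u fS by auto
    have IH: "em f \<otimes> T u = T u \<otimes> em f" using Suc(1)[of u] u by simp
    have "em f \<otimes> (?t \<otimes> T u) = (?t \<otimes> em f) \<otimes> T u" using c s[OF u(1)] by (simp flip: m_assoc)
    also have "\<dots> = ?t \<otimes> T u \<otimes> em f" using c IH by (simp add: m_assoc)
    finally show ?case unfolding Tw .
  qed
  show ?thesis
    using assms(2)
  proof (induction h rule: hecke_induct)
    case (T_em w s)
    have c: "T w \<in> carrier H" "em s \<in> carrier H" "em f \<in> carrier H" using T_em T_closed fS by auto
    have "em f \<otimes> (T w \<otimes> em s) = T w \<otimes> (em f \<otimes> em s)" using c T[OF T_em(1)] by (simp add: m_assoc flip: m_assoc[of "em f"])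
    also have "\<dots> = T w \<otimes> em s \<otimes> em f" using c em_commute[OF fS T_em(2)] by (simp add: m_assoc)
    finally show ?case .
  next
    case (add x y)
    then show ?case using fS by (simp add: l_distr r_distr)
  qed (use fS in simp)
qed

lemma weyl_moves_lattice:
  assumes "w \<in> W" "w \<noteq> id"
  shows "\<exists>x\<in>X. winv w x \<noteq> x"
proof (rule ccontr)
  assume "\<not> ?thesis"
  then have "winv w \<alpha> = \<alpha>" if "\<alpha> \<in> \<Delta>" for \<alpha> using root_lattice simple_root that by blast
  then have "winv w = id" using weyl_positive_id[OF weyl_inv[OF assms(1)]] simple_pos by metis
  then show False using assms weyl_bij by (metis inv_id inv_inv_eq)
qed

text \<open>If \<open>u\<close> is a longest element in the support and not the identity, it moves
  some lattice point \<open>x\<close>. Comparing the coefficients at \<open>u\<close> of the two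
  products of \<open>z\<close> with \<open>em (E x)\<close> gives a nonzero divisor that kills the
  coefficient of \<open>z\<close>. So \<open>z\<close> lies in the image of \<open>S\<close>, and
  comparing coefficients at simple reflections shows invariance.\<close>

lemma central_is_em:
  assumes "z \<in> ring_centre H"
  shows "\<exists>f\<in>Z. z = em f"
proof -
  have z: "z \<in> carrier H" and comm: "\<And>h. h \<in> carrier H \<Longrightarrow> z \<otimes> h = h \<otimes> z"
    using assms by (auto simp: ring_centre_def)
  have id: "coeff z w = 0" if w: "w \<in> W" "w \<noteq> id" for w
  proof (rule ccontr)
    assume "coeff z w \<noteq> 0"
    then have "{w \<in> W. coeff z w \<noteq> 0} \<noteq> {}" "finite {w \<in> W. coeff z w \<noteq> 0}" using w finite_weyl by auto
    then obtain u where u: "u \<in> W" "coeff z u \<noteq> 0"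
      and max: "\<And>w'. w' \<in> W \<Longrightarrow> coeff z w' \<noteq> 0 \<Longrightarrow> len w' \<le> len u"
      using finite_has_max[of "{w \<in> W. coeff z w \<noteq> 0}" "\<lambda>w. real (len w)"] by auto
    have "u \<noteq> id"
      using max[OF w(1) \<open>coeff z w \<noteq> 0\<close>] len_zero[OF w(1)] w(2) by auto
    then obtain x where x: "x \<in> X" "winv u x \<noteq> x" using weyl_moves_lattice u by blast
    have zF: "z \<in> Fil (Suc (len u))" using z max by (auto simp: Fil_def less_Suc_eq_le)
    have "coeff (em (E x) \<otimes> z) u = act (winv u) (E x) * coeff z u"
      by (rule coeff_em_left[OF zF u(1) S_single[OF x(1)]])
    moreover have "em (E x) \<otimes> z = z \<otimes> em (E x)" using comm[of "em (E x)"] S_single[OF x(1)] by simp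
    ultimately have "act (winv u) (E x) * coeff z u = coeff z u * E x"
      using coeff_mult_em[OF z S_single[OF x(1)]] by simp
    then have "E (winv u x) * coeff z u = E x * coeff z u"
      using weyl_bij[OF weyl_inv[OF u(1)]] by (simp add: act_single mult.commute)
    then have "(E x - E (winv u x)) * coeff z u = 0" unfolding left_diff_distrib by simp
    then show False using E_diff_nonzero_divisor x(2) u(2) by metis
  qed
  define f where "f = coeff z id"
  have fS: "f \<in> S" unfolding f_def using coeff_S[OF z] .
  have zf: "z = em f"
  proof (rule coeff_eqI[OF z em_closed[OF fS]])
    fix w assume "w \<in> W"
    then show "coeff z w = coeff (em f) w"
      unfolding coeff_em[OF fS] using id by (cases "w = id") (simp_all add: f_def)
  qed
  have "f \<in> Z"
  proof (rule Z_simple[OF fS])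
    fix \<alpha> assume a: "\<alpha> \<in> \<Delta>"
    let ?s = "reflection \<alpha>"
    have sW: "?s \<in> W" using simple_in_weyl[OF a] .
    have "?s \<noteq> id" using len_simple[OF a] by auto
    obtain g where g: "g \<in> S" "em f \<otimes> T ?s = T ?s \<otimes> em (act ?s f) \<oplus> em g"
      using bernstein_em[OF a fS] by blast
    have t: "T ?s \<in> carrier H" using T_closed sW by blast
    have "coeff (em f \<otimes> T ?s) ?s = act ?s f"
      unfolding g(2) using t g(1) S_act[OF sW fS] \<open>?s \<noteq> id\<close> sW by (simp add: coeff_add coeff_T_em coeff_em)
    moreover have "em f \<otimes> T ?s = T ?s \<otimes> em f" using comm[OF t] zf by simp
    then have "coeff (em f \<otimes> T ?s) ?s = f" using sW fS by (simp add: coeff_T_em)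
    ultimately show "act ?s f = f" by simp
  qed
  then show ?thesis using zf by blast
qed

lemma centre_eq: "ring_centre H = em ` Z"
proof
  show "ring_centre H \<subseteq> em ` Z" using central_is_em by blast
  show "em ` Z \<subseteq> ring_centre H" using em_Z_central Z_S by (auto simp: ring_centre_def)
qed

text \<open>\<open>theta_invariants\<close> tests invariance on lattice exponents only; outside the
  lattice both coefficients are 0, as W preserves it.\<close>

lemma theta_invariants_eq: "theta_invariants \<Phi> H \<iota> \<theta> = em ` Z"
proof -
  have "act w q = q \<longleftrightarrow> (\<forall>x\<in>X. lookup q (w x) = lookup q x)" if "w \<in> W" "q \<in> S" for w q
  proof
    assume "act w q = q"
    then show "\<forall>x\<in>X. lookup q (w x) = lookup q x"
      using lookup_act'[OF weyl_bij[OF that(1)], of q] by metis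
  next
    assume r: "\<forall>x\<in>X. lookup q (w x) = lookup q x"
    show "act w q = q"
    proof (rule poly_mapping_eqI)
      fix x
      have w: "w (winv w x) = x" using weyl_bij[OF that(1)] by (simp add: bij_is_surj surj_f_inv_f)
      show "lookup (act w q) x = lookup q x"
      proof (cases "winv w x \<in> X")
        case True
        then show ?thesis using r w weyl_bij[OF that(1)] by (metis lookup_act)
      next
        case False
        then have "x \<notin> X" using weyl_lattice[OF weyl_inv[OF that(1)]] by blast
        then have "lookup q x = 0" "lookup q (winv w x) = 0"
          using False \<open>q \<in> S\<close> by (metis (mono_tags) S_def in_keys_iff mem_Collect_eq subsetD)+
        then show ?thesis using weyl_bij[OF that(1)] by (simp add: lookup_act)
      qed
    qed
  qed
  then have "Z = {q. keys q \<subseteq> X \<and> (\<forall>w\<in>W. \<forall>x\<in>X. lookup q (w x) = lookup q x)}"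
    unfolding Z_def by (auto simp: S_def)
  then show ?thesis by (simp add: theta_invariants_def)
qed

end

section \<open>The Frobenius form\<close>

context root_base begin

lemma S_const: "single 0 a \<in> S"
  by (intro S_single lattice_zero)

lemma act_const: "w \<in> W \<Longrightarrow> act w (single 0 a) = single 0 a"
  using weyl_bij[of w] weyl_linear[of w] by (simp add: act_single linear_0)

lemma Z_const: "single 0 a \<in> Z"
  by (simp add: Z_def S_const act_const)

text \<open>Powers of v are the units on the diagonal of the pairing. As scalars they are fixed by
  W, and their inverses are again in \<open>Z\<close>.\<close>

definition unit_const :: "('a \<Rightarrow>\<^sub>0 laurent) \<Rightarrow> bool" where
  "unit_const u \<longleftrightarrow> (\<exists>k. u = single 0 (v_power k))"

lemma unit_const_one: "unit_const 1"
  unfolding unit_const_def v_power_def by (intro exI[of _ 0]) simp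

lemma unit_const_mult: "unit_const u \<Longrightarrow> unit_const v \<Longrightarrow> unit_const (u * v)"
  unfolding unit_const_def v_power_def by (auto simp: mult_single)

lemma unit_const_Z: "unit_const u \<Longrightarrow> u \<in> Z"
  using Z_const by (auto simp: unit_const_def)

lemma unit_const_inverse: "unit_const u \<Longrightarrow> \<exists>v\<in>Z. u * v = 1"
proof -
  assume "unit_const u"
  then obtain k where "u = single 0 (v_power k)" by (auto simp: unit_const_def)
  then have "u * single 0 (v_power (- k)) = 1" by (simp add: mult_single v_power_def)
  then show ?thesis using Z_const by blast
qed

text \<open>The coordinates of \<open>g\<close> with respect to \<open>e\<close> are themselves
  values of the form.\<close>

lemma alt_quot_nondegenerate:
  assumes "g \<in> S" "\<And>f. f \<in> S \<Longrightarrow> alt_quot (f * g) = 0"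
  shows "g = 0"
proof -
  obtain n and e b :: "nat \<Rightarrow> 'a \<Rightarrow>\<^sub>0 laurent"
    where d: "\<forall>i<n. e i \<in> S" "\<forall>i<n. b i \<in> S"
      "\<forall>i<n. \<forall>j<n. alt_quot (e i * b j) = (if i = j then 1 else 0)"
      "\<forall>f\<in>S. f = (\<Sum>i<n. alt_quot (f * b i) * e i)"
    by (rule exE[OF dual_bases], elim exE conjE, rule that)
  have bS: "\<And>i. i < n \<Longrightarrow> b i \<in> S" using d(2) by blast
  have expand: "f = (\<Sum>i<n. alt_quot (f * b i) * e i)" if "f \<in> S" for f
    by (rule bspec[OF d(4) that])
  have "alt_quot (g * b i) = 0" if "i < n" for i
    using assms(2)[OF bS[OF that]] by (simp add: mult.commute)
  then have "(\<Sum>i<n. alt_quot (g * b i) * e i) = 0" by (intro sum.neutral) auto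
  then have "g = 0" using expand[OF assms(1)] by (rule trans[rotated])
  then show ?thesis by simp
qed

end

context hecke begin

definition tau :: "'h \<Rightarrow> 'a \<Rightarrow>\<^sub>0 laurent" where "tau h = coeff h id"

lemma tau_zero: "tau \<zero> = 0"
  and tau_add: "h \<in> carrier H \<Longrightarrow> k \<in> carrier H \<Longrightarrow> tau (h \<oplus> k) = tau h + tau k"
  and tau_mult_em: "h \<in> carrier H \<Longrightarrow> s \<in> S \<Longrightarrow> tau (h \<otimes> em s) = tau h * s"
  and tau_S: "h \<in> carrier H \<Longrightarrow> tau h \<in> S"
  by (simp_all add: tau_def coeff_zero coeff_add coeff_mult_em coeff_S)

lemma tau_T: "w \<in> W \<Longrightarrow> tau (T w) = (if w = id then 1 else 0)"
  by (auto simp: tau_def coeff_T)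

text \<open>Up to powers of v, the T_w and the T_u with \<open>u\<close> inverse to \<open>w\<close>
  are dual to each other, as in the finite Hecke algebra. The last letter of \<open>w\<close> is
  moved over to \<open>u\<close>; if this shortens \<open>u\<close>, the quadratic relation produces
  a second term, which contributes 0.\<close>

lemma tau_T_T:
  assumes "w \<in> W" "u \<in> W"
  shows "(u \<noteq> winv w \<longrightarrow> tau (T w \<otimes> T u) = 0) \<and> (u = winv w \<longrightarrow> unit_const (tau (T w \<otimes> T u)))"
  using assms
proof (induction "len w" arbitrary: w u)
  case 0
  then have w: "w = id" using len_zero by simp
  then have "tau (T w \<otimes> T u) = (if u = id then 1 else 0)"
    using T_closed[OF 0(3)] tau_T[OF 0(3)] T_id by simp
  moreover have "winv w = id" using w by simp
  ultimately show ?case using unit_const_one by metis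
next
  case (Suc k)
  obtain \<alpha> v where v: "\<alpha> \<in> \<Delta>" "v \<in> W" "w = v \<circ> reflection \<alpha>" "len v = k"
    using len_Suc_decomp_right[OF Suc(3)] Suc(2) by metis
  let ?s = "reflection \<alpha>" and ?t = "T (reflection \<alpha>)"
  have sW: "?s \<in> W" using simple_in_weyl v by blast
  have Tw: "T w = T v \<otimes> ?t" using T_mult[OF v(2) sW] v Suc(2) len_simple by simp
  define u' where "u' = ?s \<circ> u"
  have u'W: "u' \<in> W" unfolding u'_def using weyl_comp sW Suc(4) by blast
  have c: "T v \<in> carrier H" "?t \<in> carrier H" "T u \<in> carrier H" "T u' \<in> carrier H"
    using T_closed v(2) sW Suc(4) u'W by blast+
  have ws: "winv ?s = ?s" using inv_unique_comp reflection_comp_self by blast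
  have wv: "winv w = ?s \<circ> winv v"
    unfolding v(3) using o_inv_distrib[OF weyl_bij[OF v(2)] weyl_bij[OF sW]] ws by simp
  have uu: "u = ?s \<circ> u'" unfolding u'_def by (simp only: comp_assoc[symmetric] reflection_comp_self id_comp)
  have iff: "u = winv w \<longleftrightarrow> u' = winv v"
  proof
    assume "u = winv w"
    then have "u' = (?s \<circ> ?s) \<circ> winv v" unfolding u'_def wv by (simp only: comp_assoc)
    then show "u' = winv v" by (simp only: reflection_comp_self id_comp)
  qed (use uu wv in simp)
  note IH = Suc(1)[of v, OF _ v(2)]
  have IH': "(u' \<noteq> winv v \<longrightarrow> tau (T v \<otimes> T u') = 0) \<and> (u' = winv v \<longrightarrow> unit_const (tau (T v \<otimes> T u')))"
    using IH[OF _ u'W] v(4) by blast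
  consider "len u' = Suc (len u)" | "len u = Suc (len u')"
    using len_left[OF Suc(4) v(1)] unfolding u'_def by blast
  then show ?case
  proof cases
    case 1
    then have "?t \<otimes> T u = T u'" using T_up[OF v(1) Suc(4)] by (simp only: u'_def)
    then have "T w \<otimes> T u = T v \<otimes> T u'" using c by (simp add: Tw m_assoc)
    then show ?thesis using IH' iff by simp
  next
    case 2
    have e: "em (quad_param \<alpha>) \<in> carrier H" "em (quad_param \<alpha> - 1) \<in> carrier H" using quad_param_S S_diff S_one by blast+
    have q: "quad_param \<alpha> \<in> S" "quad_param \<alpha> - 1 \<in> S" using quad_param_S S_diff S_one by blast+
    have "?t \<otimes> T u = T u' \<otimes> em (quad_param \<alpha>) \<oplus> T u \<otimes> em (quad_param \<alpha> - 1)"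
      using T_down[OF v(1) Suc(4)] 2 by (simp only: u'_def)
    then have "T w \<otimes> T u = T v \<otimes> T u' \<otimes> em (quad_param \<alpha>) \<oplus> T v \<otimes> T u \<otimes> em (quad_param \<alpha> - 1)"
      using c e by (simp add: Tw m_assoc r_distr)
    then have coeff: "tau (T w \<otimes> T u) = tau (T v \<otimes> T u') * quad_param \<alpha> + tau (T v \<otimes> T u) * (quad_param \<alpha> - 1)"
      using c q by (simp add: tau_add tau_mult_em)
    \<comment> \<open>Otherwise \<open>u'\<close> would be the inverse of \<open>w\<close> and
      longer than \<open>u\<close>, against the case assumption.\<close>
    have "u \<noteq> winv v"
    proof
      assume vu: "u = winv v"
      then have lu: "len u = k" using len_inv[OF v(2)] v(4) by simp
      have "winv w = u'" unfolding wv vu[symmetric] u'_def ..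
      then have "len u' = Suc k" using len_inv[OF Suc(3)] Suc(2) by simp
      then show False using 2 lu by simp
    qed
    then have "tau (T v \<otimes> T u) = 0" using IH[OF _ Suc(4)] v(4) by blast
    moreover have "unit_const (quad_param \<alpha>)" by (auto simp: unit_const_def quad_param_def)
    ultimately show ?thesis using IH' unit_const_mult iff unfolding coeff by auto
  qed
qed

definition diag_unit :: "('a \<Rightarrow> 'a) \<Rightarrow> 'a \<Rightarrow>\<^sub>0 laurent" where
  "diag_unit w = tau (T w \<otimes> T (winv w))"

lemma diag_unit_const: "w \<in> W \<Longrightarrow> unit_const (diag_unit w)"
  unfolding diag_unit_def using tau_T_T[OF _ weyl_inv] by blast

lemma tau_T_Fil:
  assumes "w \<in> W" "r \<in> Fil (len w)"
  shows "tau (T w \<otimes> r) = 0"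
  using assms(2)
proof (induction r rule: Fil_induct)
  case zero
  then show ?case using T_closed[OF assms(1)] by (simp add: tau_zero)
next
  case (T_em u s)
  have c: "T w \<in> carrier H" "T u \<in> carrier H" "em s \<in> carrier H" using T_closed assms(1) T_em by auto
  have "u \<noteq> winv w" using len_inv[OF assms(1)] T_em(3) by auto
  then have "tau (T w \<otimes> T u) = 0" using tau_T_T[OF assms(1) T_em(1)] by blast
  moreover have "T w \<otimes> (T u \<otimes> em s) = T w \<otimes> T u \<otimes> em s" using c by (simp add: m_assoc)
  ultimately show ?case using c T_em(2) by (simp add: tau_mult_em)
next
  case (add x y)
  then show ?case using T_closed[OF assms(1)] by (simp add: r_distr tau_add)
qed

text \<open>
  With respect to the length of \<open>w\<close> and \<open>u\<close>, the pairing of \<open>T\<^sub>w f\<close> and \<open>T\<^sub>u g\<close> is triangular, with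
  blocks that are unit multiples of the pairing of \<open>f\<close> and \<open>g\<close> on the diagonal.
\<close>

lemma tau_T_em_T_em:
  assumes w: "w \<in> W" and u: "u \<in> W" and f: "f \<in> S" and g: "g \<in> S" and le: "len u \<le> len w"
  shows "tau (T w \<otimes> em f \<otimes> (T u \<otimes> em g)) = (if u = winv w then diag_unit w * act w f * g else 0)"
proof -
  obtain r where r: "r \<in> Fil (len u)" "em f \<otimes> T u = T u \<otimes> em (act (winv u) f) \<oplus> r"
    using em_T[OF u f] by blast
  have aS: "act (winv u) f \<in> S" using S_act[OF weyl_inv[OF u] f] .
  have c: "T w \<in> carrier H" "T u \<in> carrier H" "em f \<in> carrier H" "em g \<in> carrier H"
    "em (act (winv u) f) \<in> carrier H" "r \<in> carrier H"
    using T_closed w u f g aS Fil_closed[OF r(1)] by auto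
  have "T w \<otimes> em f \<otimes> (T u \<otimes> em g) = T w \<otimes> (em f \<otimes> T u) \<otimes> em g" using c by (simp add: m_assoc)
  also have "\<dots> = (T w \<otimes> T u \<otimes> em (act (winv u) f) \<oplus> T w \<otimes> r) \<otimes> em g"
    unfolding r(2) using c by (simp add: m_assoc r_distr)
  finally have "tau (T w \<otimes> em f \<otimes> (T u \<otimes> em g)) =
      (tau (T w \<otimes> T u) * act (winv u) f + tau (T w \<otimes> r)) * g"
    using c aS g by (simp add: tau_mult_em tau_add)
  also have "tau (T w \<otimes> r) = 0" using tau_T_Fil[OF w Fil_mono[OF r(1) le]] .
  finally have eq: "tau (T w \<otimes> em f \<otimes> (T u \<otimes> em g)) = tau (T w \<otimes> T u) * act (winv u) f * g" by simp
  show ?thesis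
  proof (cases "u = winv w")
    case True
    then have "winv u = w" using weyl_bij[OF w] by (simp add: inv_inv_eq)
    then show ?thesis using eq True by (simp add: diag_unit_def)
  next
    case False
    show ?thesis using eq tau_T_T[OF w u] False by simp
  qed
qed

section \<open>The form on the algebra and the functionals that it represents\<close>

definition phi :: "'h \<Rightarrow> 'h" where "phi h = em (alt_quot (tau h))"

abbreviation C :: "'h set" where "C \<equiv> ring_centre H"

lemma centre_em: "z \<in> Z \<Longrightarrow> em z \<in> C"
  by (simp add: centre_eq)

lemma centre_closed: "z \<in> C \<Longrightarrow> z \<in> carrier H"
  by (simp add: ring_centre_def)

lemma centre_commute: "z \<in> C \<Longrightarrow> h \<in> carrier H \<Longrightarrow> z \<otimes> h = h \<otimes> z"
  by (simp add: ring_centre_def)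

lemma subring_centre: "subring C H"
proof (rule subringI)
  show "\<ominus> h \<in> C" if "h \<in> C" for h
    using that unfolding centre_eq by (auto simp: em_uminus[symmetric] Z_S intro!: imageI Z_uminus)
  show "h \<otimes> k \<in> C" if "h \<in> C" "k \<in> C" for h k
    using that unfolding centre_eq by (auto simp: em_mult[symmetric] Z_S intro!: imageI Z_mult)
  show "h \<oplus> k \<in> C" if "h \<in> C" "k \<in> C" for h k
    using that unfolding centre_eq by (auto simp: em_add[symmetric] Z_S intro!: imageI Z_add)
qed (auto simp: ring_centre_def)

lemma phi_centre: "h \<in> carrier H \<Longrightarrow> phi h \<in> C"
  unfolding phi_def by (intro centre_em alt_quot_Z tau_S)

lemma phi_closed: "h \<in> carrier H \<Longrightarrow> phi h \<in> carrier H"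
  using phi_centre centre_closed by blast

lemma phi_add: "h \<in> carrier H \<Longrightarrow> k \<in> carrier H \<Longrightarrow> phi (h \<oplus> k) = phi h \<oplus> phi k"
  by (simp add: phi_def tau_add alt_quot_add tau_S em_add Z_S[OF alt_quot_Z])

lemma phi_mult_centre:
  assumes "h \<in> carrier H" "z \<in> C"
  shows "phi (h \<otimes> z) = phi h \<otimes> z"
proof -
  obtain q where q: "q \<in> Z" "z = em q" using assms(2) unfolding centre_eq by blast
  have "alt_quot (tau h * q) = alt_quot (tau h) * q"
    using alt_quot_mult_Z[OF tau_S[OF assms(1)] q(1)] by (simp add: mult.commute)
  then show ?thesis
    unfolding q(2) phi_def using assms(1) q(1)
    by (simp add: tau_mult_em Z_S em_mult Z_S[OF alt_quot_Z] tau_S)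
qed

text \<open>A version of \<open>Hom_over\<close> without extensionality, so that functionals given
  by lambda terms belong to it without a restriction to the carrier.\<close>

definition Lin :: "('h \<Rightarrow> 'h) set" where
  "Lin = {\<psi>. (\<forall>x\<in>carrier H. \<psi> x \<in> C) \<and>
    (\<forall>x\<in>carrier H. \<forall>y\<in>carrier H. \<psi> (x \<oplus> y) = \<psi> x \<oplus> \<psi> y) \<and>
    (\<forall>z\<in>C. \<forall>x\<in>carrier H. \<psi> (z \<otimes> x) = z \<otimes> \<psi> x)}"

lemma Lin_closed: "\<psi> \<in> Lin \<Longrightarrow> x \<in> carrier H \<Longrightarrow> \<psi> x \<in> C"
  and Lin_closed': "\<psi> \<in> Lin \<Longrightarrow> x \<in> carrier H \<Longrightarrow> \<psi> x \<in> carrier H"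
  and Lin_add: "\<psi> \<in> Lin \<Longrightarrow> x \<in> carrier H \<Longrightarrow> y \<in> carrier H \<Longrightarrow> \<psi> (x \<oplus> y) = \<psi> x \<oplus> \<psi> y"
  and Lin_mult: "\<psi> \<in> Lin \<Longrightarrow> z \<in> C \<Longrightarrow> x \<in> carrier H \<Longrightarrow> \<psi> (z \<otimes> x) = z \<otimes> \<psi> x"
  using centre_closed by (auto simp: Lin_def)

lemma Lin_zero: "\<psi> \<in> Lin \<Longrightarrow> \<psi> \<zero> = \<zero>"
  using Lin_add[of \<psi> \<zero> \<zero>] Lin_closed'[of \<psi> \<zero>] add.l_cancel_one[of "\<psi> \<zero>" "\<psi> \<zero>"] by simp

lemma Lin_finsum:
  assumes "\<psi> \<in> Lin" "finite A" "\<And>i. i \<in> A \<Longrightarrow> f i \<in> carrier H"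
  shows "\<psi> (finsum H f A) = finsum H (\<lambda>i. \<psi> (f i)) A"
  using assms(2,3)
proof (induction A rule: finite_induct)
  case (insert a A)
  have "\<psi> (finsum H f (insert a A)) = \<psi> (f a \<oplus> finsum H f A)"
    using insert by (subst finsum_insert) auto
  also have "\<dots> = \<psi> (f a) \<oplus> finsum H (\<lambda>i. \<psi> (f i)) A"
    using insert by (subst Lin_add[OF assms(1)]) auto
  also have "\<dots> = finsum H (\<lambda>i. \<psi> (f i)) (insert a A)"
    using insert Lin_closed'[OF assms(1)] by (subst finsum_insert) auto
  finally show ?case .
qed (simp add: Lin_zero[OF assms(1)])

lemma phi_Lin: "t \<in> carrier H \<Longrightarrow> (\<lambda>x. phi (x \<otimes> t)) \<in> Lin"
  unfolding Lin_def
proof (intro CollectI conjI ballI)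
  assume t: "t \<in> carrier H"
  show "phi (x \<otimes> t) \<in> C" if "x \<in> carrier H" for x using phi_centre that t by blast
  show "phi ((x \<oplus> y) \<otimes> t) = phi (x \<otimes> t) \<oplus> phi (y \<otimes> t)" if "x \<in> carrier H" "y \<in> carrier H" for x y
    using that t by (simp add: l_distr phi_add)
  show "phi ((z \<otimes> x) \<otimes> t) = z \<otimes> phi (x \<otimes> t)" if z: "z \<in> C" and x: "x \<in> carrier H" for z x
  proof -
    have "z \<otimes> x \<otimes> t = (x \<otimes> t) \<otimes> z"
      using centre_commute[OF z, of "x \<otimes> t"] centre_closed[OF z] x t by (simp add: m_assoc)
    then have "phi (z \<otimes> x \<otimes> t) = phi (x \<otimes> t) \<otimes> z" using phi_mult_centre[OF _ z] x t by simp
    then show ?thesis using centre_commute[OF z phi_closed] x t by simp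
  qed
qed

lemma Lin_diff:
  assumes "\<psi> \<in> Lin" "\<xi> \<in> Lin"
  shows "(\<lambda>x. \<psi> x \<ominus> \<xi> x) \<in> Lin"
  unfolding Lin_def
proof (intro CollectI conjI ballI)
  show "\<psi> x \<ominus> \<xi> x \<in> C" if "x \<in> carrier H" for x
    using Lin_closed[OF assms(1) that] Lin_closed[OF assms(2) that] subring_centre
    by (metis a_minus_def subringE(5,7))
  show "\<psi> (x \<oplus> y) \<ominus> \<xi> (x \<oplus> y) = (\<psi> x \<ominus> \<xi> x) \<oplus> (\<psi> y \<ominus> \<xi> y)"
    if "x \<in> carrier H" "y \<in> carrier H" for x y
    using that assms by (simp add: Lin_add Lin_closed' a_minus_def minus_add a_ac)
  show "\<psi> (z \<otimes> x) \<ominus> \<xi> (z \<otimes> x) = z \<otimes> (\<psi> x \<ominus> \<xi> x)" if "z \<in> C" "x \<in> carrier H" for z x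
    using that assms by (simp add: Lin_mult Lin_closed' centre_closed a_minus_def r_distr r_minus)
qed

text \<open>Perfectness of the form on \<open>S\<close>, applied to the functional that sends
  \<open>f\<close> to \<open>\<psi> (T w \<otimes> em f)\<close>. The representing element is the
  combination of the dual family \<open>b\<close> with the values on \<open>e\<close> as
  coefficients.\<close>

lemma Lin_represent:
  assumes "\<psi> \<in> Lin" "w \<in> W"
  shows "\<exists>g\<in>S. \<forall>f\<in>S. \<psi> (T w \<otimes> em f) = em (alt_quot (f * g))"
proof -
  obtain n and e b :: "nat \<Rightarrow> 'a \<Rightarrow>\<^sub>0 laurent"
    where d: "\<forall>i<n. e i \<in> S" "\<forall>i<n. b i \<in> S"
      "\<forall>i<n. \<forall>j<n. alt_quot (e i * b j) = (if i = j then 1 else 0)"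
      "\<forall>f\<in>S. f = (\<Sum>i<n. alt_quot (f * b i) * e i)"
    by (rule exE[OF dual_bases], elim exE conjE, rule that)
  have eS: "\<And>i. i < n \<Longrightarrow> e i \<in> S" using d(1) by blast
  have bS: "\<And>i. i < n \<Longrightarrow> b i \<in> S" using d(2) by blast
  have expand: "f = (\<Sum>i<n. alt_quot (f * b i) * e i)" if "f \<in> S" for f
    by (rule bspec[OF d(4) that])
  note Tc = T_closed[OF assms(2)]
  have "\<exists>c\<in>Z. \<psi> (T w \<otimes> em (e i)) = em c" if "i < n" for i
    using Lin_closed[OF assms(1), of "T w \<otimes> em (e i)"] eS[OF that] Tc by (auto simp: centre_eq)
  then obtain c where c: "\<And>i. i < n \<Longrightarrow> c i \<in> Z \<and> \<psi> (T w \<otimes> em (e i)) = em (c i)" by metis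
  define g where "g = (\<Sum>i<n. c i * b i)"
  have gS: "g \<in> S" unfolding g_def by (intro S_sum S_mult bS Z_S) (use c in auto)
  have "\<psi> (T w \<otimes> em f) = em (alt_quot (f * g))" if f: "f \<in> S" for f
  proof -
    have zZ: "alt_quot (f * b i) \<in> Z" if "i < n" for i by (intro alt_quot_Z S_mult f bS that)
    have tS: "alt_quot (f * b i) * e i \<in> S" if "i < n" for i by (intro S_mult Z_S[OF zZ] eS that)
    have "T w \<otimes> em f = T w \<otimes> em (\<Sum>i<n. alt_quot (f * b i) * e i)" using expand[OF f] by simp
    also have "\<dots> = T w \<otimes> finsum H (\<lambda>i. em (alt_quot (f * b i) * e i)) {..<n}"
      using tS by (subst em_sum) auto
    also have "\<dots> = finsum H (\<lambda>i. T w \<otimes> em (alt_quot (f * b i) * e i)) {..<n}"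
      using Tc tS by (intro finsum_rdistr) auto
    also have "\<dots> = finsum H (\<lambda>i. em (alt_quot (f * b i)) \<otimes> (T w \<otimes> em (e i))) {..<n}"
    proof (rule finsum_cong'[OF refl])
      fix i assume "i \<in> {..<n}"
      then have i: "i < n" by simp
      have cl: "em (alt_quot (f * b i)) \<in> carrier H" "em (e i) \<in> carrier H" using Z_S[OF zZ[OF i]] eS[OF i] by auto
      have "em (alt_quot (f * b i)) \<otimes> T w = T w \<otimes> em (alt_quot (f * b i))" by (rule em_Z_central[OF zZ[OF i] Tc])
      then show "T w \<otimes> em (alt_quot (f * b i) * e i) = em (alt_quot (f * b i)) \<otimes> (T w \<otimes> em (e i))"
        using cl Tc by (simp add: em_mult Z_S[OF zZ[OF i]] eS[OF i] flip: m_assoc)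
    qed (use Tc Z_S[OF zZ] eS in auto)
    finally have "\<psi> (T w \<otimes> em f) = finsum H (\<lambda>i. \<psi> (em (alt_quot (f * b i)) \<otimes> (T w \<otimes> em (e i)))) {..<n}"
      using Lin_finsum[OF assms(1), of "{..<n}" "\<lambda>i. em (alt_quot (f * b i)) \<otimes> (T w \<otimes> em (e i))"] Tc Z_S[OF zZ] eS
      by auto
    also have "\<dots> = finsum H (\<lambda>i. em (alt_quot (f * b i) * c i)) {..<n}"
    proof (rule finsum_cong'[OF refl])
      fix i assume "i \<in> {..<n}"
      then have i: "i < n" by simp
      show "\<psi> (em (alt_quot (f * b i)) \<otimes> (T w \<otimes> em (e i))) = em (alt_quot (f * b i) * c i)"
        using c[OF i] Lin_mult[OF assms(1) centre_em[OF zZ[OF i]], of "T w \<otimes> em (e i)"] eS[OF i] Tc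
        by (simp add: em_mult Z_S[OF zZ[OF i]] Z_S)
    qed (use zZ c Z_S in \<open>auto intro!: S_mult\<close>)
    also have "\<dots> = em (\<Sum>i<n. alt_quot (f * b i) * c i)"
      by (rule em_sum[symmetric]) (use zZ c Z_S in \<open>auto intro!: S_mult\<close>)
    also have "(\<Sum>i<n. alt_quot (f * b i) * c i) = alt_quot (\<Sum>i<n. c i * (f * b i))"
      using c f bS by (subst alt_quot_sum) (auto simp: S_mult Z_S alt_quot_mult_Z mult.commute)
    also have "(\<Sum>i<n. c i * (f * b i)) = f * g" by (simp add: g_def sum_distrib_left mult.left_commute)
    finally show ?thesis .
  qed
  then show ?thesis using gS by blast
qed

text \<open>Triangular elimination. Outside \<open>A\<close> the functional already vanishes, and no
  element outside \<open>A\<close> is shorter than one inside. For a longest \<open>w\<close> in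
  \<open>A\<close>, a multiple of T_u with \<open>u\<close> inverse to \<open>w\<close> matches the
  functional at \<open>w\<close>. By triangularity it pairs to 0 with the elements outside
  \<open>A\<close>, so subtracting its functional shrinks \<open>A\<close> by
  \<open>w\<close>.\<close>

lemma phi_surj:
  assumes "\<psi> \<in> Lin"
  shows "\<exists>t\<in>carrier H. \<forall>x\<in>carrier H. \<psi> x = phi (x \<otimes> t)"
proof -
  have "\<exists>t\<in>carrier H. \<forall>x\<in>carrier H. \<psi> x = phi (x \<otimes> t)"
    if "\<psi> \<in> Lin" "A \<subseteq> W" "\<And>w u. w \<in> A \<Longrightarrow> u \<in> W - A \<Longrightarrow> len w \<le> len u"
      "\<And>w f. w \<in> W - A \<Longrightarrow> f \<in> S \<Longrightarrow> \<psi> (T w \<otimes> em f) = \<zero>" for A \<psi>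
    using that
  proof (induction "card A" arbitrary: A \<psi>)
    case 0
    then have "A = {}" using finite_weyl finite_subset by (metis card_0_eq)
    have "\<psi> x = phi (x \<otimes> \<zero>)" if "x \<in> carrier H" for x
    proof -
      have "\<psi> x = \<zero>" using that
      proof (induction x rule: hecke_induct)
        case (T_em w s) then show ?case using 0 \<open>A = {}\<close> by simp
      next
        case (add x y) then show ?case using Lin_add[OF 0(2)] by simp
      qed (use Lin_zero[OF 0(2)] in simp)
      then show ?thesis using that by (simp add: phi_def tau_zero alt_quot_zero)
    qed
    then show ?case by blast
  next
    case (Suc k)
    have fA: "finite A" "A \<noteq> {}" using Suc finite_weyl finite_subset by (auto simp: card_gt_0_iff)
    then obtain w where w: "w \<in> A" and max: "\<And>u. u \<in> A \<Longrightarrow> len u \<le> len w"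
      using finite_has_max[OF fA, of "\<lambda>w. real (len w)"] by auto
    have wW: "w \<in> W" using w Suc by blast
    obtain g where g: "g \<in> S" "\<And>f. f \<in> S \<Longrightarrow> \<psi> (T w \<otimes> em f) = em (alt_quot (f * g))"
      using Lin_represent[OF Suc(3) wW] by blast
    obtain q where q: "q \<in> Z" "diag_unit w * q = 1" using unit_const_inverse[OF diag_unit_const[OF wW]] by blast
    have hZ: "diag_unit w \<in> Z" using unit_const_Z[OF diag_unit_const[OF wW]] .
    \<comment> \<open>The pairing with \<open>T w \<otimes> em f\<close> is
      \<open>diag_unit w * act w f * g'\<close>. Here \<open>q\<close> removes the unit,
      \<open>act w g\<close> completes \<open>act w (f * g)\<close>, and \<open>sg w\<close>
      compensates the sign with which \<open>alt_quot\<close> reacts to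
      \<open>act w\<close>.\<close>
    define g' where "g' = sg w * q * act w g"
    have g'S: "g' \<in> S" unfolding g'_def by (intro S_mult sg_S S_act wW g Z_S q)
    define t where "t = T (winv w) \<otimes> em g'"
    have iW: "winv w \<in> W" using weyl_inv[OF wW] .
    have t: "t \<in> carrier H" unfolding t_def using T_closed[OF iW] g'S by blast
    define \<xi> where "\<xi> x = \<psi> x \<ominus> phi (x \<otimes> t)" for x
    have chi: "\<xi> \<in> Lin" unfolding \<xi>_def by (rule Lin_diff[OF Suc(3) phi_Lin[OF t]])
    have ii: "winv u = winv w \<longleftrightarrow> u = w" if "u \<in> W" for u
      using weyl_bij[OF that] weyl_bij[OF wW] by (metis inv_inv_eq)
    have vanish: "\<xi> (T u \<otimes> em f) = \<zero>" if u: "u \<in> W - (A - {w})" and f: "f \<in> S" for u f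
    proof -
      have uW: "u \<in> W" using u by blast
      have le: "len (winv w) \<le> len u"
        using u Suc(5)[OF w, of u] len_inv[OF wW] by (cases "u = w") auto
      have Tf: "T u \<otimes> em f \<in> carrier H" using T_closed[OF uW] f by blast
      have coeff: "tau (T u \<otimes> em f \<otimes> t) = (if winv w = winv u then diag_unit u * act u f * g' else 0)"
        unfolding t_def by (rule tau_T_em_T_em[OF uW iW f g'S le])
      show ?thesis
      proof (cases "u = w")
        case False
        then have "phi (T u \<otimes> em f \<otimes> t) = \<zero>"
          using coeff ii[OF uW] by (metis em_zero alt_quot_zero phi_def)
        moreover have "\<psi> (T u \<otimes> em f) = \<zero>" using Suc(6)[of u f] u f False by blast
        ultimately show ?thesis by (simp add: \<xi>_def)
      next
        case True
        have "diag_unit w * act w f * g' = (diag_unit w * q) * (sg w * act w (f * g))"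
          unfolding g'_def act_mult[OF weyl_bij[OF wW] weyl_linear[OF wW]]
          by (simp only: mult.assoc mult.left_commute)
        then have h: "diag_unit w * act w f * g' = sg w * act w (f * g)" by (simp add: q(2))
        have "alt_quot (tau (T u \<otimes> em f \<otimes> t)) = alt_quot (f * g)"
          using f g wW True unfolding coeff
          by (simp add: h alt_quot_mult_Z Z_sg S_act S_mult alt_quot_act sg_square')
        then have "phi (T u \<otimes> em f \<otimes> t) = \<psi> (T u \<otimes> em f)"
          using g(2)[OF f] True by (simp add: phi_def)
        then show ?thesis using Lin_closed'[OF Suc(3) Tf] by (simp add: \<xi>_def a_minus_def r_neg)
      qed
    qed
    have k: "k = card (A - {w})" using Suc(2) w fA by simp
    have low: "len v \<le> len u" if "v \<in> A - {w}" "u \<in> W - (A - {w})" for v u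
      using that max[of v] Suc(5)[of v u] by (cases "u = w") auto
    obtain t' where t': "t' \<in> carrier H" "\<And>x. x \<in> carrier H \<Longrightarrow> \<xi> x = phi (x \<otimes> t')"
      using Suc(1)[OF k chi _ low vanish] Suc(4) by blast
    have "\<psi> x = phi (x \<otimes> (t' \<oplus> t))" if x: "x \<in> carrier H" for x
    proof -
      have "\<psi> x = \<xi> x \<oplus> phi (x \<otimes> t)"
        using Lin_closed'[OF Suc(3) x] phi_closed[of "x \<otimes> t"] x t
        by (simp add: \<xi>_def a_minus_def a_assoc l_neg)
      then show ?thesis using x t t' by (simp add: r_distr phi_add)
    qed
    then show ?case using t t'(1) by blast
  qed
  from this[OF assms order_refl] show ?thesis by blast
qed

text \<open>For a longest \<open>u\<close> in the support of \<open>t\<close>, the elements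
  \<open>T v \<otimes> em f\<close> with \<open>v\<close> inverse to \<open>u\<close> see only the
  coefficient of \<open>t\<close> at \<open>u\<close>. Nondegeneracy of the form on \<open>S\<close>
  then makes this coefficient 0.\<close>

lemma phi_inj:
  assumes t: "t \<in> carrier H" and z: "\<And>x. x \<in> carrier H \<Longrightarrow> phi (x \<otimes> t) = \<zero>"
  shows "t = \<zero>"
proof -
  have co0: "coeff t w = 0" if w: "w \<in> W" for w
  proof (rule ccontr)
    assume "coeff t w \<noteq> 0"
    then have ne: "{w \<in> W. coeff t w \<noteq> 0} \<noteq> {}" "finite {w \<in> W. coeff t w \<noteq> 0}" using w finite_weyl by auto
    obtain u where u: "u \<in> W" "coeff t u \<noteq> 0"
      and max: "\<And>w'. w' \<in> W \<Longrightarrow> coeff t w' \<noteq> 0 \<Longrightarrow> len w' \<le> len u"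
      using finite_has_max[OF ne(2,1), of "\<lambda>w. real (len w)"] by auto
    have tF: "t \<in> Fil (Suc (len u))" using t max by (auto simp: Fil_def less_Suc_eq_le)
    define v where "v = winv u"
    have v: "v \<in> W" "len v = len u" "winv v = u"
      using weyl_inv[OF u(1)] len_inv[OF u(1)] weyl_bij[OF u(1)] by (auto simp: v_def inv_inv_eq)
    have key: "tau (T v \<otimes> em f \<otimes> h) = diag_unit v * act v f * coeff h u"
      if f: "f \<in> S" and h: "h \<in> Fil (Suc (len u))" for f h
      using h
    proof (induction h rule: Fil_induct)
      case zero
      then show ?case using T_closed[OF v(1)] f by (simp add: tau_zero coeff_zero)
    next
      case (T_em u' s)
      then show ?case
        using tau_T_em_T_em[OF v(1) T_em(1) f T_em(2)] v by (simp add: coeff_T_em)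
    next
      case (add x y)
      then show ?case using T_closed[OF v(1)] f by (simp add: r_distr tau_add coeff_add distrib_left)
    qed
    obtain q where q: "q \<in> Z" "diag_unit v * q = 1" using unit_const_inverse[OF diag_unit_const[OF v(1)]] by blast
    have "coeff t u = 0"
    proof (rule alt_quot_nondegenerate[OF coeff_S[OF t]])
      fix f assume f: "f \<in> S"
      \<comment> \<open>Chosen so that \<open>act v f'\<close> is \<open>q * f\<close>, whose factor
        \<open>q\<close> cancels the unit \<open>diag_unit v\<close>.\<close>
      define f' where "f' = act u (q * f)"
      have f'S: "f' \<in> S" unfolding f'_def by (intro S_act u S_mult Z_S q f)
      have "act v f' = q * f"
        unfolding f'_def v_def using weyl_bij[OF u(1)] weyl_bij[OF weyl_inv[OF u(1)]]
        by (simp add: bij_is_inj flip: act_comp)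
      then have "tau (T v \<otimes> em f' \<otimes> t) = (diag_unit v * q) * (f * coeff t u)"
        using key[OF f'S tF] by (simp add: mult.assoc)
      then have "tau (T v \<otimes> em f' \<otimes> t) = f * coeff t u" by (simp add: q(2))
      moreover have "phi (T v \<otimes> em f' \<otimes> t) = \<zero>"
        using z[of "T v \<otimes> em f'"] T_closed[OF v(1)] f'S by simp
      ultimately have "em (alt_quot (f * coeff t u)) = em 0" by (simp add: phi_def)
      then show "alt_quot (f * coeff t u) = 0"
        using em_inj[OF Z_S[OF alt_quot_Z] S_zero] S_mult[OF f coeff_S[OF t]] by blast
    qed
    then show False using u(2) by simp
  qed
  show ?thesis by (rule coeff_eqI[OF t zero_closed]) (simp add: co0 coeff_zero)
qed

theorem frobenius_form: "frobenius_iso H C (\<lambda>t. restrict (\<lambda>x. phi (x \<otimes> t)) (carrier H))"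
  unfolding frobenius_iso_def
proof (intro conjI ballI)
  let ?F = "\<lambda>t. restrict (\<lambda>x. phi (x \<otimes> t)) (carrier H)"
  show "bij_betw ?F (carrier H) (Hom_over H C)"
  proof (rule bij_betw_imageI)
    show "inj_on ?F (carrier H)"
    proof (rule inj_onI)
      fix t u assume tu: "t \<in> carrier H" "u \<in> carrier H" "?F t = ?F u"
      have "phi (x \<otimes> (t \<ominus> u)) = \<zero>" if x: "x \<in> carrier H" for x
      proof -
        have eq: "phi (x \<otimes> t) = phi (x \<otimes> u)" using fun_cong[OF tu(3), of x] x by simp
        have "phi (x \<otimes> t) = phi (x \<otimes> (t \<ominus> u) \<oplus> x \<otimes> u)"
          using x tu by (simp add: a_minus_def a_assoc l_neg flip: r_distr)
        also have "\<dots> = phi (x \<otimes> (t \<ominus> u)) \<oplus> phi (x \<otimes> u)" using x tu by (intro phi_add) auto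
        finally show ?thesis
          using eq x tu phi_closed add.r_cancel_one by (metis m_closed minus_closed)
      qed
      then have "t \<ominus> u = \<zero>" using phi_inj tu by blast
      then show "t = u" using tu by (simp add: r_right_minus_eq)
    qed
    show "?F ` carrier H = Hom_over H C"
    proof
      show "?F ` carrier H \<subseteq> Hom_over H C"
        using phi_Lin centre_closed by (force simp: Hom_over_def Lin_def)
      show "Hom_over H C \<subseteq> ?F ` carrier H"
      proof
        fix f assume f: "f \<in> Hom_over H C"
        then have "f \<in> Lin" by (auto simp: Hom_over_def Lin_def)
        then obtain t where t: "t \<in> carrier H" "\<And>x. x \<in> carrier H \<Longrightarrow> f x = phi (x \<otimes> t)"
          using phi_surj by blast
        have "f = ?F t"
          using f t by (intro extensionalityI[of f "carrier H"]) (auto simp: Hom_over_def PiE_def)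
        then show "f \<in> ?F ` carrier H" using t(1) by blast
      qed
    qed
  qed
  show "?F (t \<oplus> u) x = ?F t x \<oplus> ?F u x"
    if "t \<in> carrier H" "u \<in> carrier H" "x \<in> carrier H" for t u x
    using that by (simp add: r_distr phi_add)
  show "?F (r \<otimes> t \<otimes> s) x = ?F t (x \<otimes> r) \<otimes> s"
    if "r \<in> carrier H" "t \<in> carrier H" "s \<in> C" "x \<in> carrier H" for r t s x
    using that phi_mult_centre[of "x \<otimes> r \<otimes> t" s] centre_closed[of s] by (simp add: m_assoc)
qed

section \<open>Freeness over the centre\<close>

lemma coeff_finsum:
  assumes "finite A" "\<And>i. i \<in> A \<Longrightarrow> f i \<in> carrier H"
  shows "coeff (finsum H f A) w = (\<Sum>i\<in>A. coeff (f i) w)"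
  using assms
proof (induction A rule: finite_induct)
  case (insert a A)
  then show ?case by (subst finsum_insert) (auto simp: coeff_add)
qed (simp add: coeff_zero)

text \<open>The products of the \<open>T w\<close> with Steinberg's family form a basis. Coordinates
  are obtained by reading off the coefficient at \<open>w\<close> and applying
  \<open>alt_quot\<close> against the dual family.\<close>

theorem free_over_centre: "\<exists>B. finite B \<and> free_basis_over H C B"
proof -
  obtain n and e b :: "nat \<Rightarrow> 'a \<Rightarrow>\<^sub>0 laurent"
    where d: "\<forall>i<n. e i \<in> S" "\<forall>i<n. b i \<in> S"
      "\<forall>i<n. \<forall>j<n. alt_quot (e i * b j) = (if i = j then 1 else 0)"
      "\<forall>f\<in>S. f = (\<Sum>i<n. alt_quot (f * b i) * e i)"
    by (rule exE[OF dual_bases], elim exE conjE, rule that)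
  have eS: "\<And>i. i < n \<Longrightarrow> e i \<in> S" using d(1) by blast
  have bS: "\<And>i. i < n \<Longrightarrow> b i \<in> S" using d(2) by blast
  have dual: "alt_quot (e i * b j) = (if i = j then 1 else 0)" if "i < n" "j < n" for i j
    using d(3) that by blast
  have expand: "f = (\<Sum>i<n. alt_quot (f * b i) * e i)" if "f \<in> S" for f
    by (rule bspec[OF d(4) that])
  have coord: "alt_quot ((\<Sum>i<n. c i * e i) * b j) = c j" if c: "\<And>i. i < n \<Longrightarrow> c i \<in> Z" and j: "j < n" for c j
  proof -
    have "alt_quot ((\<Sum>i<n. c i * e i) * b j) = alt_quot (\<Sum>i<n. c i * (e i * b j))"
      by (simp add: sum_distrib_right mult.assoc)
    also have "\<dots> = (\<Sum>i<n. c i * (if i = j then 1 else 0))"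
      using c j by (subst alt_quot_sum) (auto simp: S_mult Z_S eS bS alt_quot_mult_Z dual intro!: sum.cong)
    also have "\<dots> = c j" using j by (simp add: if_distrib cong: if_cong)
    finally show ?thesis .
  qed
  define I where "I = W \<times> {..<n}"
  define \<beta> where "\<beta> p = T (fst p) \<otimes> em (e (snd p))" for p
  have fI: "finite I" by (simp add: I_def finite_weyl)
  have \<beta>c: "\<beta> p \<in> carrier H" if "p \<in> I" for p
    using that by (auto simp: I_def \<beta>_def T_closed eS)
  have ne: "e i \<noteq> 0" if "i < n" for i
    using dual[OF that that] alt_quot_zero by auto
  \<comment> \<open>A basis is a set in \<open>free_basis_over\<close>, so different indices must
    give different elements.\<close>
  have inj: "inj_on \<beta> I"
  proof (rule inj_onI)
    fix p q assume p: "p \<in> I" and q: "q \<in> I" and eq: "\<beta> p = \<beta> q"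
    obtain w i where wi: "p = (w, i)" "w \<in> W" "i < n" using p by (auto simp: I_def)
    obtain u j where uj: "q = (u, j)" "u \<in> W" "j < n" using q by (auto simp: I_def)
    have "coeff (\<beta> p) w = coeff (\<beta> q) w" using eq by simp
    then have "e i = (if w = u then e j else 0)"
      using wi uj by (simp add: \<beta>_def coeff_T_em eS)
    then have "w = u" "e i = e j" using ne[OF wi(3)] by (auto split: if_splits)
    then have "alt_quot (e j * b i) = 1" using dual[OF wi(3) wi(3)] by simp
    then have "i = j" using dual[OF uj(3) wi(3)] by (metis zero_neq_one)
    then show "p = q" using \<open>w = u\<close> wi uj by simp
  qed
  define B where "B = \<beta> ` I"
  have sum_co: "coeff (finsum H (\<lambda>x. c x \<otimes> x) B) w = (\<Sum>i<n. z (w, i) * e i)"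
    if c: "\<And>p. p \<in> I \<Longrightarrow> z p \<in> Z \<and> c (\<beta> p) = em (z p)" and w: "w \<in> W" for c z w
  proof -
    have cc: "c (\<beta> p) \<in> carrier H" if "p \<in> I" for p using c[OF that] Z_S by auto
    have "finsum H (\<lambda>x. c x \<otimes> x) B = finsum H (\<lambda>p. c (\<beta> p) \<otimes> \<beta> p) I"
      unfolding B_def by (rule finsum_reindex) (use inj cc \<beta>c in auto)
    then have "coeff (finsum H (\<lambda>x. c x \<otimes> x) B) w = (\<Sum>p\<in>I. coeff (c (\<beta> p) \<otimes> \<beta> p) w)"
      using coeff_finsum[OF fI, of "\<lambda>p. c (\<beta> p) \<otimes> \<beta> p" w] cc \<beta>c by simp
    also have "\<dots> = (\<Sum>p\<in>I. if fst p = w then z p * e (snd p) else 0)"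
    proof (rule sum.cong[OF refl])
      fix p assume p: "p \<in> I"
      have zZ: "z p \<in> Z" and pW: "fst p \<in> W" and pn: "snd p < n" using c[OF p] p by (auto simp: I_def)
      have "c (\<beta> p) \<otimes> \<beta> p = T (fst p) \<otimes> em (e (snd p)) \<otimes> em (z p)"
        using c[OF p] em_Z_central[OF zZ \<beta>c[OF p]] by (simp add: \<beta>_def)
      then show "coeff (c (\<beta> p) \<otimes> \<beta> p) w = (if fst p = w then z p * e (snd p) else 0)"
        using T_closed[OF pW] eS[OF pn] Z_S[OF zZ] pW by (auto simp: coeff_mult_em coeff_T mult.commute)
    qed
    also have "\<dots> = (\<Sum>u\<in>W. \<Sum>i<n. if u = w then z (u, i) * e i else 0)"
      unfolding I_def sum.cartesian_product by (rule sum.cong) auto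
    also have "\<dots> = (\<Sum>u\<in>W. if u = w then \<Sum>i<n. z (w, i) * e i else 0)"
      by (rule sum.cong) auto
    also have "\<dots> = (\<Sum>i<n. z (w, i) * e i)" using w finite_weyl by simp
    finally show ?thesis .
  qed
  have Bc: "B \<subseteq> carrier H" using \<beta>c by (auto simp: B_def)
  have "\<exists>!c. c \<in> B \<rightarrow>\<^sub>E C \<and> r = finsum H (\<lambda>x. c x \<otimes> x) B" if r: "r \<in> carrier H" for r
  proof (rule ex_ex1I)
    define z where "z p = alt_quot (coeff r (fst p) * b (snd p))" for p :: "('a \<Rightarrow> 'a) \<times> nat"
    have zZ: "z p \<in> Z" if "p \<in> I" for p
      unfolding z_def using that by (intro alt_quot_Z S_mult coeff_S r bS) (auto simp: I_def)
    define c where "c = restrict (\<lambda>x. em (z (inv_into I \<beta> x))) B"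
    have cz: "c (\<beta> p) = em (z p)" if "p \<in> I" for p
      using that inj by (simp add: c_def B_def)
    have cE: "c \<in> B \<rightarrow>\<^sub>E C"
      unfolding c_def B_def by (auto simp: inj intro!: centre_em zZ)
    have "finsum H (\<lambda>x. c x \<otimes> x) B \<in> carrier H"
      using cE Bc centre_closed by (intro finsum_closed) (auto simp: PiE_def Pi_def)
    then have "r = finsum H (\<lambda>x. c x \<otimes> x) B"
    proof (intro coeff_eqI[OF r])
      fix w assume w: "w \<in> W"
      have "coeff (finsum H (\<lambda>x. c x \<otimes> x) B) w = (\<Sum>i<n. z (w, i) * e i)"
        by (rule sum_co[OF _ w]) (use zZ cz in auto)
      also have "\<dots> = coeff r w" using expand[OF coeff_S[OF r], of w] by (simp add: z_def)
      finally show "coeff r w = coeff (finsum H (\<lambda>x. c x \<otimes> x) B) w" by simp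
    qed
    then show "\<exists>c. c \<in> B \<rightarrow>\<^sub>E C \<and> r = finsum H (\<lambda>x. c x \<otimes> x) B" using cE by blast
  next
    have zval: "c (\<beta> (w, j)) = em (alt_quot (coeff r w * b j))"
      if c: "c \<in> B \<rightarrow>\<^sub>E C" "r = finsum H (\<lambda>x. c x \<otimes> x) B" and w: "w \<in> W" and j: "j < n" for c w j
    proof -
      have "\<exists>z\<in>Z. c (\<beta> p) = em z" if "p \<in> I" for p
        using c(1) that by (auto simp: B_def centre_eq PiE_def Pi_def)
      then obtain z where z: "\<And>p. p \<in> I \<Longrightarrow> z p \<in> Z \<and> c (\<beta> p) = em (z p)" by metis
      have "coeff r w = (\<Sum>i<n. z (w, i) * e i)" 
        unfolding c(2) by (rule sum_co[where z = z]) (use z w in auto)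
      then have "alt_quot (coeff r w * b j) = z (w, j)"
        using coord[of "\<lambda>i. z (w, i)", OF _ j] z w by (simp add: I_def)
      then show ?thesis using z[of "(w, j)"] w j by (simp add: I_def)
    qed
    fix c d assume c: "c \<in> B \<rightarrow>\<^sub>E C \<and> r = finsum H (\<lambda>x. c x \<otimes> x) B"
      and d: "d \<in> B \<rightarrow>\<^sub>E C \<and> r = finsum H (\<lambda>x. d x \<otimes> x) B"
    show "c = d"
    proof (rule PiE_ext)
      show "c \<in> B \<rightarrow>\<^sub>E C" "d \<in> B \<rightarrow>\<^sub>E C" using c d by blast+
      fix x assume "x \<in> B"
      then obtain w j where "x = \<beta> (w, j)" "w \<in> W" "j < n" by (auto simp: B_def I_def)
      then show "c x = d x" using zval[of c w j] zval[of d w j] c d by simp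
    qed
  qed
  then show ?thesis
    using Bc fI unfolding free_basis_over_def by (intro exI[of _ B]) (auto simp: B_def)
qed

theorem free_frobenius: "free_frobenius_extension H C"
  unfolding free_frobenius_extension_def
  using subring_centre free_over_centre frobenius_form ring_axioms by blast

end

section \<open>A non-symmetric example\<close>

definition augment :: "('k \<Rightarrow>\<^sub>0 'c::comm_ring_1) \<Rightarrow> 'c" where
  "augment f = (\<Sum>x\<in>keys f. lookup f x)"

lemma augment_superset: "finite A \<Longrightarrow> keys f \<subseteq> A \<Longrightarrow> augment f = (\<Sum>x\<in>A. lookup f x)"
  unfolding augment_def by (rule sum.mono_neutral_left) (auto simp: in_keys_iff)

lemma augment_add: "augment (f + g) = augment f + augment g"
  using keys_add[of f g]
  by (simp add: augment_superset[of "keys f \<union> keys g"] lookup_add sum.distrib)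

lemma augment_single [simp]: "augment (single x a) = a"
  using augment_superset[of "{x}" "single x a"] by simp

lemma augment_zero [simp]: "augment 0 = 0"
  by (simp add: augment_def)

lemma augment_mult:
  fixes f g :: "'k::ab_group_add \<Rightarrow>\<^sub>0 'c::comm_ring_1"
  shows "augment (f * g) = augment f * augment g"
proof (induction f rule: poly_mapping_induct_single)
  case (single x a)
  show ?case
  proof (induction g rule: poly_mapping_induct_single)
    case (single y b)
    show ?case by (simp add: mult_single)
  qed (simp_all add: distrib_left augment_add)
qed (simp_all add: distrib_right augment_add)

lemma augment_act: "bij w \<Longrightarrow> augment (act w f) = augment f"
  by (induction f rule: poly_mapping_induct_single) (simp_all add: act_add augment_add act_single)

context hecke begin

theorem not_symmetric:
  assumes \<Phi>: "\<Phi> = {\<alpha>, - \<alpha>}" and \<Delta>: "\<Delta> = {\<alpha>}" and L: "L \<alpha> = 0"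
  shows "\<not> symmetric_frobenius_extension H C"
proof
  assume "symmetric_frobenius_extension H C"
  then obtain F \<nu> where F: "frobenius_iso H C F" and \<nu>: "nakayama_automorphism H C F \<nu>"
    and inner: "inner_automorphism H \<nu>"
    by (auto simp: symmetric_frobenius_extension_def)
  obtain u where u: "u \<in> Units H" "\<And>x. x \<in> carrier H \<Longrightarrow> \<nu> x = u \<otimes> x \<otimes> inv u"
    using inner by (auto simp: inner_automorphism_def)
  have uc: "u \<in> carrier H" "inv u \<in> carrier H" using u(1) by auto
  \<comment> \<open>The isomorphism is determined by its value at the unit: \<open>F y x\<close> is
    this functional at \<open>x \<otimes> y\<close>.\<close>
  define \<phi> where "\<phi> = F \<one>"
  have C1: "\<one> \<in> C" by (simp add: ring_centre_def)
  have hom: "\<phi> \<in> Hom_over H C" using F by (auto simp: frobenius_iso_def bij_betw_def \<phi>_def)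
  have Fy: "F y x = \<phi> (x \<otimes> y)" if y: "y \<in> carrier H" and x: "x \<in> carrier H" for x y
  proof -
    have c: "\<phi> (x \<otimes> y) \<in> carrier H"
      using hom x y centre_closed by (auto simp: Hom_over_def PiE_def Pi_def)
    have "F (y \<otimes> \<one> \<otimes> \<one>) x = F \<one> (x \<otimes> y) \<otimes> \<one>"
      using F x y C1 unfolding frobenius_iso_def by blast
    then show ?thesis using x y c by (simp add: \<phi>_def)
  qed
  have \<phi>L: "\<phi> \<in> Lin"
    using hom by (auto simp: Hom_over_def Lin_def)
  have twist: "\<phi> (x \<otimes> y) = \<phi> (u \<otimes> y \<otimes> inv u \<otimes> x)" if "x \<in> carrier H" "y \<in> carrier H" for x y
  proof -
    have "F y x = F x (\<nu> y)" using \<nu> that by (simp add: nakayama_automorphism_def)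
    then show ?thesis using Fy that u(2)[OF that(2)] uc by simp
  qed
  \<comment> \<open>Multiplication by \<open>u\<close> absorbs the inner Nakayama automorphism: the
    new functional is a trace, insensitive to the order of two factors, and it is still linear over
    the centre.\<close>
  define \<psi> where "\<psi> x = \<phi> (u \<otimes> x)" for x
  have \<psi>_add: "\<psi> (x \<oplus> y) = \<psi> x \<oplus> \<psi> y" if "x \<in> carrier H" "y \<in> carrier H" for x y
    using that uc by (simp add: \<psi>_def r_distr Lin_add[OF \<phi>L])
  have \<psi>_C: "\<psi> x \<in> C" if "x \<in> carrier H" for x
    using that uc by (simp add: \<psi>_def Lin_closed[OF \<phi>L])
  have \<psi>_mult: "\<psi> (z \<otimes> x) = z \<otimes> \<psi> x" if "z \<in> C" "x \<in> carrier H" for z x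
  proof -
    have "u \<otimes> (z \<otimes> x) = z \<otimes> (u \<otimes> x)"
      using that uc centre_commute[OF that(1) uc(1)] centre_closed[OF that(1)] by (simp flip: m_assoc)
    then show ?thesis using that uc by (simp add: \<psi>_def Lin_mult[OF \<phi>L])
  qed
  have trace: "\<psi> (x \<otimes> y) = \<psi> (y \<otimes> x)" if "x \<in> carrier H" "y \<in> carrier H" for x y
  proof -
    have "\<psi> (x \<otimes> y) = \<phi> ((u \<otimes> x) \<otimes> y)" using that uc by (simp add: \<psi>_def m_assoc)
    also have "\<dots> = \<phi> (u \<otimes> y \<otimes> inv u \<otimes> (u \<otimes> x))" using that uc by (intro twist) auto
    also have "u \<otimes> y \<otimes> inv u \<otimes> (u \<otimes> x) = u \<otimes> y \<otimes> (inv u \<otimes> u) \<otimes> x" using that uc by (simp add: m_assoc)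
    also have "\<dots> = u \<otimes> (y \<otimes> x)" using that uc u(1) by (simp add: m_assoc)
    finally show ?thesis by (simp add: \<psi>_def)
  qed

  have a\<Delta>: "\<alpha> \<in> \<Delta>" using \<Delta> by simp
  define s where "s = reflection \<alpha>"
  define t where "t = T s"
  have sW: "s \<in> W" unfolding s_def by (rule simple_in_weyl[OF a\<Delta>])
  note sb = weyl_bij[OF sW] and sl = weyl_linear[OF sW]
  have ss: "s (s x) = x" for x by (simp add: s_def)
  have tc: "t \<in> carrier H" unfolding t_def by (rule T_closed[OF sW])
  have s_id: "s \<noteq> id" unfolding s_def using len_simple[OF a\<Delta>] by auto
  have W: "W = {id, s}" using weyl_group_rank_one[of \<alpha>] by (simp only: \<Phi> s_def)
  have act2: "act s (act s f) = f" for f :: "'a \<Rightarrow>\<^sub>0 laurent"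
  proof -
    have "s \<circ> s = id" by (simp only: s_def reflection_comp_self)
    then show ?thesis using act_comp[OF sb sb, of f] by (simp only: act_id)
  qed
  have move: "em f \<otimes> t = t \<otimes> em (act s f)" if f: "f \<in> S" for f
    using bernstein_em[OF a\<Delta> f] L tc S_act[OF sW f] by (auto simp: s_def t_def)
  have tt: "t \<otimes> t = \<one>"
    using T_square[OF a\<Delta>] L tc by (simp add: quad_param_def v_power_def s_def t_def)
  have Z_sym: "f \<in> Z" if "f \<in> S" "act s f = f" for f
    using that by (intro Z_simple) (auto simp: \<Delta> s_def)
  \<comment> \<open>Cyclicity moves \<open>em g\<close> around the product and past
    \<open>t\<close>, so behind \<open>t\<close> an element and its reflection can be exchanged
    under \<open>\<psi>\<close>.\<close>
  have \<psi>t: "\<psi> (t \<otimes> em f) = \<zero>" if f: "f \<in> S" for f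
  proof -
    have swap: "\<psi> (t \<otimes> em (act s g * h)) = \<psi> (t \<otimes> em (g * h))" if "g \<in> S" "h \<in> S" for g h
    proof -
      have gs: "act s g \<in> S" using S_act[OF sW that(1)] .
      have "t \<otimes> em (act s g * h) = t \<otimes> em (act s g) \<otimes> em h"
        using tc gs that by (simp add: em_mult m_assoc)
      also have "\<dots> = em g \<otimes> (t \<otimes> em h)"
        unfolding move[OF that(1), symmetric] using tc that by (simp add: m_assoc)
      finally have "\<psi> (t \<otimes> em (act s g * h)) = \<psi> ((t \<otimes> em h) \<otimes> em g)"
        using trace[of "em g" "t \<otimes> em h"] that tc by simp
      also have "(t \<otimes> em h) \<otimes> em g = t \<otimes> em (g * h)"
        using that tc by (simp add: em_mult m_assoc em_commute)
      finally show ?thesis .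
    qed
    \<comment> \<open>The two monomials of \<open>d\<close> are reflections of each other, so under
      the exchange their contributions cancel.\<close>
    define d :: "'a \<Rightarrow>\<^sub>0 laurent" where "d = E rho - E (s rho)"
    have dS: "d \<in> S" unfolding d_def by (intro S_diff S_single weyl_lattice[OF sW] rho_lattice)
    have sd: "act s d = - d" by (simp add: d_def act_diff act_single sb ss)
    have alt_quot: "\<psi> (t \<otimes> em (d * h)) = \<zero>" if h: "h \<in> S" for h
    proof -
      have E: "E rho \<in> S" "E (s rho) \<in> S" by (auto intro!: S_single weyl_lattice[OF sW] rho_lattice)
      have Eh: "E rho * h \<in> S" "E (s rho) * h \<in> S" using E h S_mult by blast+
      have "t \<otimes> em (E rho * h) = t \<otimes> em (d * h) \<oplus> t \<otimes> em (E (s rho) * h)"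
        using tc Eh S_mult[OF dS h] by (simp add: d_def left_diff_distrib flip: r_distr em_add)
      then have "\<psi> (t \<otimes> em (E rho * h)) = \<psi> (t \<otimes> em (d * h)) \<oplus> \<psi> (t \<otimes> em (E (s rho) * h))"
        using \<psi>_add[of "t \<otimes> em (d * h)" "t \<otimes> em (E (s rho) * h)"] tc Eh S_mult[OF dS h] by simp
      moreover have "\<psi> (t \<otimes> em (E (s rho) * h)) = \<psi> (t \<otimes> em (E rho * h))"
        using swap[OF E(1) h] by (simp add: act_single sb)
      moreover have "\<psi> (t \<otimes> em (d * h)) \<in> carrier H" "\<psi> (t \<otimes> em (E rho * h)) \<in> carrier H"
        using tc Eh S_mult[OF dS h] by (auto intro!: centre_closed[OF \<psi>_C])
      ultimately show ?thesis by (metis add.r_cancel_one)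
    qed
    \<comment> \<open>The reflection changes the sign of \<open>d\<close>, but its square is central
      and can be taken out of \<open>\<psi>\<close> as a scalar. It cancels afterwards because
      \<open>d\<close> is no zero divisor.\<close>
    have d2: "d * d \<in> Z" using Z_sym[OF S_mult[OF dS dS]] by (simp add: act_mult sb sl sd)
    obtain p where p: "p \<in> Z" "\<psi> (t \<otimes> em f) = em p"
      using \<psi>_C[of "t \<otimes> em f"] tc f by (auto simp: centre_eq)
    have "em (d * d) \<otimes> (t \<otimes> em f) = t \<otimes> em f \<otimes> em (d * d)"
      using tc f by (intro em_Z_central[OF d2]) auto
    also have "\<dots> = t \<otimes> em (f * (d * d))"
      using tc f S_mult[OF dS dS] by (simp add: em_mult[OF f S_mult[OF dS dS]] m_assoc)
    also have "f * (d * d) = d * (d * f)" by (simp only: mult.commute mult.left_commute)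
    finally have "em (d * d) \<otimes> (t \<otimes> em f) = t \<otimes> em (d * (d * f))" .
    then have "em (d * d) \<otimes> em p = \<zero>"
      using alt_quot[OF S_mult[OF dS f]] \<psi>_mult[OF centre_em[OF d2], of "t \<otimes> em f"] tc f p(2) by simp
    then have "em (d * d * p) = em 0" using S_mult[OF dS dS] Z_S[OF p(1)] by (simp add: em_mult)
    then have "d * (d * p) = 0"
      using em_inj[OF _ S_zero] S_mult[OF S_mult[OF dS dS] Z_S[OF p(1)]] by (metis mult.assoc)
    moreover have "rho \<noteq> s rho"
      using simple_nonzero[OF a\<Delta>] rho_simple_pos[OF a\<Delta>]
      by (simp add: s_def reflection_def coroot_pairing_def)
    ultimately have "p = 0" using E_diff_nonzero_divisor unfolding d_def by blast
    then show ?thesis using p(2) by simp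
  qed
  have \<psi>s: "\<psi> (em (act s f)) = \<psi> (em f)" if f: "f \<in> S" for f
  proof -
    have fs: "act s f \<in> S" using S_act[OF sW f] .
    have "em (act s f) = t \<otimes> (t \<otimes> em (act s f))" using tc fs tt by (simp flip: m_assoc)
    also have "t \<otimes> em (act s f) = em f \<otimes> t" using move[OF f] by simp
    finally have "\<psi> (em (act s f)) = \<psi> (em f \<otimes> t \<otimes> t)" using trace[of t "em f \<otimes> t"] tc f by simp
    then show ?thesis using tc f tt by (simp add: m_assoc)
  qed
  \<comment> \<open>By invariance under the reflection, twice \<open>\<psi> (em f)\<close> is the
    value at the central element \<open>em (f + act s f)\<close>, hence this scalar times the value
    at the unit. Doubling avoids a division by 2.\<close>
  obtain p where p: "p \<in> Z" "\<psi> \<one> = em p" using \<psi>_C[OF one_closed] by (auto simp: centre_eq)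
  have double: "\<psi> (em f) \<oplus> \<psi> (em f) = em ((f + act s f) * p)" if f: "f \<in> S" for f
  proof -
    have fs: "act s f \<in> S" using S_act[OF sW f] .
    have z: "f + act s f \<in> Z" by (intro Z_sym S_add f fs) (simp add: act_add sb act2 add.commute)
    have "\<psi> (em f) \<oplus> \<psi> (em f) = \<psi> (em (f + act s f) \<otimes> \<one>)"
      using f fs \<psi>_add[of "em f" "em (act s f)"] \<psi>s[OF f] Z_S[OF z] by (simp add: em_add)
    also have "\<dots> = em (f + act s f) \<otimes> em p" using \<psi>_mult[OF centre_em[OF z] one_closed] p(2) by simp
    finally show ?thesis using Z_S[OF z] Z_S[OF p(1)] by (simp add: em_mult)
  qed

  have "restrict phi (carrier H) \<in> Hom_over H C"
    using phi_Lin[OF one_closed] centre_closed by (auto simp: Hom_over_def Lin_def)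
  then have "restrict phi (carrier H) \<in> F ` carrier H"
    using F by (auto simp: frobenius_iso_def bij_betw_def)
  then obtain y where y: "y \<in> carrier H" "restrict phi (carrier H) = F y" by auto
  \<comment> \<open>By cyclicity \<open>\<phi> (x \<otimes> y)\<close> equals
    \<open>\<psi> (x \<otimes> y \<otimes> inv u)\<close>, so the factor \<open>inv u\<close> turns
    a representative for \<open>\<phi>\<close> into one for the trace form.\<close>
  define y' where "y' = y \<otimes> inv u"
  have y'c: "y' \<in> carrier H" using y uc by (simp add: y'_def)
  have rep: "phi x = \<psi> (x \<otimes> y')" if x: "x \<in> carrier H" for x
  proof -
    have "phi x = F y x" using fun_cong[OF y(2), of x] x by simp
    also have "\<dots> = \<phi> (x \<otimes> y)" using Fy[OF y(1) x] .
    also have "x \<otimes> y = u \<otimes> (inv u \<otimes> (x \<otimes> y))" using x y uc u(1) by (simp flip: m_assoc)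
    also have "\<phi> (u \<otimes> (inv u \<otimes> (x \<otimes> y))) = \<psi> ((x \<otimes> y) \<otimes> inv u)"
      using trace[of "inv u" "x \<otimes> y"] x y uc by (simp add: \<psi>_def)
    finally show ?thesis using x y uc by (simp add: y'_def m_assoc)
  qed
  define a c where "a = coeff y' id" and "c = coeff y' s"
  have aS: "a \<in> S" and cS: "c \<in> S" using coeff_S[OF y'c] by (simp_all add: a_def c_def)
  have y': "y' = em a \<oplus> t \<otimes> em c"
    by (rule coeff_eqI[OF y'c])
      (use aS cS tc sW s_id in \<open>auto simp: W coeff_add coeff_em coeff_T_em t_def a_def c_def\<close>)
  \<comment> \<open>Only the component \<open>a\<close> of \<open>y'\<close> counts, because
    \<open>\<psi>\<close> kills everything of the form \<open>t \<otimes> em h\<close>.\<close>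
  have key: "alt_quot f + alt_quot f = (f * a + act s (f * a)) * p" if f: "f \<in> S" for f
  proof -
    have fc: "em f \<in> carrier H" using f by blast
    have fs: "act s f \<in> S" using S_act[OF sW f] .
    have "em f \<otimes> y' = em (f * a) \<oplus> t \<otimes> em (act s f * c)"
      unfolding y' using f aS cS fs tc move[OF f] by (simp add: r_distr em_mult flip: m_assoc)
    then have "\<psi> (em f \<otimes> y') = \<psi> (em (f * a))"
      using \<psi>t[OF S_mult[OF fs cS]] \<psi>_add[of "em (f * a)" "t \<otimes> em (act s f * c)"]
        tc S_mult[OF f aS] S_mult[OF fs cS] centre_closed[OF \<psi>_C[of "em (f * a)"]] by simp
    moreover have "phi (em f) = em (alt_quot f)" using f by (simp add: phi_def tau_def coeff_em)
    ultimately have e: "em (alt_quot f) = \<psi> (em (f * a))" using rep[OF fc] by simp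
    have dS: "alt_quot f \<in> S" using Z_S[OF alt_quot_Z[OF f]] .
    have "em (alt_quot f + alt_quot f) = em ((f * a + act s (f * a)) * p)"
      unfolding em_add[OF dS dS] e by (rule double[OF S_mult[OF f aS]])
    then show ?thesis
      using em_inj dS S_add S_mult S_act[OF sW] f aS Z_S[OF p(1)] by metis
  qed
  have alt: "alternate f = f - act s f" for f
    unfolding alternate_def W using s_id by (simp add: s_def sgn_weyl_reflection a\<Delta>)
  \<comment> \<open>The elements \<open>1\<close> and \<open>E rho\<close> have the same
    augmentation, whereas \<open>alt_quot\<close> takes the values 0 and 1 on them. Under
    \<open>augment\<close> the right-hand sides of \<open>key\<close> agree, the left-hand sides do
    not.\<close>
  have "alt_quot 1 = 0" by (rule alt_quot_unique[OF S_one]) (simp add: alt sb sl)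
  then have 1: "(a + act s a) * p = 0" using key[OF S_one] by simp
  have "pos = {\<alpha>}"
    using simple_pos[OF a\<Delta>] simple_neg[OF a\<Delta>] pos_root \<Phi> by blast
  then have "denom = E rho - E (rho - \<alpha>)"
    by (simp add: denom_def right_diff_distrib mult_single)
  moreover have "s rho = rho - \<alpha>"
    by (simp add: s_def reflection_def coroot_pairing_def rho_inner_simple a\<Delta> simple_nonzero)
  ultimately have "alt_quot (E rho) = 1"
    by (intro alt_quot_unique S_single rho_lattice) (simp add: alt act_single sb)
  then have 2: "2 = (E rho * a + act s (E rho * a)) * p"
    using key[OF S_single[OF rho_lattice], of 1] by simp
  have "augment ((a + act s a) * p) = augment ((E rho * a + act s (E rho * a)) * p)"
    by (simp add: augment_mult augment_add augment_act sb)
  then have "augment (2 :: 'a \<Rightarrow>\<^sub>0 laurent) = 0" unfolding 1 2[symmetric] by simp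
  moreover have "(2 :: 'a \<Rightarrow>\<^sub>0 laurent) = single 0 2" by simp
  ultimately have "(2 :: laurent) = 0" by (metis augment_single)
  then show False by simp
qed

end

section \<open>A concrete Hecke algebra of type A_1 with zero parameter\<close>

lemma (in ring) a_inv_eqI: "x \<in> carrier R \<Longrightarrow> y \<in> carrier R \<Longrightarrow> x \<oplus> y = \<zero> \<Longrightarrow> \<ominus> x = y"
  by (rule minus_equality) (auto simp: a_comm)

definition place :: "'w \<Rightarrow> ('k \<Rightarrow>\<^sub>0 'c::zero) \<Rightarrow> ('w \<times> 'k \<Rightarrow>\<^sub>0 'c)" where
  "place w f = Poly_Mapping.Abs_poly_mapping (\<lambda>p. if fst p = w then lookup f (snd p) else 0)"

lemma lookup_place: "lookup (place w f) (u, x) = (if u = w then lookup f x else 0)"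
proof -
  have "{p. (if fst p = w then lookup f (snd p) else 0) \<noteq> 0} \<subseteq> {w} \<times> keys f"
    by (auto simp: in_keys_iff split: if_splits)
  then have "finite {p. (if fst p = w then lookup f (snd p) else 0) \<noteq> 0}"
    by (rule finite_subset) simp
  then show ?thesis by (simp add: place_def lookup_Abs_poly_mapping)
qed

lemma slice_place: "slice (place w f) u = (if u = w then f else 0)"
  by (rule poly_mapping_eqI) (simp add: lookup_slice lookup_place)

lemma keys_place: "keys (place w f) = {w} \<times> keys f"
  by (auto simp: in_keys_iff lookup_place split: if_splits)

lemma slice_eqI: "(\<And>w. slice c w = slice d w) \<Longrightarrow> c = d"
  by (rule poly_mapping_eqI) (metis lookup_slice surj_pair)

locale rank_one =
  fixes \<alpha> :: "'a::euclidean_space"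
  assumes \<alpha>: "\<alpha> \<noteq> 0"
begin

definition rank_one_roots where "rank_one_roots = {\<alpha>, - \<alpha>}"
abbreviation s where "s \<equiv> reflection \<alpha>"

lemma root_base: "root_base rank_one_roots {\<alpha>}"
proof
  have i: "\<alpha> \<bullet> \<alpha> \<noteq> 0" using \<alpha> by simp
  have "c = 1 \<or> c = -1" if "c *\<^sub>R \<alpha> \<in> rank_one_roots \<or> c *\<^sub>R (- \<alpha>) \<in> rank_one_roots" for c
  proof -
    have "c *\<^sub>R \<alpha> = 1 *\<^sub>R \<alpha> \<or> c *\<^sub>R \<alpha> = (-1) *\<^sub>R \<alpha>"
      using that by (auto simp: rank_one_roots_def minus_equation_iff[of "c *\<^sub>R \<alpha>"])
    then show ?thesis using \<alpha> by (simp only: scaleR_cancel_right) simp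
  qed
  then show "reduced_root_system rank_one_roots"
    using \<alpha> i unfolding reduced_root_system_def
    by (auto simp: rank_one_roots_def reflection_self linear_neg[OF linear_reflection] coroot_pairing_def)
  show "simple_roots rank_one_roots {\<alpha>}"
    unfolding simple_roots_def using \<alpha> by (auto simp: rank_one_roots_def intro!: exI[of _ "\<lambda>_. 1"])
qed

sublocale root_base rank_one_roots "{\<alpha>}" by (rule root_base)

lemma s_not_id: "s \<noteq> id"
proof
  assume "s = id"
  then have "(- \<alpha>) \<bullet> \<alpha> = \<alpha> \<bullet> \<alpha>" using reflection_self[OF \<alpha>] by simp
  then show False using \<alpha> by simp
qed

lemma s_W: "s \<in> W"
  by (simp add: simple_in_weyl)

lemma s_bij: "bij s" and s_linear: "linear s"
  using weyl_bij weyl_linear s_W by blast+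

lemma W_eq: "W = {id, s}"
  unfolding rank_one_roots_def by (rule weyl_group_rank_one)

lemma act_s_act_s: "act s (act s f) = (f :: 'a \<Rightarrow>\<^sub>0 laurent)"
  using act_comp[OF s_bij s_bij, of f] by (simp only: reflection_comp_self act_id)

definition smash_carrier :: "(('a \<Rightarrow> 'a) \<times> 'a \<Rightarrow>\<^sub>0 laurent) set" where "smash_carrier = {c. keys c \<subseteq> W \<times> X}"

text \<open>
  The product \<open>(f\<^sub>0 + T\<^sub>s f\<^sub>1) (g\<^sub>0 + T\<^sub>s g\<^sub>1)\<close> in the algebra with \<open>T\<^sub>s\<^sup>2 = 1\<close> and \<open>f T\<^sub>s = T\<^sub>s s(f)\<close>, to which
  the Hecke algebra reduces for the zero parameter.
\<close>

definition smash_mult where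
  "smash_mult c d = place id (slice c id * slice d id + act s (slice c s) * slice d s)
    + place s (slice c s * slice d id + act s (slice c id) * slice d s)"

definition smash :: "(('a \<Rightarrow> 'a) \<times> 'a \<Rightarrow>\<^sub>0 laurent) ring" where
  "smash = \<lparr>carrier = smash_carrier, monoid.mult = smash_mult, one = single (id, 0) 1, zero = 0, add = (+)\<rparr>"

lemma smash_simps [simp]:
  "carrier smash = smash_carrier" "x \<otimes>\<^bsub>smash\<^esub> y = smash_mult x y" "\<one>\<^bsub>smash\<^esub> = single (id, 0) 1" "\<zero>\<^bsub>smash\<^esub> = 0" "x \<oplus>\<^bsub>smash\<^esub> y = x + y"
  by (simp_all add: smash_def)

lemma slice_smash_mult:
  "slice (smash_mult c d) id = slice c id * slice d id + act s (slice c s) * slice d s"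
  "slice (smash_mult c d) s = slice c s * slice d id + act s (slice c id) * slice d s"
  using s_not_id by (simp_all add: smash_mult_def slice_add slice_place)

lemma slice_outside: "c \<in> smash_carrier \<Longrightarrow> w \<noteq> id \<Longrightarrow> w \<noteq> s \<Longrightarrow> slice c w = 0"
proof (rule poly_mapping_eqI)
  fix x assume "c \<in> smash_carrier" "w \<noteq> id" "w \<noteq> s"
  then have "(w, x) \<notin> keys c" using W_eq by (auto simp: smash_carrier_def)
  then show "lookup (slice c w) x = lookup 0 x" by (simp add: lookup_slice in_keys_iff)
qed

lemma smash_carrier_eqI:
  assumes "c \<in> smash_carrier" "d \<in> smash_carrier" "slice c id = slice d id" "slice c s = slice d s"
  shows "c = d"
  using assms slice_outside by (intro slice_eqI) metis

lemma slice_S: "c \<in> smash_carrier \<Longrightarrow> slice c w \<in> S"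
  unfolding S_def smash_carrier_def by (auto simp: lookup_slice in_keys_iff subset_iff)

lemma smash_carrier_zero: "0 \<in> smash_carrier" and smash_carrier_single: "w \<in> W \<Longrightarrow> x \<in> X \<Longrightarrow> single (w, x) a \<in> smash_carrier"
  and smash_carrier_uminus: "c \<in> smash_carrier \<Longrightarrow> - c \<in> smash_carrier"
  by (auto simp: smash_carrier_def)

lemma smash_carrier_add: "c \<in> smash_carrier \<Longrightarrow> d \<in> smash_carrier \<Longrightarrow> c + d \<in> smash_carrier"
  using keys_add[of c d] by (auto simp: smash_carrier_def)

lemma smash_carrier_place: "w \<in> W \<Longrightarrow> f \<in> S \<Longrightarrow> place w f \<in> smash_carrier"
  by (auto simp: smash_carrier_def S_def keys_place)

lemma smash_carrier_mult: "c \<in> smash_carrier \<Longrightarrow> d \<in> smash_carrier \<Longrightarrow> smash_mult c d \<in> smash_carrier"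
  unfolding smash_mult_def
  by (intro smash_carrier_add smash_carrier_place s_W weyl_group.id S_add S_mult slice_S S_act)

lemma slice_uminus: "slice (- c) w = - slice (c :: 'w \<times> 'k \<Rightarrow>\<^sub>0 'c::ab_group_add) w"
  by (rule poly_mapping_eqI) (simp add: lookup_slice)

lemma one_M: "single (id, 0) 1 \<in> smash_carrier"
  by (intro smash_carrier_single weyl_group.id lattice_zero)

lemma slice_one: "slice (single (id, 0) 1) id = (1 :: 'a \<Rightarrow>\<^sub>0 laurent)"
  "slice (single (id, 0) 1) s = (0 :: 'a \<Rightarrow>\<^sub>0 laurent)"
  using s_not_id by (simp_all add: slice_single)

lemmas act_s = act_add[OF s_bij] act_mult[OF s_bij s_linear] act_uminus[OF s_bij] act_zero[OF s_bij]
  act_one[OF s_bij s_linear] act_single[OF s_bij] act_s_act_s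

text \<open>Equality is tested on the two slices, where every law reduces to the fact that
  \<open>act s\<close> is an involutive automorphism of the group algebra.\<close>

lemma ring_smash: "ring smash"
proof (rule ringI)
  show "abelian_group smash"
  proof (rule abelian_groupI)
    fix x assume "x \<in> carrier smash"
    then show "\<exists>y\<in>carrier smash. y \<oplus>\<^bsub>smash\<^esub> x = \<zero>\<^bsub>smash\<^esub>"
      by (intro bexI[of _ "- x"]) (auto simp: smash_carrier_uminus)
  qed (auto simp: smash_carrier_add smash_carrier_zero add.assoc add.commute)
  show "Group.monoid smash"
  proof (rule monoidI)
    fix x y z assume xyz: "x \<in> carrier smash" "y \<in> carrier smash" "z \<in> carrier smash"
    show "x \<otimes>\<^bsub>smash\<^esub> y \<otimes>\<^bsub>smash\<^esub> z = x \<otimes>\<^bsub>smash\<^esub> (y \<otimes>\<^bsub>smash\<^esub> z)"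
      using xyz by (intro smash_carrier_eqI) (simp_all add: smash_carrier_mult slice_smash_mult act_s algebra_simps)
  next
    fix x assume "x \<in> carrier smash"
    then show "\<one>\<^bsub>smash\<^esub> \<otimes>\<^bsub>smash\<^esub> x = x" "x \<otimes>\<^bsub>smash\<^esub> \<one>\<^bsub>smash\<^esub> = x"
      using one_M by (auto intro!: smash_carrier_eqI simp: smash_carrier_mult slice_smash_mult slice_one act_s)
  qed (auto simp: smash_carrier_mult one_M)
  fix x y z assume xyz: "x \<in> carrier smash" "y \<in> carrier smash" "z \<in> carrier smash"
  then show "(x \<oplus>\<^bsub>smash\<^esub> y) \<otimes>\<^bsub>smash\<^esub> z = x \<otimes>\<^bsub>smash\<^esub> z \<oplus>\<^bsub>smash\<^esub> y \<otimes>\<^bsub>smash\<^esub> z"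
    "z \<otimes>\<^bsub>smash\<^esub> (x \<oplus>\<^bsub>smash\<^esub> y) = z \<otimes>\<^bsub>smash\<^esub> x \<oplus>\<^bsub>smash\<^esub> z \<otimes>\<^bsub>smash\<^esub> y"
    by (auto intro!: smash_carrier_eqI simp: smash_carrier_mult smash_carrier_add slice_smash_mult slice_add act_s algebra_simps)
qed

lemma finsum_smash: "finite I \<Longrightarrow> (\<And>i. i \<in> I \<Longrightarrow> f i \<in> smash_carrier) \<Longrightarrow> finsum smash f I = (\<Sum>i\<in>I. f i)"
proof (induction I rule: finite_induct)
  interpret smash: ring smash by (rule ring_smash)
  case (insert a I)
  have "finsum smash f (insert a I) = f a \<oplus>\<^bsub>smash\<^esub> finsum smash f I"
    using insert by (intro smash.finsum_insert) auto
  then show ?case using insert by simp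
next
  interpret smash: ring smash by (rule ring_smash)
  case empty
  show ?case using smash.finsum_empty by simp
qed

lemma minus_smash: "x \<in> smash_carrier \<Longrightarrow> y \<in> smash_carrier \<Longrightarrow> x \<ominus>\<^bsub>smash\<^esub> y = x - y"
proof -
  interpret smash: ring smash by (rule ring_smash)
  assume "x \<in> smash_carrier" "y \<in> smash_carrier"
  then show ?thesis
    using smash.a_inv_eqI[of y "- y"] smash_carrier_uminus by (simp add: a_minus_def)
qed

text \<open>On basis elements the product is multiplication in the semidirect product of W and the
  lattice, up to scalars. The axioms about \<open>T\<close> and \<open>\<theta>\<close> follow from
  this formula.\<close>

lemma smash_mult_single:
  fixes a b :: laurent
  assumes "w \<in> W" "u \<in> W" "x \<in> X" "y \<in> X"
  shows "smash_mult (single (w, x) a) (single (u, y) b) = single (w \<circ> u, winv u x + y) (a * b)"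
proof -
  have smash_carrier: "single (w \<circ> u, winv u x + y) (a * b) \<in> smash_carrier"
    by (intro smash_carrier_single weyl_comp lattice_add weyl_lattice[OF weyl_inv]) (use assms in auto)
  have sinv: "winv s = s" using inv_unique_comp reflection_comp_self by blast
  have ss: "s \<circ> s = id" by (rule reflection_comp_self)
  from assms consider "w = id" "u = id" | "w = id" "u = s" | "w = s" "u = id" | "w = s" "u = s"
    unfolding W_eq by blast
  then have "slice (smash_mult (single (w, x) a) (single (u, y) b)) id = slice (single (w \<circ> u, winv u x + y) (a * b)) id
    \<and> slice (smash_mult (single (w, x) a) (single (u, y) b)) s = slice (single (w \<circ> u, winv u x + y) (a * b)) s"
    using s_not_id by cases (simp_all add: slice_smash_mult slice_single act_s mult_single sinv ss)
  then show ?thesis using assms by (intro smash_carrier_eqI smash_carrier smash_carrier_mult smash_carrier_single) auto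
qed

abbreviation sc :: "laurent \<Rightarrow> ('a \<Rightarrow> 'a) \<times> 'a \<Rightarrow>\<^sub>0 laurent" where "sc a \<equiv> single (id, 0) a"
abbreviation tw :: "('a \<Rightarrow> 'a) \<Rightarrow> ('a \<Rightarrow> 'a) \<times> 'a \<Rightarrow>\<^sub>0 laurent" where "tw w \<equiv> single (w, 0) 1"
abbreviation th :: "'a \<Rightarrow> ('a \<Rightarrow> 'a) \<times> 'a \<Rightarrow>\<^sub>0 laurent" where "th x \<equiv> single (id, x) 1"

text \<open>The elements are their own coefficient functions, which makes the axiom
  \<open>basis\<close> immediate.\<close>

lemma combination_smash:
  assumes "keys c \<subseteq> W \<times> X"
  shows "hecke_combination smash sc tw th c = c"
proof -
  have t: "sc a \<otimes>\<^bsub>smash\<^esub> (tw w \<otimes>\<^bsub>smash\<^esub> th x) = single (w, x) a" if "w \<in> W" "x \<in> X" for w x a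
    using that linear_0[OF weyl_linear[OF weyl_inv[OF that(1)]]]
    by (simp add: smash_mult_single weyl_group.id lattice_zero)
  have "hecke_combination smash sc tw th c = (\<Sum>p\<in>keys c. case p of (w, x) \<Rightarrow> sc (lookup c (w, x)) \<otimes>\<^bsub>smash\<^esub> (tw w \<otimes>\<^bsub>smash\<^esub> th x))"
    unfolding hecke_combination_def
    using assms t smash_carrier_single by (intro finsum_smash) (auto simp del: smash_simps)
  also have "\<dots> = (\<Sum>p\<in>keys c. single p (lookup c p))"
    using assms t by (intro sum.cong) (auto simp del: smash_simps)
  also have "\<dots> = c" by (rule poly_mapping_single_sum[symmetric])
  finally show ?thesis .
qed

text \<open>With zero parameter the \<open>tw w\<close> multiply as a group, so
  \<open>T_mult\<close> holds whatever the lengths are, and both sides of the Bernstein relation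
  vanish.\<close>

lemma hecke_smash: "hecke rank_one_roots {\<alpha>} (\<lambda>_. 0) smash sc tw th"
proof -
  have w: "id \<in> W" and z: "0 \<in> X" by (auto simp: weyl_group.id lattice_zero)
  have w0: "w 0 = 0" if "w \<in> W" for w using linear_0[OF weyl_linear[OF that]] .
  interpret smash: ring smash by (rule ring_smash)
  have "affine_hecke_algebra_axioms rank_one_roots {\<alpha>} (\<lambda>_. 0) smash sc tw th"
  proof
    fix a b h w u x y \<beta>
    show "sc a \<in> carrier smash" using w z by (simp add: smash_carrier_single)
    show "sc 1 = \<one>\<^bsub>smash\<^esub>" by simp
    show "sc (a + b) = sc a \<oplus>\<^bsub>smash\<^esub> sc b" by (simp add: single_add)
    show "sc (a * b) = sc a \<otimes>\<^bsub>smash\<^esub> sc b" using w z by (simp add: smash_mult_single)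
    show "sc a \<otimes>\<^bsub>smash\<^esub> h = h \<otimes>\<^bsub>smash\<^esub> sc a" if "h \<in> carrier smash"
      using that w z s_not_id
      by (intro smash_carrier_eqI) (auto simp: smash_carrier_mult smash_carrier_single slice_smash_mult slice_single act_s linear_0[OF s_linear] mult.commute)
    show "tw w \<in> carrier smash" if "w \<in> W" using that z by (simp add: smash_carrier_single)
    show "th x \<in> carrier smash" if "x \<in> X" using that w by (simp add: smash_carrier_single)
    show "\<exists>!c. keys c \<subseteq> W \<times> X \<and> h = hecke_combination smash sc tw th c" if "h \<in> carrier smash"
      using that combination_smash by (auto simp: smash_carrier_def)
    show "tw w \<otimes>\<^bsub>smash\<^esub> tw u = tw (w \<circ> u)" if "w \<in> W" "u \<in> W"
      using that z w0[OF weyl_inv[OF that(2)]] by (simp add: smash_mult_single)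
    show "th x \<otimes>\<^bsub>smash\<^esub> th y = th (x + y)" if "x \<in> X" "y \<in> X"
      using that w by (simp add: smash_mult_single)
    show "(tw (reflection \<beta>) \<oplus>\<^bsub>smash\<^esub> \<one>\<^bsub>smash\<^esub>) \<otimes>\<^bsub>smash\<^esub> (tw (reflection \<beta>) \<ominus>\<^bsub>smash\<^esub> sc (v_power (2 * int 0))) = \<zero>\<^bsub>smash\<^esub>"
      if "\<beta> \<in> {\<alpha>}"
    proof -
      have m: "tw s \<in> smash_carrier" "sc 1 \<in> smash_carrier" using s_W w z by (auto simp: smash_carrier_single)
      then have "smash_mult (tw s + sc 1) (tw s - sc 1) = 0"
        using s_not_id smash_carrier_add smash_carrier_uminus[OF m(2)] smash_carrier_add[OF m(1) smash_carrier_uminus[OF m(2)]]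
        by (intro smash_carrier_eqI smash_carrier_mult)
          (auto simp: smash_carrier_zero slice_smash_mult slice_single slice_add slice_uminus diff_conv_add_uminus slice_zero act_s
            linear_0[OF s_linear] simp del: add_uminus_conv_diff)
      then show ?thesis using that m by (simp add: minus_smash v_power_def)
    qed
    show "\<exists>q. keys q \<subseteq> X \<and> q * (1 - single (- \<beta>) 1) = single x 1 - single (reflection \<beta> x) 1 \<and>
        th x \<otimes>\<^bsub>smash\<^esub> tw (reflection \<beta>) \<ominus>\<^bsub>smash\<^esub> tw (reflection \<beta>) \<otimes>\<^bsub>smash\<^esub> th (reflection \<beta> x)
          = sc (v_power (2 * int 0) - 1) \<otimes>\<^bsub>smash\<^esub> theta_embed smash sc th q"
      if "\<beta> \<in> {\<alpha>}" "x \<in> X"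
    proof -
      have b: "\<beta> = \<alpha>" using that by simp
      have sx: "s x \<in> X" using weyl_lattice[OF s_W that(2)] .
      \<comment> \<open>Although its scalar factor is 0, the quotient itself has to be exhibited.
        Divisibility gives it, and \<open>S_factor\<close> keeps its exponents in the
        lattice.\<close>
      have "1 - E (- \<alpha>) dvd E x - act s (E x :: 'a \<Rightarrow>\<^sub>0 laurent)"
        by (rule reflection_diff_dvd[OF _ S_single[OF that(2)]]) (simp add: rank_one_roots_def)
      then obtain q where q: "E x - E (s x) = (1 - E (- \<alpha>)) * (q :: 'a \<Rightarrow>\<^sub>0 laurent)"
        by (auto simp: act_s elim: dvdE)
      have ap: "\<alpha> \<in> pos" by (simp add: simple_pos)
      have "q \<in> S"
      proof (rule S_factor[OF _ _ one_minus_E_top[OF ap]])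
        show "1 - E (- \<alpha>) \<in> S" by (intro S_diff S_one S_single root_lattice) (simp add: rank_one_roots_def)
        show "(1 - E (- \<alpha>)) * q \<in> S"
          unfolding q[symmetric] by (intro S_diff S_single that sx)
      qed
      moreover have "q * (1 - single (- \<alpha>) 1) = single x 1 - single (s x) 1"
        using q by (simp add: mult.commute)
      moreover have "smash_mult (th x) (tw s) = smash_mult (tw s) (th (s x))"
      proof -
        have "winv s = s" using inv_unique_comp reflection_comp_self by blast
        then show ?thesis using s_W w z that sx by (simp add: smash_mult_single)
      qed
      then have "th x \<otimes>\<^bsub>smash\<^esub> tw s \<ominus>\<^bsub>smash\<^esub> tw s \<otimes>\<^bsub>smash\<^esub> th (s x) = 0"
        using minus_smash[OF smash_carrier_mult smash_carrier_mult, of "tw s" "th (s x)" "tw s" "th (s x)"] s_W w z that sx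
        by (simp add: smash_carrier_single)
      moreover have "sc (v_power (2 * int 0) - 1) \<otimes>\<^bsub>smash\<^esub> theta_embed smash sc th q = 0"
      proof -
        have "place u (0 :: 'a \<Rightarrow>\<^sub>0 laurent) = 0" for u :: "'a \<Rightarrow> 'a"
          by (rule slice_eqI) (simp add: slice_place slice_zero)
        then show ?thesis by (simp add: v_power_def smash_mult_def slice_zero act_s)
      qed
      ultimately show ?thesis unfolding b S_def by auto
    qed
  qed
  then show ?thesis
    by (intro hecke.intro affine_hecke_algebra.intro ring_smash root_base)
qed

end

section \<open>Both claims together\<close>

theorem theorem5p2:
  shows
    "(\<forall>(\<Phi> :: 'a::euclidean_space set) \<Delta> L (H :: 'h ring) \<iota> T \<theta>.
        reduced_root_system \<Phi> \<longrightarrow> simple_roots \<Phi> \<Delta> \<longrightarrow> parameter_set \<Phi> \<Delta> L \<longrightarrow>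
        affine_hecke_algebra \<Phi> \<Delta> L H \<iota> T \<theta> \<longrightarrow>
          ring_centre H = theta_invariants \<Phi> H \<iota> \<theta> \<and>
          free_frobenius_extension H (ring_centre H)) \<and>
     (\<exists>(\<Phi> :: 'a set) \<Delta> L (H :: (('a \<Rightarrow> 'a) \<times> 'a \<Rightarrow>\<^sub>0 laurent) ring) \<iota> T \<theta>.
        reduced_root_system \<Phi> \<and> simple_roots \<Phi> \<Delta> \<and> parameter_set \<Phi> \<Delta> L \<and>
        affine_hecke_algebra \<Phi> \<Delta> L H \<iota> T \<theta> \<and>
        free_frobenius_extension H (ring_centre H) \<and>
        \<not> symmetric_frobenius_extension H (ring_centre H))"
proof (intro conjI allI impI)
  fix \<Phi> \<Delta> :: "'a set" and L and H :: "'h ring" and \<iota> T \<theta>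
  assume "reduced_root_system \<Phi>" "simple_roots \<Phi> \<Delta>" and H: "affine_hecke_algebra \<Phi> \<Delta> L H \<iota> T \<theta>"
  then interpret hecke \<Phi> \<Delta> L H \<iota> T \<theta>
    by (intro hecke.intro root_base.intro)
  show "ring_centre H = theta_invariants \<Phi> H \<iota> \<theta>" by (simp only: centre_eq theta_invariants_eq)
  show "free_frobenius_extension H (ring_centre H)" by (rule free_frobenius)
next
  \<comment> \<open>Any nonzero vector and its negative form a system of type A_1, so every
    Euclidean space contains one.\<close>
  obtain \<alpha> :: 'a where "\<alpha> \<noteq> 0" using nonempty_Basis nonzero_Basis by blast
  then interpret rank_one \<alpha> by unfold_locales
  interpret smash: hecke rank_one_roots "{\<alpha>}" "\<lambda>_. 0" smash sc tw th by (rule hecke_smash)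
  have "parameter_set rank_one_roots {\<alpha>} (\<lambda>_. 0)" by (simp add: parameter_set_def)
  moreover have "\<not> symmetric_frobenius_extension smash (ring_centre smash)"
    by (rule smash.not_symmetric) (simp_all add: rank_one_roots_def)
  ultimately show "\<exists>(\<Phi> :: 'a set) \<Delta> L (H :: (('a \<Rightarrow> 'a) \<times> 'a \<Rightarrow>\<^sub>0 laurent) ring) \<iota> T \<theta>.
        reduced_root_system \<Phi> \<and> simple_roots \<Phi> \<Delta> \<and> parameter_set \<Phi> \<Delta> L \<and>
        affine_hecke_algebra \<Phi> \<Delta> L H \<iota> T \<theta> \<and>
        free_frobenius_extension H (ring_centre H) \<and>
        \<not> symmetric_frobenius_extension H (ring_centre H)"
    using root_system base smash.affine_hecke_algebra_axioms smash.free_frobenius by blast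
qed

end
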